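(* Let $G$ be a discrete group, and let $1 \leq p < \infty$. Then $CV_p(G)$ is weak*-simple if and only if $G$ is an ICC group.
   Context: All Banach spaces are complex. Let $\rho_p$ be the right regular representation of $G$ on $\ell^p(G)$, i.e. $(\rho_p(t)\xi)(s)=\xi(st)$. The algebra of $p$-convolution operators is $CV_p(G)=\{T\in \mathcal B(\ell^p(G)) : T\rho_p(t)=\rho_p(t)T \ (t\in G)\}$, where $\mathcal B(\ell^p(G))$ is the algebra of bounded linear operators on $\ell^p(G)$. Weak*-topology on $CV_p(G)$: for $1<p<\infty$ it is the restriction of the weak*-topology of $\mathcal B(\ell^p(G))=(\ell^{p'}(G)\widehat{\otimes}\ell^p(G))^*$ ($1/p+1/p'=1$, $\widehat\otimes$ the projective tensor product), with duality $\langle \sum_j \eta_j\otimes \xi_j, T\rangle=\sum_j\langle \eta_j,T\xi_j\rangle$. For $p=1$, $CV_1(G)$ is identified with the convolution algebra $\ell^1(G)$ via $T\mapsto T\delta_e$ (so $T\xi=(T\delta_e)*\xi$), with the weak*-topology given by $\ell^1(G)=c_0(G)^*$. "Ideal" means two-sided ideal. Such an algebra is weak*-simple if it has no proper, non-zero, weak*-closed ideals. $G$ is an ICC group if every conjugacy class other than $\{e\}$ is infinite. *)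

theory Defs
  imports "HOL-Analysis.Analysis" "HOL-Algebra.Ideal" "HOL-Algebra.Group_Action"
begin

text \<open>
  Functions on a set \<open>S\<close> are represented by functions on the ambient type vanishing off \<open>S\<close>.
\<close>

definition lp_space :: "real \<Rightarrow> 'a set \<Rightarrow> ('a \<Rightarrow> complex) set" where
  "lp_space p S =
     {\<xi>. (\<forall>s. s \<notin> S \<longrightarrow> \<xi> s = 0) \<and> (\<lambda>s. cmod (\<xi> s) powr p) summable_on S}"

definition lp_norm :: "real \<Rightarrow> 'a set \<Rightarrow> ('a \<Rightarrow> complex) \<Rightarrow> real" where
  "lp_norm p S \<xi> = (\<Sum>\<^sub>\<infinity>s\<in>S. cmod (\<xi> s) powr p) powr (1 / p)"

definition c0_space :: "'a set \<Rightarrow> ('a \<Rightarrow> complex) set" where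
  "c0_space S =
     {\<phi>. (\<forall>s. s \<notin> S \<longrightarrow> \<phi> s = 0) \<and> (\<forall>\<epsilon>>0. finite {s \<in> S. \<epsilon> \<le> cmod (\<phi> s)})}"

text \<open>The duality is bilinear (no complex conjugation).\<close>

definition dual_pair :: "'a set \<Rightarrow> ('a \<Rightarrow> complex) \<Rightarrow> ('a \<Rightarrow> complex) \<Rightarrow> complex" where
  "dual_pair S \<eta> \<xi> = (\<Sum>\<^sub>\<infinity>s\<in>S. \<eta> s * \<xi> s)"

text \<open>
  An operator on \<open>\<ell>\<^sup>p(S)\<close> is represented by its extension by zero outside \<open>\<ell>\<^sup>p(S)\<close>, so that equality
  of operators is equality of functions. Since linear maps send 0 to 0, this convention is
  preserved by composition, and by pointwise linear combinations.
\<close>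

definition bounded_ops :: "real \<Rightarrow> 'a set \<Rightarrow> (('a \<Rightarrow> complex) \<Rightarrow> ('a \<Rightarrow> complex)) set" where
  "bounded_ops p S = {T.
     (\<forall>\<xi>\<in>lp_space p S. T \<xi> \<in> lp_space p S) \<and>
     (\<forall>\<xi>. \<xi> \<notin> lp_space p S \<longrightarrow> T \<xi> = (\<lambda>s. 0)) \<and>
     (\<forall>\<xi>\<in>lp_space p S. \<forall>\<zeta>\<in>lp_space p S. T (\<lambda>s. \<xi> s + \<zeta> s) = (\<lambda>s. T \<xi> s + T \<zeta> s)) \<and>
     (\<forall>c. \<forall>\<xi>\<in>lp_space p S. T (\<lambda>s. c * \<xi> s) = (\<lambda>s. c * T \<xi> s)) \<and>
     (\<exists>C. \<forall>\<xi>\<in>lp_space p S. lp_norm p S (T \<xi>) \<le> C * lp_norm p S \<xi>)}"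

definition right_reg ::
  "real \<Rightarrow> ('a, 'b) monoid_scheme \<Rightarrow> 'a \<Rightarrow> ('a \<Rightarrow> complex) \<Rightarrow> ('a \<Rightarrow> complex)" where
  "right_reg p G t \<xi> =
     (if \<xi> \<in> lp_space p (carrier G)
      then (\<lambda>s. if s \<in> carrier G then \<xi> (s \<otimes>\<^bsub>G\<^esub> t) else 0) else (\<lambda>s. 0))"

definition CV ::
  "real \<Rightarrow> ('a, 'b) monoid_scheme \<Rightarrow> (('a \<Rightarrow> complex) \<Rightarrow> ('a \<Rightarrow> complex)) ring" where
  "CV p G =
     \<lparr>carrier = {T \<in> bounded_ops p (carrier G).
                   \<forall>t\<in>carrier G. T \<circ> right_reg p G t = right_reg p G t \<circ> T},
      mult = (\<lambda>T U. T \<circ> U),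
      one = (\<lambda>\<xi>. if \<xi> \<in> lp_space p (carrier G) then \<xi> else (\<lambda>s. 0)),
      zero = (\<lambda>\<xi> s. 0),
      add = (\<lambda>T U \<xi> s. T \<xi> s + U \<xi> s)\<rparr>"

definition initial_topology :: "'x set \<Rightarrow> ('x \<Rightarrow> complex) set \<Rightarrow> 'x topology" where
  "initial_topology X \<Phi> = topology_generated_by {\<phi> -` U \<inter> X | \<phi> U. \<phi> \<in> \<Phi> \<and> open U}"

text \<open>
  Every element of the projective tensor product \<open>\<ell>\<^sup>q(S) \<otimes> \<ell>\<^sup>p(S)\<close> (Banach space completion) is a sum
  \<open>\<Sum>\<^sub>j \<eta>\<^sub>j \<otimes> \<xi>\<^sub>j\<close> with \<open>\<Sum>\<^sub>j \<parallel>\<eta>\<^sub>j\<parallel> \<parallel>\<xi>\<^sub>j\<parallel> < \<infinity>\<close>, and every such series converges. Its elements are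
  represented here by these series. Different series for the same tensor induce the same
  functional on operators, so the topology below is not affected by the choice of representative.
\<close>

definition proj_tensor_series ::
  "real \<Rightarrow> real \<Rightarrow> 'a set \<Rightarrow> ((nat \<Rightarrow> 'a \<Rightarrow> complex) \<times> (nat \<Rightarrow> 'a \<Rightarrow> complex)) set" where
  "proj_tensor_series q p S = {(\<eta>, \<xi>).
     (\<forall>j. \<eta> j \<in> lp_space q S \<and> \<xi> j \<in> lp_space p S) \<and>
     summable (\<lambda>j. lp_norm q S (\<eta> j) * lp_norm p S (\<xi> j))}"

definition tensor_pair ::
  "'a set \<Rightarrow> (nat \<Rightarrow> 'a \<Rightarrow> complex) \<times> (nat \<Rightarrow> 'a \<Rightarrow> complex) \<Rightarrow>
   (('a \<Rightarrow> complex) \<Rightarrow> ('a \<Rightarrow> complex)) \<Rightarrow> complex" where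
  "tensor_pair S = (\<lambda>(\<eta>, \<xi>) T. \<Sum>j. dual_pair S (\<eta> j) (T (\<xi> j)))"

text \<open>For \<open>1 < p\<close>; the conjugate exponent is \<open>p / (p - 1)\<close>.\<close>

definition ops_weak_star ::
  "real \<Rightarrow> 'a set \<Rightarrow> (('a \<Rightarrow> complex) \<Rightarrow> ('a \<Rightarrow> complex)) topology" where
  "ops_weak_star p S =
     initial_topology (bounded_ops p S) (tensor_pair S ` proj_tensor_series (p / (p - 1)) p S)"

definition l1_weak_star :: "'a set \<Rightarrow> ('a \<Rightarrow> complex) topology" where
  "l1_weak_star S = initial_topology (lp_space 1 S) (dual_pair S ` c0_space S)"

definition delta :: "'a \<Rightarrow> 'a \<Rightarrow> complex" where
  "delta t = (\<lambda>s. if s = t then 1 else 0)"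

text \<open>For \<open>p = 1\<close> the topology is transported along \<open>T \<mapsto> T \<delta>\<^sub>e\<close>, which identifies the algebra with
  \<open>\<ell>\<^sup>1(G)\<close>.\<close>

definition CV_weak_star ::
  "real \<Rightarrow> ('a, 'b) monoid_scheme \<Rightarrow> (('a \<Rightarrow> complex) \<Rightarrow> ('a \<Rightarrow> complex)) topology" where
  "CV_weak_star p G =
     (if p = 1
      then pullback_topology (carrier (CV 1 G)) (\<lambda>T. T (delta \<one>\<^bsub>G\<^esub>)) (l1_weak_star (carrier G))
      else subtopology (ops_weak_star p (carrier G)) (carrier (CV p G)))"

definition CV_ideal ::
  "(('a \<Rightarrow> complex) \<Rightarrow> ('a \<Rightarrow> complex)) set \<Rightarrow> real \<Rightarrow> ('a, 'b) monoid_scheme \<Rightarrow> bool" where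
  "CV_ideal I p G \<longleftrightarrow> ideal I (CV p G) \<and> (\<forall>c. \<forall>T\<in>I. (\<lambda>\<xi> s. c * T \<xi> s) \<in> I)"

definition weak_star_simple :: "real \<Rightarrow> ('a, 'b) monoid_scheme \<Rightarrow> bool" where
  "weak_star_simple p G \<longleftrightarrow>
     (\<forall>I. CV_ideal I p G \<and> closedin (CV_weak_star p G) I \<longrightarrow>
          I = {\<zero>\<^bsub>CV p G\<^esub>} \<or> I = carrier (CV p G))"

definition conjugacy_classes :: "('a, 'b) monoid_scheme \<Rightarrow> 'a set set" where
  "conjugacy_classes G = orbits G (carrier G) (\<lambda>g h. g \<otimes>\<^bsub>G\<^esub> h \<otimes>\<^bsub>G\<^esub> inv\<^bsub>G\<^esub> g)"

definition ICC_group :: "('a, 'b) monoid_scheme \<Rightarrow> bool" where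
  "ICC_group G \<longleftrightarrow> group G \<and> (\<forall>C\<in>conjugacy_classes G. C \<noteq> {\<one>\<^bsub>G\<^esub>} \<longrightarrow> infinite C)"

end

theory Submission
  imports Defs
begin

text \<open>
  Every operator \<open>T\<close> in \<open>CV\<^sub>p(G)\<close> is left convolution by its symbol \<open>f = T \<delta>\<^sub>e\<close> (\<open>CV_eq_conv\<close>).  On
  bounded sets the weak* topology only sees matrix coefficients: a norm-bounded net of operators whose
  coefficients converge also converges weak*, for every \<open>p \<ge> 1\<close> (locale \<open>bounded_op_net\<close>).

  Let \<open>G\<close> be an ICC group and \<open>I\<close> a non-zero weak*-closed ideal.  A translate of a non-zero element of \<open>I\<close> is an
  operator \<open>T\<close> in \<open>I\<close> whose symbol satisfies \<open>f(e) \<noteq> 0\<close>.  The conjugates of \<open>T\<close> by the left translations by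
  \<open>x\<close> lie in \<open>I\<close>, are uniformly bounded, and have the symbols \<open>s \<mapsto> f(x\<^sup>-\<^sup>1 s x)\<close>.  Because all
  non-trivial conjugacy classes are infinite, \<open>x\<close> can be chosen so that it conjugates a given finite subset of
  \<open>G - {e}\<close> off itself (\<open>exists_conjugator_avoiding\<close>).  Since \<open>f\<close> vanishes at infinity, the symbols tend to
  \<open>f(e) \<delta>\<^sub>e\<close> along the net of these \<open>x\<close>.  Hence \<open>f(e)\<close> times the identity is in \<open>I\<close>, and \<open>I\<close> is the whole
  algebra.

  Conversely, convolution by a class function \<open>b\<close> in \<open>\<ell>\<^sup>1(G)\<close> is central in \<open>CV\<^sub>p(G)\<close>, so its annihilator is a
  weak*-closed ideal.  It is proper if \<open>b \<noteq> 0\<close>, and non-zero if \<open>b * a = 0\<close> for some \<open>a \<noteq> 0\<close> in \<open>\<ell>\<^sup>1(G)\<close>.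
  A finite conjugacy class \<open>C\<close> of some \<open>x \<noteq> e\<close> provides such zero divisors.

  If \<open>x\<close> has finite order, then \<open>C\<close> generates a finite normal subgroup \<open>N\<close> by Dietzmann's lemma
  (\<open>finite_words\<close>).  The uniform distribution \<open>a\<close> on \<open>N\<close> is an idempotent class function, and
  \<open>b = \<delta>\<^sub>e - a\<close> does it.

  If \<open>x\<close> has infinite order, then a suitable power maps \<open>C\<close> to a finite conjugation-invariant set \<open>D\<close> of commuting
  elements of infinite order.  For \<open>d\<close> in \<open>D\<close> let \<open>v = (d + d\<^sup>-\<^sup>1)/2\<close>, a cosine.  Then
  \<open>1 - v\<^sup>2 = (2 - d\<^sup>2 - d\<^sup>-\<^sup>2)/4\<close> has \<open>\<ell>\<^sup>1\<close>-norm at most \<open>1\<close>, and because the binomial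
  series of \<open>(1 - z)\<^sup>1\<^sup>/\<^sup>2\<close> converges absolutely even at \<open>|z| = 1\<close>, it defines a square root \<open>u\<close> of
  \<open>v\<^sup>2\<close> in \<open>\<ell>\<^sup>1(G)\<close>, the absolute value of the cosine.  So \<open>(u - v) * (u + v) = 0\<close>.  The sum \<open>b\<close> of all
  \<open>u - v\<close> over \<open>D\<close> is a class function; it is annihilated by the product \<open>a\<close> of all \<open>u + v\<close>.  Here \<open>a \<noteq> 0\<close>
  because \<open>a\<close> has augmentation a power of \<open>2\<close>, and \<open>b \<noteq> 0\<close> because its coefficient at \<open>e\<close> has positive real part.
\<close>

section \<open>The spaces \<open>\<ell>\<^sup>p(S)\<close>\<close>

lemma infsum_powr_nonneg: "0 \<le> (\<Sum>\<^sub>\<infinity>s\<in>S. cmod (\<xi> s) powr p)"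
  by (simp add: infsum_nonneg)

lemma lp_norm_nonneg: "0 \<le> lp_norm p S \<xi>"
  by (simp add: lp_norm_def)

lemma lp_norm_powr:
  assumes "1 \<le> p"
  shows "lp_norm p S \<xi> powr p = (\<Sum>\<^sub>\<infinity>s\<in>S. cmod (\<xi> s) powr p)"
  using assms infsum_powr_nonneg[of \<xi> p S] by (simp add: lp_norm_def powr_powr)

lemma lp_norm_leI:
  assumes "1 \<le> p" "0 \<le> C" "(\<Sum>\<^sub>\<infinity>s\<in>S. cmod (\<xi> s) powr p) \<le> C powr p"
  shows "lp_norm p S \<xi> \<le> C"
proof -
  have "lp_norm p S \<xi> \<le> (C powr p) powr (1 / p)"
    unfolding lp_norm_def
    by (rule powr_mono2) (use assms infsum_powr_nonneg[of \<xi> p S] in auto)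
  then show ?thesis using assms by (simp add: powr_powr)
qed

lemma lp_space_off: "\<xi> \<in> lp_space p S \<Longrightarrow> s \<notin> S \<Longrightarrow> \<xi> s = 0"
  by (simp add: lp_space_def)

lemma lp_space_summable: "\<xi> \<in> lp_space p S \<Longrightarrow> (\<lambda>s. cmod (\<xi> s) powr p) summable_on S"
  by (simp add: lp_space_def)

lemma lp_space_finite_support:
  assumes "finite A" "A \<subseteq> S" "\<And>s. s \<notin> A \<Longrightarrow> \<xi> s = 0"
  shows "\<xi> \<in> lp_space p S"
  unfolding lp_space_def
proof (intro CollectI conjI)
  show "(\<lambda>s. cmod (\<xi> s) powr p) summable_on S"
    by (rule finite_nonzero_values_imp_summable_on)
      (rule finite_subset[OF _ assms(1)], use assms in auto)
qed (use assms in auto)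

lemma lp_space_zero: "(\<lambda>s. 0) \<in> lp_space p S"
  by (simp add: lp_space_def)

lemma delta_in_lp_space: "t \<in> S \<Longrightarrow> delta t \<in> lp_space p S"
  by (rule lp_space_finite_support[of "{t}"]) (auto simp: delta_def)

lemma lp_norm_zero: "lp_norm p S (\<lambda>s. 0) = 0"
  by (simp add: lp_norm_def)

lemma lp_space_dominated:
  assumes "\<xi> \<in> lp_space p S" "\<And>s. cmod (\<zeta> s) \<le> cmod (\<xi> s)" "1 \<le> p"
  shows "\<zeta> \<in> lp_space p S"
  unfolding lp_space_def
proof (intro CollectI conjI allI impI)
  show "(\<lambda>s. cmod (\<zeta> s) powr p) summable_on S"
    by (rule summable_on_comparison_test[OF lp_space_summable[OF assms(1)]])
      (use assms in \<open>auto intro: powr_mono2\<close>)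
  fix s assume "s \<notin> S"
  then have "\<xi> s = 0" by (rule lp_space_off[OF assms(1)])
  then show "\<zeta> s = 0" using assms(2)[of s] by simp
qed

lemma norm_le_lp_norm:
  assumes "\<xi> \<in> lp_space p S" "1 \<le> p"
  shows "cmod (\<xi> s) \<le> lp_norm p S \<xi>"
proof (cases "s \<in> S")
  case True
  have "cmod (\<xi> s) powr p \<le> (\<Sum>\<^sub>\<infinity>s\<in>S. cmod (\<xi> s) powr p)"
    using finite_sum_le_infsum[OF lp_space_summable[OF assms(1)], of "{s}"] True by simp
  then have "(cmod (\<xi> s) powr p) powr (1/p) \<le> lp_norm p S \<xi>"
    unfolding lp_norm_def using assms by (intro powr_mono2) auto
  then show ?thesis using assms by (simp add: powr_powr)
next
  case False
  then show ?thesis using lp_space_off[OF assms(1)] by (simp add: lp_norm_nonneg)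
qed

lemma lp_space_scale:
  assumes "\<xi> \<in> lp_space p S"
  shows "(\<lambda>s. c * \<xi> s) \<in> lp_space p S"
  using assms by (auto simp: lp_space_def norm_mult powr_mult intro!: summable_on_cmult_right)

lemma lp_norm_scale:
  assumes "1 \<le> p"
  shows "lp_norm p S (\<lambda>s. c * \<xi> s) = cmod c * lp_norm p S \<xi>"
  using assms
  by (simp add: lp_norm_def norm_mult powr_mult infsum_cmult_right' powr_powr infsum_nonneg)

text \<open>
  One factor \<open>2\<close> comes from \<open>(a + b)\<^sup>p \<le> (2 max a b)\<^sup>p\<close>, the other one from
  \<open>A\<^sup>p + B\<^sup>p \<le> 2 (A + B)\<^sup>p\<close>.  A quasi-triangle inequality is enough to see that sums of bounded
  operators are bounded.
\<close>

lemma lp_space_add: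
  assumes "\<xi> \<in> lp_space p S" "\<zeta> \<in> lp_space p S" "1 \<le> p"
  shows "(\<lambda>s. \<xi> s + \<zeta> s) \<in> lp_space p S"
    and "lp_norm p S (\<lambda>s. \<xi> s + \<zeta> s) \<le> 4 * (lp_norm p S \<xi> + lp_norm p S \<zeta>)"
proof -
  have le: "cmod (\<xi> s + \<zeta> s) powr p \<le> 2 powr p * (cmod (\<xi> s) powr p + cmod (\<zeta> s) powr p)" for s
  proof -
    have "cmod (\<xi> s + \<zeta> s) powr p \<le> (2 * max (cmod (\<xi> s)) (cmod (\<zeta> s))) powr p"
      by (rule powr_mono2) (use assms norm_triangle_ineq[of "\<xi> s" "\<zeta> s"] in auto)
    also have "\<dots> = 2 powr p * max (cmod (\<xi> s)) (cmod (\<zeta> s)) powr p"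
      by (simp add: powr_mult)
    also have "max (cmod (\<xi> s)) (cmod (\<zeta> s)) powr p \<le> cmod (\<xi> s) powr p + cmod (\<zeta> s) powr p"
      by (simp add: max_def)
    finally show ?thesis by simp
  qed
  note s1 = lp_space_summable[OF assms(1)] and s2 = lp_space_summable[OF assms(2)]
  have sb: "(\<lambda>s. 2 powr p * (cmod (\<xi> s) powr p + cmod (\<zeta> s) powr p)) summable_on S"
    by (intro summable_on_cmult_right summable_on_add s1 s2)
  have sm: "(\<lambda>s. cmod (\<xi> s + \<zeta> s) powr p) summable_on S"
    by (rule summable_on_comparison_test[OF sb]) (use le in auto)
  show "(\<lambda>s. \<xi> s + \<zeta> s) \<in> lp_space p S"
    using lp_space_off[OF assms(1)] lp_space_off[OF assms(2)] sm by (simp add: lp_space_def)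
  let ?a = "lp_norm p S \<xi>" and ?b = "lp_norm p S \<zeta>"
  have "(\<Sum>\<^sub>\<infinity>s\<in>S. cmod (\<xi> s + \<zeta> s) powr p)
      \<le> (\<Sum>\<^sub>\<infinity>s\<in>S. 2 powr p * (cmod (\<xi> s) powr p + cmod (\<zeta> s) powr p))"
    by (intro infsum_mono sm sb le)
  also have "\<dots> = 2 powr p * (?a powr p + ?b powr p)"
    using assms(3) by (simp add: infsum_cmult_right' infsum_add s1 s2 lp_norm_powr)
  also have "?a powr p + ?b powr p \<le> (?a + ?b) powr p + (?a + ?b) powr p"
    by (intro add_mono powr_mono2) (use assms in \<open>auto simp: lp_norm_nonneg\<close>)
  also have "\<dots> = 2 powr 1 * (?a + ?b) powr p" by simp
  also have "\<dots> \<le> 2 powr p * (?a + ?b) powr p"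
    by (intro mult_right_mono powr_mono) (use assms in auto)
  also have "2 powr p * (2 powr p * (?a + ?b) powr p) = (2 * (2 * (?a + ?b))) powr p"
    by (simp only: powr_mult)
  finally show "lp_norm p S (\<lambda>s. \<xi> s + \<zeta> s) \<le> 4 * (?a + ?b)"
    using assms by (intro lp_norm_leI) (auto simp: lp_norm_nonneg)
qed

lemma lp_space_sum:
  assumes "finite A" "\<And>i. i \<in> A \<Longrightarrow> \<xi> i \<in> lp_space p S" "1 \<le> p"
  shows "(\<lambda>s. \<Sum>i\<in>A. \<xi> i s) \<in> lp_space p S"
  using assms by (induction A) (auto intro!: lp_space_zero lp_space_add)

definition cut :: "'a set \<Rightarrow> ('a \<Rightarrow> complex) \<Rightarrow> 'a \<Rightarrow> complex" where
  "cut F \<xi> = (\<lambda>s. if s \<in> F then \<xi> s else 0)"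

lemma cut_in_lp_space:
  assumes "\<xi> \<in> lp_space p S" "1 \<le> p"
  shows "cut F \<xi> \<in> lp_space p S"
  by (rule lp_space_dominated[OF assms(1)]) (use assms in \<open>auto simp: cut_def\<close>)

lemma cut_eq_sum_delta:
  assumes "finite F"
  shows "cut F \<xi> = (\<lambda>s. \<Sum>t\<in>F. \<xi> t * delta t s)"
  using assms by (auto simp: cut_def delta_def if_distrib fun_eq_iff cong: if_cong)

lemma cut_add_compl: "(\<lambda>s. cut F \<xi> s + cut (- F) \<xi> s) = \<xi>"
  by (auto simp: cut_def)

text \<open>
  Density of the finitely supported functions; the truncations to finite sets form an approximating net.
\<close>

lemma lp_tail_small:
  assumes "\<xi> \<in> lp_space p S" "1 \<le> p" "0 < \<epsilon>"
  shows "eventually (\<lambda>F. lp_norm p S (cut (- F) \<xi>) \<le> \<epsilon>) (finite_subsets_at_top S)"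
proof -
  note sm = lp_space_summable[OF assms(1)]
  have "eventually (\<lambda>F. dist (\<Sum>s\<in>F. cmod (\<xi> s) powr p) (\<Sum>\<^sub>\<infinity>s\<in>S. cmod (\<xi> s) powr p) < \<epsilon> powr p)
      (finite_subsets_at_top S)"
    by (rule tendstoD[OF infsum_tendsto[OF sm]]) (use assms in auto)
  moreover have "eventually (\<lambda>F. finite F \<and> F \<subseteq> S) (finite_subsets_at_top S)"
    by (rule eventually_finite_subsets_at_top_weakI) auto
  ultimately show ?thesis
  proof eventually_elim
    case (elim F)
    have "(\<Sum>\<^sub>\<infinity>s\<in>S. cmod (cut (- F) \<xi> s) powr p) = (\<Sum>\<^sub>\<infinity>s\<in>S - F. cmod (\<xi> s) powr p)"
      by (rule infsum_cong_neutral) (auto simp: cut_def)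
    also have "\<dots> = (\<Sum>\<^sub>\<infinity>s\<in>S. cmod (\<xi> s) powr p) - (\<Sum>s\<in>F. cmod (\<xi> s) powr p)"
      using elim sm by (subst infsum_Diff) auto
    also have "\<dots> \<le> \<epsilon> powr p" using elim by (simp add: dist_real_def)
    finally show ?case using assms by (intro lp_norm_leI) auto
  qed
qed

lemma lp_tail_smallE:
  assumes "\<xi> \<in> lp_space p S" "1 \<le> p" "0 < \<epsilon>"
  obtains F where "finite F" "F \<subseteq> S" "lp_norm p S (cut (- F) \<xi>) \<le> \<epsilon>"
  using lp_tail_small[OF assms] unfolding eventually_finite_subsets_at_top by blast

text \<open>
  Functions in \<open>\<ell>\<^sup>p(S)\<close> vanish at infinity.
\<close>

lemma lp_level_finite:
  assumes "\<xi> \<in> lp_space p S" "1 \<le> p" "0 < \<epsilon>"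
  shows "finite {s. \<epsilon> \<le> cmod (\<xi> s)}"
proof -
  obtain F where F: "finite F" "F \<subseteq> S" "lp_norm p S (cut (- F) \<xi>) \<le> \<epsilon> / 2"
    using lp_tail_smallE[OF assms(1,2), of "\<epsilon>/2"] assms(3) by auto
  have "{s. \<epsilon> \<le> cmod (\<xi> s)} \<subseteq> F"
  proof
    fix s assume "s \<in> {s. \<epsilon> \<le> cmod (\<xi> s)}"
    moreover have "cmod (cut (- F) \<xi> s) \<le> \<epsilon> / 2"
      using norm_le_lp_norm[OF cut_in_lp_space[OF assms(1,2)] assms(2)] F(3) by (rule order_trans)
    ultimately show "s \<in> F" using assms(3) by (cases "s \<in> F") (auto simp: cut_def)
  qed
  then show ?thesis using F(1) finite_subset by blast
qed

section \<open>Bounded operators and their matrices\<close>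

lemma bounded_opsD:
  assumes "T \<in> bounded_ops p S"
  shows "\<xi> \<in> lp_space p S \<Longrightarrow> T \<xi> \<in> lp_space p S"
    and "\<xi> \<notin> lp_space p S \<Longrightarrow> T \<xi> = (\<lambda>s. 0)"
    and "\<xi> \<in> lp_space p S \<Longrightarrow> \<zeta> \<in> lp_space p S \<Longrightarrow> T (\<lambda>s. \<xi> s + \<zeta> s) = (\<lambda>s. T \<xi> s + T \<zeta> s)"
    and "\<xi> \<in> lp_space p S \<Longrightarrow> T (\<lambda>s. c * \<xi> s) = (\<lambda>s. c * T \<xi> s)"
  using assms by (auto simp: bounded_ops_def)

lemma bounded_ops_zero: "T \<in> bounded_ops p S \<Longrightarrow> T (\<lambda>s. 0) = (\<lambda>s. 0)"
  using bounded_opsD(4)[of T p S "\<lambda>s. 0" 0] lp_space_zero by fastforce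

lemma bounded_ops_bound:
  assumes "T \<in> bounded_ops p S"
  obtains C where "0 < C" "\<And>\<xi>. \<xi> \<in> lp_space p S \<Longrightarrow> lp_norm p S (T \<xi>) \<le> C * lp_norm p S \<xi>"
proof -
  obtain C where C: "\<forall>\<xi>\<in>lp_space p S. lp_norm p S (T \<xi>) \<le> C * lp_norm p S \<xi>"
    using assms by (auto simp: bounded_ops_def)
  have "lp_norm p S (T \<xi>) \<le> (\<bar>C\<bar> + 1) * lp_norm p S \<xi>" if "\<xi> \<in> lp_space p S" for \<xi>
    using C that mult_right_mono[of C "\<bar>C\<bar> + 1" "lp_norm p S \<xi>"] lp_norm_nonneg[of p S \<xi>] by force
  then show ?thesis using that[of "\<bar>C\<bar> + 1"] by simp
qed

lemma bounded_ops_sum: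
  assumes "T \<in> bounded_ops p S" "1 \<le> p" "finite A" "\<And>i. i \<in> A \<Longrightarrow> \<xi> i \<in> lp_space p S"
  shows "T (\<lambda>s. \<Sum>i\<in>A. c i * \<xi> i s) = (\<lambda>s. \<Sum>i\<in>A. c i * T (\<xi> i) s)"
  using assms(3,4)
proof (induction A)
  case empty
  then show ?case using bounded_ops_zero[OF assms(1)] by simp
next
  case (insert i A)
  have "T (\<lambda>s. c i * \<xi> i s + (\<Sum>i\<in>A. c i * \<xi> i s))
      = (\<lambda>s. T (\<lambda>s. c i * \<xi> i s) s + T (\<lambda>s. \<Sum>i\<in>A. c i * \<xi> i s) s)"
    using insert assms(2) by (intro bounded_opsD(3)[OF assms(1)] lp_space_sum lp_space_scale) auto
  then show ?case using insert bounded_opsD(4)[OF assms(1), of "\<xi> i" "c i"] by simp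
qed

lemma bounded_ops_cut:
  assumes "T \<in> bounded_ops p S" "1 \<le> p" "finite F" "F \<subseteq> S"
  shows "T (cut F \<xi>) = (\<lambda>s. \<Sum>t\<in>F. \<xi> t * T (delta t) s)"
  using assms by (simp add: cut_eq_sum_delta bounded_ops_sum delta_in_lp_space subset_iff)

lemma bounded_ops_split:
  assumes "T \<in> bounded_ops p S" "1 \<le> p" "\<xi> \<in> lp_space p S"
  shows "T \<xi> s = T (cut F \<xi>) s + T (cut (- F) \<xi>) s"
  using bounded_opsD(3)[OF assms(1) cut_in_lp_space[OF assms(3,2)] cut_in_lp_space[OF assms(3,2)], of F "- F"]
  by (simp add: cut_add_compl)

text \<open>
  The finite partial sums are the values of \<open>T\<close> at the truncations of \<open>\<xi>\<close>, which converge to \<open>\<xi>\<close>.  In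
  particular \<open>T\<close> is determined by its matrix, and for \<open>T\<close> in \<open>CV\<^sub>p(G)\<close> this sum is a convolution.
\<close>

lemma bounded_ops_has_sum:
  assumes "T \<in> bounded_ops p S" "1 \<le> p" "\<xi> \<in> lp_space p S"
  shows "((\<lambda>t. \<xi> t * T (delta t) s) has_sum T \<xi> s) S"
  unfolding has_sum_def
proof (rule tendstoI)
  fix e :: real assume "0 < e"
  obtain C where C: "0 < C" "\<And>\<xi>. \<xi> \<in> lp_space p S \<Longrightarrow> lp_norm p S (T \<xi>) \<le> C * lp_norm p S \<xi>"
    using bounded_ops_bound[OF assms(1)] by blast
  have "eventually (\<lambda>F. lp_norm p S (cut (- F) \<xi>) \<le> e / (2 * C)) (finite_subsets_at_top S)"
    using C \<open>0 < e\<close> by (intro lp_tail_small assms) auto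
  moreover have "eventually (\<lambda>F. finite F \<and> F \<subseteq> S) (finite_subsets_at_top S)"
    by (rule eventually_finite_subsets_at_top_weakI) auto
  ultimately show "eventually (\<lambda>F. dist (\<Sum>t\<in>F. \<xi> t * T (delta t) s) (T \<xi> s) < e) (finite_subsets_at_top S)"
  proof eventually_elim
    case (elim F)
    have in_lp: "cut (- F) \<xi> \<in> lp_space p S" by (rule cut_in_lp_space) fact+
    have "dist (\<Sum>t\<in>F. \<xi> t * T (delta t) s) (T \<xi> s) = cmod (T (cut (- F) \<xi>) s)"
      using elim bounded_ops_split[OF assms, of s F] bounded_ops_cut[OF assms(1,2), of F \<xi>]
      by (simp add: dist_norm)
    also have "\<dots> \<le> lp_norm p S (T (cut (- F) \<xi>))"
      by (intro norm_le_lp_norm bounded_opsD(1)[OF assms(1)] in_lp assms)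
    also have "\<dots> \<le> C * lp_norm p S (cut (- F) \<xi>)" by (rule C(2)[OF in_lp])
    also have "\<dots> \<le> C * (e / (2 * C))" using elim C(1) by (intro mult_left_mono) auto
    also have "\<dots> < e" using C(1) \<open>0 < e\<close> by simp
    finally show ?case .
  qed
qed

lemma bounded_ops_eqI:
  assumes "T \<in> bounded_ops p S" "U \<in> bounded_ops p S" "1 \<le> p"
    and "\<And>t. t \<in> S \<Longrightarrow> T (delta t) = U (delta t)"
  shows "T = U"
proof
  fix \<xi>
  show "T \<xi> = U \<xi>"
  proof (cases "\<xi> \<in> lp_space p S")
    case True
    have "T \<xi> s = U \<xi> s" for s
    proof (rule has_sum_unique)
      show "((\<lambda>t. \<xi> t * T (delta t) s) has_sum T \<xi> s) S"
        by (rule bounded_ops_has_sum[OF assms(1,3) True])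
      show "((\<lambda>t. \<xi> t * T (delta t) s) has_sum U \<xi> s) S"
        using bounded_ops_has_sum[OF assms(2,3) True, of s]
        by (rule has_sum_cong[THEN iffD2, rotated]) (simp add: assms(4))
    qed
    then show ?thesis by blast
  next
    case False
    then show ?thesis by (simp add: bounded_opsD(2)[OF assms(1)] bounded_opsD(2)[OF assms(2)])
  qed
qed

lemma bounded_opsI:
  assumes "\<And>\<xi>. \<xi> \<in> lp_space p S \<Longrightarrow> T \<xi> \<in> lp_space p S"
    and "\<And>\<xi>. \<xi> \<notin> lp_space p S \<Longrightarrow> T \<xi> = (\<lambda>s. 0)"
    and "\<And>\<xi> \<zeta> s. \<xi> \<in> lp_space p S \<Longrightarrow> \<zeta> \<in> lp_space p S \<Longrightarrow> T (\<lambda>s. \<xi> s + \<zeta> s) s = T \<xi> s + T \<zeta> s"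
    and "\<And>\<xi> c s. \<xi> \<in> lp_space p S \<Longrightarrow> T (\<lambda>s. c * \<xi> s) s = c * T \<xi> s"
    and "\<And>\<xi>. \<xi> \<in> lp_space p S \<Longrightarrow> lp_norm p S (T \<xi>) \<le> C * lp_norm p S \<xi>"
  shows "T \<in> bounded_ops p S"
  unfolding bounded_ops_def using assms by blast

lemma bounded_ops_compose:
  assumes "T \<in> bounded_ops p S" "U \<in> bounded_ops p S"
  shows "T \<circ> U \<in> bounded_ops p S"
proof -
  obtain C where C: "0 < C" "\<And>\<xi>. \<xi> \<in> lp_space p S \<Longrightarrow> lp_norm p S (T \<xi>) \<le> C * lp_norm p S \<xi>"
    using bounded_ops_bound[OF assms(1)] by blast
  obtain D where D: "0 < D" "\<And>\<xi>. \<xi> \<in> lp_space p S \<Longrightarrow> lp_norm p S (U \<xi>) \<le> D * lp_norm p S \<xi>"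
    using bounded_ops_bound[OF assms(2)] by blast
  show ?thesis
  proof (rule bounded_opsI[where C = "C * D"])
    fix \<xi> assume \<xi>: "\<xi> \<in> lp_space p S"
    have "lp_norm p S (T (U \<xi>)) \<le> C * lp_norm p S (U \<xi>)"
      by (intro C bounded_opsD[OF assms(2)] \<xi>)
    also have "\<dots> \<le> C * (D * lp_norm p S \<xi>)" using C(1) D(2)[OF \<xi>] by simp
    finally show "lp_norm p S ((T \<circ> U) \<xi>) \<le> C * D * lp_norm p S \<xi>" by simp
  qed (simp_all add: bounded_opsD[OF assms(1)] bounded_opsD[OF assms(2)] bounded_ops_zero[OF assms(1)])
qed

lemma bounded_ops_add:
  assumes "T \<in> bounded_ops p S" "U \<in> bounded_ops p S" "1 \<le> p"
  shows "(\<lambda>\<xi> s. T \<xi> s + U \<xi> s) \<in> bounded_ops p S"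
proof -
  obtain C where C: "0 < C" "\<And>\<xi>. \<xi> \<in> lp_space p S \<Longrightarrow> lp_norm p S (T \<xi>) \<le> C * lp_norm p S \<xi>"
    using bounded_ops_bound[OF assms(1)] by blast
  obtain D where D: "0 < D" "\<And>\<xi>. \<xi> \<in> lp_space p S \<Longrightarrow> lp_norm p S (U \<xi>) \<le> D * lp_norm p S \<xi>"
    using bounded_ops_bound[OF assms(2)] by blast
  show ?thesis
  proof (rule bounded_opsI[where C = "4 * (C + D)"])
    fix \<xi> assume \<xi>: "\<xi> \<in> lp_space p S"
    have "lp_norm p S (\<lambda>s. T \<xi> s + U \<xi> s) \<le> 4 * (lp_norm p S (T \<xi>) + lp_norm p S (U \<xi>))"
      by (intro lp_space_add bounded_opsD[OF assms(1)] bounded_opsD[OF assms(2)] \<xi> assms)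
    also have "\<dots> \<le> 4 * (C + D) * lp_norm p S \<xi>"
      using C(2)[OF \<xi>] D(2)[OF \<xi>] by (simp add: algebra_simps)
    finally show "lp_norm p S (\<lambda>s. T \<xi> s + U \<xi> s) \<le> 4 * (C + D) * lp_norm p S \<xi>" .
    show "(\<lambda>s. T \<xi> s + U \<xi> s) \<in> lp_space p S"
      by (intro lp_space_add bounded_opsD[OF assms(1)] bounded_opsD[OF assms(2)] \<xi> assms)
  qed (simp_all add: bounded_opsD[OF assms(1)] bounded_opsD[OF assms(2)] algebra_simps)
qed

lemma bounded_ops_scale:
  assumes "T \<in> bounded_ops p S" "1 \<le> p"
  shows "(\<lambda>\<xi> s. c * T \<xi> s) \<in> bounded_ops p S"
proof -
  obtain C where C: "0 < C" "\<And>\<xi>. \<xi> \<in> lp_space p S \<Longrightarrow> lp_norm p S (T \<xi>) \<le> C * lp_norm p S \<xi>"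
    using bounded_ops_bound[OF assms(1)] by blast
  show ?thesis
  proof (rule bounded_opsI[where C = "cmod c * C"])
    fix \<xi> assume \<xi>: "\<xi> \<in> lp_space p S"
    show "lp_norm p S (\<lambda>s. c * T \<xi> s) \<le> cmod c * C * lp_norm p S \<xi>"
      using mult_left_mono[OF C(2)[OF \<xi>], of "cmod c"] assms by (simp add: lp_norm_scale mult.assoc)
  qed (simp_all add: lp_space_scale bounded_opsD[OF assms(1)] algebra_simps)
qed


section \<open>Duality\<close>

text \<open>
  Hoelder's inequality up to the constant \<open>2\<close>: for vectors of norm \<open>1\<close>, sum
  Young's inequality \<open>x y \<le> x\<^sup>q/q + y\<^sup>p/p\<close>, with the factors \<open>1/q\<close> and \<open>1/p\<close> estimated by \<open>1\<close>.
\<close>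

lemma lp_hoelder:
  assumes "1 < p" "\<eta> \<in> lp_space (p / (p - 1)) S" "\<xi> \<in> lp_space p S"
  shows "(\<lambda>s. cmod (\<eta> s * \<xi> s)) summable_on S"
    and "cmod (dual_pair S \<eta> \<xi>) \<le> 2 * lp_norm (p / (p - 1)) S \<eta> * lp_norm p S \<xi>"
proof -
  define q where "q = p / (p - 1)"
  have q: "1 < q" "1 / q + 1 / p = 1" using assms(1) by (auto simp: q_def field_simps)
  note [simp] = lp_norm_nonneg
  let ?N = "lp_norm q S \<eta>" and ?M = "lp_norm p S \<xi>"
  have \<eta>: "\<eta> \<in> lp_space q S" using assms q_def by simp
  have bnd: "(\<lambda>s. cmod (\<eta> s * \<xi> s)) summable_on S
      \<and> (\<Sum>\<^sub>\<infinity>s\<in>S. cmod (\<eta> s * \<xi> s)) \<le> 2 * ?N * ?M"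
  proof (cases "?N = 0 \<or> ?M = 0")
    case True
    then have "\<eta> s * \<xi> s = 0" for s
      using norm_le_lp_norm[OF \<eta>, of s] norm_le_lp_norm[OF assms(3), of s] q assms(1) by auto
    then have "(\<lambda>s. cmod (\<eta> s * \<xi> s)) = (\<lambda>s. 0)" by (metis norm_zero)
    then show ?thesis by (simp only:) (simp add: infsum_0)
  next
    case False
    then have pos: "0 < ?N" "0 < ?M" using lp_norm_nonneg by (auto simp: less_le)
    let ?g = "\<lambda>s. (?N * ?M) * (cmod (\<eta> s) powr q / ?N powr q + cmod (\<xi> s) powr p / ?M powr p)"
    have le: "cmod (\<eta> s * \<xi> s) \<le> ?g s" for s
    proof -
      have "(cmod (\<eta> s) / ?N) * (cmod (\<xi> s) / ?M)
          \<le> (cmod (\<eta> s) / ?N) powr q / q + (cmod (\<xi> s) / ?M) powr p / p"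
        using q assms(1) pos by (intro Youngs_inequality) auto
      also have "\<dots> \<le> (cmod (\<eta> s) / ?N) powr q + (cmod (\<xi> s) / ?M) powr p"
        using q(1) assms(1) by (intro add_mono) (auto simp: divide_le_eq mult_le_cancel_left1)
      also have "\<dots> = cmod (\<eta> s) powr q / ?N powr q + cmod (\<xi> s) powr p / ?M powr p"
        by (simp add: powr_divide)
      finally have "(?N * ?M) * ((cmod (\<eta> s) / ?N) * (cmod (\<xi> s) / ?M)) \<le> ?g s"
        using pos by (intro mult_left_mono) auto
      then show ?thesis using pos by (simp add: norm_mult field_simps)
    qed
    note s1 = lp_space_summable[OF \<eta>] and s2 = lp_space_summable[OF assms(3)]
    have sg: "?g summable_on S"
      by (intro summable_on_cmult_right summable_on_add) (auto simp: divide_inverse intro!: summable_on_cmult_left s1 s2)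
    have sm: "(\<lambda>s. cmod (\<eta> s * \<xi> s)) summable_on S"
      by (rule summable_on_comparison_test[OF sg]) (use le in auto)
    have "(\<Sum>\<^sub>\<infinity>s\<in>S. cmod (\<eta> s * \<xi> s)) \<le> infsum ?g S"
      by (intro infsum_mono sm sg le)
    also have "infsum ?g S = (?N * ?M) * (?N powr q / ?N powr q + ?M powr p / ?M powr p)"
      using s1 s2 q(1) assms(1)
      by (simp add: infsum_cmult_right' infsum_add lp_norm_powr divide_inverse
          summable_on_cmult_left infsum_cmult_left')
    also have "\<dots> = 2 * ?N * ?M" using pos by simp
    finally show ?thesis using sm by simp
  qed
  then show "(\<lambda>s. cmod (\<eta> s * \<xi> s)) summable_on S" by simp
  then have "cmod (dual_pair S \<eta> \<xi>) \<le> (\<Sum>\<^sub>\<infinity>s\<in>S. cmod (\<eta> s * \<xi> s))"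
    unfolding dual_pair_def by (rule norm_infsum_bound)
  then show "cmod (dual_pair S \<eta> \<xi>) \<le> 2 * lp_norm (p / (p - 1)) S \<eta> * lp_norm p S \<xi>"
    using bnd q_def by simp
qed

text \<open>
  The functionals that are uniformly approximated by finitely many coordinates.  This is the common property of
  the elements of \<open>\<ell>\<^sup>q(S)\<close> for \<open>p > 1\<close> and of \<open>c\<^sub>0(S)\<close> for \<open>p = 1\<close> that makes the weak* topology
  coordinatewise on bounded sets.
\<close>

definition tight :: "real \<Rightarrow> 'a set \<Rightarrow> ('a \<Rightarrow> complex) \<Rightarrow> bool" where
  "tight p S \<eta> \<longleftrightarrow>
     (\<forall>\<zeta>\<in>lp_space p S. (\<lambda>s. cmod (\<eta> s * \<zeta> s)) summable_on S) \<and>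
     (\<forall>\<epsilon>>0. \<exists>E. finite E \<and> E \<subseteq> S \<and>
        (\<forall>\<zeta>\<in>lp_space p S. cmod (dual_pair S (cut (- E) \<eta>) \<zeta>) \<le> \<epsilon> * lp_norm p S \<zeta>))"

lemma tight_lp:
  assumes "1 < p" "\<eta> \<in> lp_space (p / (p - 1)) S"
  shows "tight p S \<eta>"
  unfolding tight_def
proof (intro conjI ballI allI impI)
  show "(\<lambda>s. cmod (\<eta> s * \<zeta> s)) summable_on S" if "\<zeta> \<in> lp_space p S" for \<zeta>
    by (rule lp_hoelder(1)[OF assms that])
  fix \<epsilon> :: real assume "0 < \<epsilon>"
  have q: "1 \<le> p / (p - 1)" using assms(1) by simp
  obtain E where E: "finite E" "E \<subseteq> S" "lp_norm (p / (p - 1)) S (cut (- E) \<eta>) \<le> \<epsilon> / 2"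
    using lp_tail_smallE[OF assms(2) q, of "\<epsilon> / 2"] \<open>0 < \<epsilon>\<close> by auto
  have "cmod (dual_pair S (cut (- E) \<eta>) \<zeta>) \<le> \<epsilon> * lp_norm p S \<zeta>" if \<zeta>: "\<zeta> \<in> lp_space p S" for \<zeta>
  proof -
    have "cmod (dual_pair S (cut (- E) \<eta>) \<zeta>)
        \<le> 2 * lp_norm (p / (p - 1)) S (cut (- E) \<eta>) * lp_norm p S \<zeta>"
      by (rule lp_hoelder(2)[OF assms(1) cut_in_lp_space[OF assms(2) q] \<zeta>])
    also have "\<dots> \<le> \<epsilon> * lp_norm p S \<zeta>"
      using E(3) by (intro mult_right_mono) (auto simp: lp_norm_nonneg)
    finally show ?thesis .
  qed
  then show "\<exists>E. finite E \<and> E \<subseteq> S \<and>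
        (\<forall>\<zeta>\<in>lp_space p S. cmod (dual_pair S (cut (- E) \<eta>) \<zeta>) \<le> \<epsilon> * lp_norm p S \<zeta>)"
    using E by blast
qed

lemma l1_summable: "\<zeta> \<in> lp_space 1 S \<Longrightarrow> (\<lambda>s. cmod (\<zeta> s)) summable_on S"
  using lp_space_summable[of \<zeta> 1 S] by simp

lemma l1_norm: "lp_norm 1 S \<zeta> = (\<Sum>\<^sub>\<infinity>s\<in>S. cmod (\<zeta> s))"
  by (simp add: lp_norm_def infsum_nonneg)

lemma l1_bounded_product:
  assumes "\<zeta> \<in> lp_space 1 S" "\<And>s. cmod (\<eta> s) \<le> M"
  shows "(\<lambda>s. cmod (\<eta> s * \<zeta> s)) summable_on S"
    and "(\<Sum>\<^sub>\<infinity>s\<in>S. cmod (\<eta> s * \<zeta> s)) \<le> M * lp_norm 1 S \<zeta>"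
    and "cmod (dual_pair S \<eta> \<zeta>) \<le> M * lp_norm 1 S \<zeta>"
proof -
  have le: "cmod (\<eta> s * \<zeta> s) \<le> M * cmod (\<zeta> s)" for s
    by (simp add: norm_mult mult_right_mono assms)
  have sM: "(\<lambda>s. M * cmod (\<zeta> s)) summable_on S"
    by (intro summable_on_cmult_right l1_summable assms)
  show sm: "(\<lambda>s. cmod (\<eta> s * \<zeta> s)) summable_on S"
    by (rule summable_on_comparison_test[OF sM]) (use le in auto)
  show *: "(\<Sum>\<^sub>\<infinity>s\<in>S. cmod (\<eta> s * \<zeta> s)) \<le> M * lp_norm 1 S \<zeta>"
    unfolding l1_norm infsum_cmult_right'[symmetric] by (intro infsum_mono sm sM le)
  have "cmod (dual_pair S \<eta> \<zeta>) \<le> (\<Sum>\<^sub>\<infinity>s\<in>S. cmod (\<eta> s * \<zeta> s))"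
    unfolding dual_pair_def by (rule norm_infsum_bound[OF sm])
  then show "cmod (dual_pair S \<eta> \<zeta>) \<le> M * lp_norm 1 S \<zeta>" using * by simp
qed

lemma c0_bounded:
  assumes "\<eta> \<in> c0_space S"
  obtains M where "\<And>s. cmod (\<eta> s) \<le> M"
proof -
  let ?A = "{s \<in> S. 1 \<le> cmod (\<eta> s)}"
  have fin: "finite ?A" using assms unfolding c0_space_def by (auto dest: spec[of _ 1])
  have "cmod (\<eta> s) \<le> 1 + (\<Sum>t\<in>?A. cmod (\<eta> t))" for s
  proof (cases "s \<in> ?A")
    case True
    then show ?thesis using member_le_sum[of s ?A "\<lambda>t. cmod (\<eta> t)"] fin by auto
  next
    case False
    then have "cmod (\<eta> s) \<le> 1" using assms by (cases "s \<in> S") (auto simp: c0_space_def)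
    then show ?thesis by (simp add: add_increasing2 sum_nonneg)
  qed
  then show ?thesis by (rule that)
qed

lemma tight_c0:
  assumes "\<eta> \<in> c0_space S"
  shows "tight 1 S \<eta>"
  unfolding tight_def
proof (intro conjI ballI allI impI)
  obtain M where "\<And>s. cmod (\<eta> s) \<le> M" using c0_bounded[OF assms] by blast
  then show "(\<lambda>s. cmod (\<eta> s * \<zeta> s)) summable_on S" if "\<zeta> \<in> lp_space 1 S" for \<zeta>
    using l1_bounded_product(1)[OF that] by blast
  fix \<epsilon> :: real assume "0 < \<epsilon>"
  define E where "E = {s \<in> S. \<epsilon> \<le> cmod (\<eta> s)}"
  have E: "finite E" "E \<subseteq> S" using assms \<open>0 < \<epsilon>\<close> by (auto simp: c0_space_def E_def)
  have "cmod (cut (- E) \<eta> s) \<le> \<epsilon>" for s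
    using assms \<open>0 < \<epsilon>\<close> by (cases "s \<in> S") (auto simp: cut_def E_def c0_space_def)
  then have "\<forall>\<zeta>\<in>lp_space 1 S. cmod (dual_pair S (cut (- E) \<eta>) \<zeta>) \<le> \<epsilon> * lp_norm 1 S \<zeta>"
    using l1_bounded_product(3) by blast
  then show "\<exists>E. finite E \<and> E \<subseteq> S \<and>
        (\<forall>\<zeta>\<in>lp_space 1 S. cmod (dual_pair S (cut (- E) \<eta>) \<zeta>) \<le> \<epsilon> * lp_norm 1 S \<zeta>)"
    using E by blast
qed

lemma tight_split:
  assumes "tight p S \<eta>" "\<zeta> \<in> lp_space p S" "finite E" "E \<subseteq> S"
  shows "dual_pair S \<eta> \<zeta> = (\<Sum>s\<in>E. \<eta> s * \<zeta> s) + dual_pair S (cut (- E) \<eta>) \<zeta>"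
proof -
  have sm: "(\<lambda>s. \<eta> s * \<zeta> s) summable_on S"
    using assms(1,2) unfolding tight_def by (blast intro: abs_summable_summable)
  have "dual_pair S (cut (- E) \<eta>) \<zeta> = (\<Sum>\<^sub>\<infinity>s\<in>S - E. \<eta> s * \<zeta> s)"
    unfolding dual_pair_def by (rule infsum_cong_neutral) (auto simp: cut_def)
  then show ?thesis
    unfolding dual_pair_def using sm assms(3,4) by (simp add: infsum_Diff)
qed

section \<open>Bounded nets of operators\<close>

lemma tendsto_approximation:
  fixes f :: "'i \<Rightarrow> 'm::metric_space"
  assumes "\<And>e. 0 < e \<Longrightarrow> \<exists>g m. (g \<longlongrightarrow> m) F \<and> eventually (\<lambda>i. dist (f i) (g i) \<le> e) F \<and> dist l m \<le> e"
  shows "(f \<longlongrightarrow> l) F"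
proof (rule tendstoI)
  fix e :: real assume "0 < e"
  then obtain g m where gm: "(g \<longlongrightarrow> m) F" "eventually (\<lambda>i. dist (f i) (g i) \<le> e / 4) F"
      "dist l m \<le> e / 4"
    using assms[of "e / 4"] by auto
  have "eventually (\<lambda>i. dist (g i) m < e / 4) F"
    using gm(1) \<open>0 < e\<close> by (intro tendstoD) auto
  with gm(2) show "eventually (\<lambda>i. dist (f i) l < e) F"
  proof eventually_elim
    case (elim i)
    have "dist (f i) l \<le> dist (f i) (g i) + dist (g i) m + dist l m"
      using dist_triangle[of "f i" l "g i"] dist_triangle[of "g i" l m] by (simp add: dist_commute)
    then show ?case using elim gm(3) \<open>0 < e\<close> by linarith
  qed
qed

text \<open>
  A bounded net of operators whose matrix entries converge to those of \<open>T\<close>.  Three successive approximations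
  turn this into weak* convergence: truncate the vector, then the functional, then the tensor series.
\<close>

locale bounded_op_net =
  fixes p :: real and S :: "'a set" and V :: "'i \<Rightarrow> ('a \<Rightarrow> complex) \<Rightarrow> 'a \<Rightarrow> complex"
    and T :: "('a \<Rightarrow> complex) \<Rightarrow> 'a \<Rightarrow> complex" and F :: "'i filter" and C :: real
  assumes p: "1 \<le> p"
    and V: "eventually (\<lambda>i. V i \<in> bounded_ops p S) F"
    and V_le: "eventually (\<lambda>i. \<forall>\<xi>\<in>lp_space p S. lp_norm p S (V i \<xi>) \<le> C * lp_norm p S \<xi>) F"
    and T: "T \<in> bounded_ops p S"
    and T_le: "\<xi> \<in> lp_space p S \<Longrightarrow> lp_norm p S (T \<xi>) \<le> C * lp_norm p S \<xi>"
    and C: "0 < C"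
    and matrix: "t \<in> S \<Longrightarrow> ((\<lambda>i. V i (delta t) h) \<longlongrightarrow> T (delta t) h) F"
begin

lemma entry_tendsto:
  assumes \<xi>: "\<xi> \<in> lp_space p S"
  shows "((\<lambda>i. V i \<xi> h) \<longlongrightarrow> T \<xi> h) F"
proof (rule tendsto_approximation)
  fix e :: real assume "0 < e"
  then obtain A where A: "finite A" "A \<subseteq> S" "lp_norm p S (cut (- A) \<xi>) \<le> e / C"
    using lp_tail_smallE[OF \<xi> p, of "e / C"] C by auto
  have cut: "cut (- A) \<xi> \<in> lp_space p S" by (rule cut_in_lp_space[OF \<xi> p])
  have close: "dist (U \<xi> h) (\<Sum>t\<in>A. \<xi> t * U (delta t) h) \<le> e"
    if U: "U \<in> bounded_ops p S" "\<forall>\<xi>\<in>lp_space p S. lp_norm p S (U \<xi>) \<le> C * lp_norm p S \<xi>" for U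
  proof -
    have "dist (U \<xi> h) (\<Sum>t\<in>A. \<xi> t * U (delta t) h) = cmod (U (cut (- A) \<xi>) h)"
      using bounded_ops_split[OF U(1) p \<xi>, of h A] bounded_ops_cut[OF U(1) p A(1,2), of \<xi>]
      by (simp add: dist_norm)
    also have "\<dots> \<le> lp_norm p S (U (cut (- A) \<xi>))"
      by (intro norm_le_lp_norm bounded_opsD(1)[OF U(1)] cut p)
    also have "\<dots> \<le> C * lp_norm p S (cut (- A) \<xi>)" using U(2) cut by blast
    also have "\<dots> \<le> C * (e / C)" using A(3) C by (intro mult_left_mono) auto
    finally show ?thesis using C by simp
  qed
  have "((\<lambda>i. \<Sum>t\<in>A. \<xi> t * V i (delta t) h) \<longlongrightarrow> (\<Sum>t\<in>A. \<xi> t * T (delta t) h)) F"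
    using A(2) by (intro tendsto_intros matrix) auto
  moreover have "eventually (\<lambda>i. dist (V i \<xi> h) (\<Sum>t\<in>A. \<xi> t * V i (delta t) h) \<le> e) F"
    using V V_le by eventually_elim (rule close)
  moreover have "dist (T \<xi> h) (\<Sum>t\<in>A. \<xi> t * T (delta t) h) \<le> e"
    using T T_le by (intro close) auto
  ultimately show "\<exists>g m. (g \<longlongrightarrow> m) F \<and> eventually (\<lambda>i. dist (V i \<xi> h) (g i) \<le> e) F \<and> dist (T \<xi> h) m \<le> e"
    by blast
qed

lemma dual_pair_tendsto:
  assumes \<xi>: "\<xi> \<in> lp_space p S" and \<eta>: "tight p S \<eta>"
  shows "((\<lambda>i. dual_pair S \<eta> (V i \<xi>)) \<longlongrightarrow> dual_pair S \<eta> (T \<xi>)) F"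
proof (rule tendsto_approximation)
  fix e :: real assume "0 < e"
  define K where "K = C * lp_norm p S \<xi> + 1"
  have K: "0 < K" using C lp_norm_nonneg[of p S \<xi>] by (simp add: K_def add_nonneg_pos)
  obtain E where E: "finite E" "E \<subseteq> S"
      "\<forall>\<zeta>\<in>lp_space p S. cmod (dual_pair S (cut (- E) \<eta>) \<zeta>) \<le> e / K * lp_norm p S \<zeta>"
    using \<eta> \<open>0 < e\<close> K unfolding tight_def by (meson divide_pos_pos)
  have close: "dist (dual_pair S \<eta> (U \<xi>)) (\<Sum>s\<in>E. \<eta> s * U \<xi> s) \<le> e"
    if U: "U \<in> bounded_ops p S" "\<forall>\<xi>\<in>lp_space p S. lp_norm p S (U \<xi>) \<le> C * lp_norm p S \<xi>" for U
  proof -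
    have U\<xi>: "U \<xi> \<in> lp_space p S" by (rule bounded_opsD(1)[OF U(1) \<xi>])
    have "dist (dual_pair S \<eta> (U \<xi>)) (\<Sum>s\<in>E. \<eta> s * U \<xi> s) = cmod (dual_pair S (cut (- E) \<eta>) (U \<xi>))"
      using tight_split[OF \<eta> U\<xi> E(1,2)] by (simp add: dist_norm)
    also have "\<dots> \<le> e / K * lp_norm p S (U \<xi>)" using E(3) U\<xi> by blast
    also have "\<dots> \<le> e / K * K"
      using U(2) \<xi> K \<open>0 < e\<close> by (intro mult_left_mono) (auto simp: K_def add_increasing2)
    finally show ?thesis using K by simp
  qed
  have "((\<lambda>i. \<Sum>s\<in>E. \<eta> s * V i \<xi> s) \<longlongrightarrow> (\<Sum>s\<in>E. \<eta> s * T \<xi> s)) F"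
    by (intro tendsto_intros entry_tendsto \<xi>)
  moreover have "eventually (\<lambda>i. dist (dual_pair S \<eta> (V i \<xi>)) (\<Sum>s\<in>E. \<eta> s * V i \<xi> s) \<le> e) F"
    using V V_le by eventually_elim (rule close)
  moreover have "dist (dual_pair S \<eta> (T \<xi>)) (\<Sum>s\<in>E. \<eta> s * T \<xi> s) \<le> e"
    using T T_le by (intro close) auto
  ultimately show "\<exists>g m. (g \<longlongrightarrow> m) F \<and> eventually (\<lambda>i. dist (dual_pair S \<eta> (V i \<xi>)) (g i) \<le> e) F
      \<and> dist (dual_pair S \<eta> (T \<xi>)) m \<le> e"
    by blast
qed

lemma tensor_pair_tendsto:
  assumes "1 < p" "x \<in> proj_tensor_series (p / (p - 1)) p S" "F \<noteq> bot"
  shows "((\<lambda>i. tensor_pair S x (V i)) \<longlongrightarrow> tensor_pair S x T) F"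
proof -
  obtain \<eta> \<xi> where x: "x = (\<eta>, \<xi>)" by (cases x)
  have el: "\<eta> j \<in> lp_space (p / (p - 1)) S" "\<xi> j \<in> lp_space p S" for j
    using assms(2) by (auto simp: x proj_tensor_series_def)
  let ?m = "\<lambda>j. 2 * C * (lp_norm (p / (p - 1)) S (\<eta> j) * lp_norm p S (\<xi> j))"
  have bound: "cmod (dual_pair S (\<eta> j) (U (\<xi> j))) \<le> ?m j"
    if U: "U \<in> bounded_ops p S" "\<forall>\<xi>\<in>lp_space p S. lp_norm p S (U \<xi>) \<le> C * lp_norm p S \<xi>" for U j
  proof -
    have "cmod (dual_pair S (\<eta> j) (U (\<xi> j))) \<le> 2 * lp_norm (p / (p - 1)) S (\<eta> j) * lp_norm p S (U (\<xi> j))"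
      by (intro lp_hoelder assms el bounded_opsD(1)[OF U(1)])
    also have "\<dots> \<le> 2 * lp_norm (p / (p - 1)) S (\<eta> j) * (C * lp_norm p S (\<xi> j))"
      using U(2) el by (intro mult_left_mono) (auto simp: lp_norm_nonneg)
    finally show ?thesis by (simp add: mult_ac)
  qed
  have "eventually (\<lambda>(j, i). cmod (dual_pair S (\<eta> j) (V i (\<xi> j))) \<le> ?m j) (at_top \<times>\<^sub>F F)"
    unfolding eventually_prod_filter
  proof (intro exI conjI allI impI)
    show "eventually (\<lambda>j::nat. True) at_top" by simp
    show "eventually (\<lambda>i. V i \<in> bounded_ops p S \<and>
        (\<forall>\<xi>\<in>lp_space p S. lp_norm p S (V i \<xi>) \<le> C * lp_norm p S \<xi>)) F"
      using V V_le by eventually_elim simp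
  qed (use bound in auto)
  moreover have "summable ?m"
    using assms(2) by (intro summable_mult) (simp add: x proj_tensor_series_def)
  moreover have "((\<lambda>i. dual_pair S (\<eta> j) (V i (\<xi> j))) \<longlongrightarrow> dual_pair S (\<eta> j) (T (\<xi> j))) F" for j
    by (intro dual_pair_tendsto tight_lp el assms)
  ultimately show ?thesis
    using tannerys_theorem[of "\<lambda>j i. dual_pair S (\<eta> j) (V i (\<xi> j))" "\<lambda>j. dual_pair S (\<eta> j) (T (\<xi> j))" F ?m] assms(3)
    by (simp add: x tensor_pair_def)
qed

end

section \<open>The weak* topology\<close>

lemma topspace_initial_topology:
  assumes "\<Phi> \<noteq> {}"
  shows "topspace (initial_topology X \<Phi>) = X"
proof -
  obtain \<phi> where "\<phi> \<in> \<Phi>" using assms by blast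
  then have "X \<in> {\<phi> -` U \<inter> X | \<phi> U. \<phi> \<in> \<Phi> \<and> open U}" by (auto intro!: exI[of _ \<phi>] exI[of _ UNIV])
  then show ?thesis unfolding initial_topology_def topology_generated_by_topspace by blast
qed

lemma openin_initial_topologyI:
  assumes "\<phi> \<in> \<Phi>" "open U"
  shows "openin (initial_topology X \<Phi>) (\<phi> -` U \<inter> X)"
  unfolding initial_topology_def by (rule topology_generated_by_Basis) (use assms in blast)

lemma eventually_in_initial_topology:
  assumes "openin (initial_topology X \<Phi>) W" "x \<in> W"
    and "\<And>\<phi>. \<phi> \<in> \<Phi> \<Longrightarrow> ((\<lambda>i. \<phi> (f i)) \<longlongrightarrow> \<phi> x) F"
    and "eventually (\<lambda>i. f i \<in> X) F"
  shows "eventually (\<lambda>i. f i \<in> W) F"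
proof -
  have "generate_topology_on {\<phi> -` U \<inter> X | \<phi> U. \<phi> \<in> \<Phi> \<and> open U} W"
    using assms(1) unfolding initial_topology_def by (rule openin_topology_generated_by)
  then show ?thesis using assms(2)
  proof induction
    case (Int a b)
    then show ?case by (simp add: eventually_conj)
  next
    case (UN K)
    then obtain k where "k \<in> K" "eventually (\<lambda>i. f i \<in> k) F" by blast
    then show ?case by (auto elim: eventually_mono)
  next
    case (Basis s)
    then obtain \<phi> U where s: "s = \<phi> -` U \<inter> X" "\<phi> \<in> \<Phi>" "open U" by blast
    then have "eventually (\<lambda>i. \<phi> (f i) \<in> U) F"
      using Basis(2) by (intro topological_tendstoD[OF assms(3)]) auto
    with assms(4) show ?case by eventually_elim (simp add: s)
  qed simp
qed

text \<open>
  The functionals that define the weak* topology, so that the two cases \<open>p = 1\<close> and \<open>p > 1\<close> can be treated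
  together below.
\<close>

definition CV_functionals ::
  "real \<Rightarrow> ('a, 'b) monoid_scheme \<Rightarrow> ((('a \<Rightarrow> complex) \<Rightarrow> ('a \<Rightarrow> complex)) \<Rightarrow> complex) set" where
  "CV_functionals p G =
     (if p = 1 then (\<lambda>\<eta> T. dual_pair (carrier G) \<eta> (T (delta \<one>\<^bsub>G\<^esub>))) ` c0_space (carrier G)
      else tensor_pair (carrier G) ` proj_tensor_series (p / (p - 1)) p (carrier G))"

lemma CV_carrier:
  "T \<in> carrier (CV p G) \<longleftrightarrow> T \<in> bounded_ops p (carrier G) \<and>
     (\<forall>t\<in>carrier G. T \<circ> right_reg p G t = right_reg p G t \<circ> T)"
  by (simp add: CV_def)

lemma zero_in_proj_tensor_series: "(\<lambda>j s. 0, \<lambda>j s. 0) \<in> proj_tensor_series q p S"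
  by (simp add: proj_tensor_series_def lp_space_zero lp_norm_zero)

lemma c0_space_nonempty: "c0_space S \<noteq> {}"
  by (auto simp: c0_space_def intro!: exI[of _ "\<lambda>s. 0"])

lemma (in group) CV_delta_in_lp_space:
  "T \<in> carrier (CV p G) \<Longrightarrow> t \<in> carrier G \<Longrightarrow> T (delta t) \<in> lp_space p (carrier G)"
  unfolding CV_carrier by (rule bounded_opsD(1)[where T = T]) (simp_all add: delta_in_lp_space)

lemma (in group) topspace_CV_weak_star: "topspace (CV_weak_star p G) = carrier (CV p G)"
proof (cases "p = 1")
  case True
  have "topspace (l1_weak_star (carrier G)) = lp_space 1 (carrier G)"
    unfolding l1_weak_star_def
    by (rule topspace_initial_topology) (use c0_space_nonempty in auto)
  then show ?thesis using True CV_delta_in_lp_space[of _ 1]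
    by (auto simp: CV_weak_star_def topspace_pullback_topology)
next
  case False
  have "topspace (ops_weak_star p (carrier G)) = bounded_ops p (carrier G)"
    unfolding ops_weak_star_def
    by (rule topspace_initial_topology) (use zero_in_proj_tensor_series in blast)
  moreover have "carrier (CV p G) \<subseteq> bounded_ops p (carrier G)"
    by (simp add: CV_def subset_iff)
  ultimately show ?thesis using False by (simp add: CV_weak_star_def Int_absorb1)
qed

lemma (in group) openin_CV_weak_star_functional:
  assumes "\<phi> \<in> CV_functionals p G" "open U"
  shows "openin (CV_weak_star p G) (\<phi> -` U \<inter> carrier (CV p G))"
proof (cases "p = 1")
  case True
  then obtain \<eta> where \<eta>: "\<eta> \<in> c0_space (carrier G)" "\<phi> = (\<lambda>T. dual_pair (carrier G) \<eta> (T (delta \<one>)))"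
    using assms(1) by (auto simp: CV_functionals_def)
  have "openin (l1_weak_star (carrier G)) (dual_pair (carrier G) \<eta> -` U \<inter> lp_space 1 (carrier G))"
    unfolding l1_weak_star_def using \<eta> assms by (intro openin_initial_topologyI) auto
  moreover have "\<phi> -` U \<inter> carrier (CV p G) = (\<lambda>T. T (delta \<one>)) -`
      (dual_pair (carrier G) \<eta> -` U \<inter> lp_space 1 (carrier G)) \<inter> carrier (CV 1 G)"
    using True CV_delta_in_lp_space[of _ 1] by (auto simp: \<eta>)
  ultimately show ?thesis using True by (auto simp: CV_weak_star_def openin_pullback_topology)
next
  case False
  have "openin (ops_weak_star p (carrier G)) (\<phi> -` U \<inter> bounded_ops p (carrier G))"
    unfolding ops_weak_star_def using False assms
    by (intro openin_initial_topologyI) (auto simp: CV_functionals_def)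
  then have "openin (CV_weak_star p G) (\<phi> -` U \<inter> bounded_ops p (carrier G) \<inter> carrier (CV p G))"
    using False by (auto simp: CV_weak_star_def openin_subtopology)
  moreover have "\<phi> -` U \<inter> bounded_ops p (carrier G) \<inter> carrier (CV p G) = \<phi> -` U \<inter> carrier (CV p G)"
    by (auto simp add: CV_def)
  ultimately show ?thesis by simp
qed

lemma (in group) closedin_CV_weak_star_kernel:
  assumes "\<Psi> \<subseteq> CV_functionals p G"
  shows "closedin (CV_weak_star p G) {T \<in> carrier (CV p G). \<forall>\<phi>\<in>\<Psi>. \<phi> T = 0}"
proof -
  have "openin (CV_weak_star p G) (\<Union>\<phi>\<in>\<Psi>. \<phi> -` (- {0}) \<inter> carrier (CV p G))"
    using assms by (intro openin_Union) (auto intro!: openin_CV_weak_star_functional)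
  moreover have "topspace (CV_weak_star p G) - {T \<in> carrier (CV p G). \<forall>\<phi>\<in>\<Psi>. \<phi> T = 0} =
      (\<Union>\<phi>\<in>\<Psi>. \<phi> -` (- {0}) \<inter> carrier (CV p G))"
    by (auto simp: topspace_CV_weak_star)
  ultimately show ?thesis by (auto simp: closedin_def topspace_CV_weak_star)
qed

text \<open>
  Weak*-closed sets contain the limits of their nets; arbitrary filters are needed as the group may be uncountable.
\<close>

lemma (in group) closedin_CV_weak_star_limit:
  assumes "closedin (CV_weak_star p G) I" "F \<noteq> bot"
    and "eventually (\<lambda>i. V i \<in> I) F" "T \<in> carrier (CV p G)"
    and lim: "\<And>\<phi>. \<phi> \<in> CV_functionals p G \<Longrightarrow> ((\<lambda>i. \<phi> (V i)) \<longlongrightarrow> \<phi> T) F"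
  shows "T \<in> I"
proof (rule ccontr)
  assume "T \<notin> I"
  let ?W = "carrier (CV p G) - I"
  have W: "openin (CV_weak_star p G) ?W" "T \<in> ?W"
    using assms(1,4) \<open>T \<notin> I\<close> by (auto simp: closedin_def topspace_CV_weak_star)
  have "I \<subseteq> carrier (CV p G)"
    using assms(1) by (auto simp: closedin_def topspace_CV_weak_star)
  then have V: "eventually (\<lambda>i. V i \<in> carrier (CV p G)) F"
    using assms(3) by (auto elim: eventually_mono)
  have "eventually (\<lambda>i. V i \<in> ?W) F"
  proof (cases "p = 1")
    case True
    then obtain U where U: "openin (l1_weak_star (carrier G)) U"
        "?W = (\<lambda>T. T (delta \<one>)) -` U \<inter> carrier (CV 1 G)"
      using W(1) by (auto simp: CV_weak_star_def openin_pullback_topology)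
    have "eventually (\<lambda>i. V i (delta \<one>) \<in> U) F"
    proof (rule eventually_in_initial_topology[OF U(1)[unfolded l1_weak_star_def]])
      show "T (delta \<one>) \<in> U" using W(2) U(2) by auto
      show "((\<lambda>i. \<phi> (V i (delta \<one>))) \<longlongrightarrow> \<phi> (T (delta \<one>))) F"
        if "\<phi> \<in> dual_pair (carrier G) ` c0_space (carrier G)" for \<phi>
        using that lim True by (auto simp: CV_functionals_def)
      show "eventually (\<lambda>i. V i (delta \<one>) \<in> lp_space 1 (carrier G)) F"
        using V by eventually_elim (use True CV_delta_in_lp_space[of _ 1] in auto)
    qed
    with V show ?thesis by eventually_elim (use U(2) True in auto)
  next
    case False
    then obtain U where U: "openin (ops_weak_star p (carrier G)) U" "?W = U \<inter> carrier (CV p G)"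
      using W(1) by (auto simp: CV_weak_star_def openin_subtopology)
    have "eventually (\<lambda>i. V i \<in> U) F"
    proof (rule eventually_in_initial_topology[OF U(1)[unfolded ops_weak_star_def]])
      show "T \<in> U" using W(2) U(2) by auto
      show "((\<lambda>i. \<phi> (V i)) \<longlongrightarrow> \<phi> T) F"
        if "\<phi> \<in> tensor_pair (carrier G) ` proj_tensor_series (p / (p - 1)) p (carrier G)" for \<phi>
        using that lim False by (auto simp: CV_functionals_def)
      show "eventually (\<lambda>i. V i \<in> bounded_ops p (carrier G)) F"
        using V by eventually_elim (simp add: CV_def)
    qed
    with V show ?thesis by eventually_elim (use U(2) in auto)
  qed
  with assms(3) have "eventually (\<lambda>i. False) F" by eventually_elim auto
  then show False using assms(2) by simp
qed


section \<open>Convolution\<close>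

text \<open>
  The graph of \<open>x\<^sup>p\<close> lies above its tangent at \<open>m\<close>.
\<close>

lemma powr_tangent:
  fixes x m p :: real
  assumes "1 \<le> p" "0 \<le> x" "0 < m"
  shows "p * m powr (p - 1) * x \<le> x powr p + (p - 1) * m powr p"
proof (cases "p = 1")
  case True
  then show ?thesis using assms by simp
next
  case False
  define q where "q = p / (p - 1)"
  have q: "1 < q" "1 / p + 1 / q = 1" "1 < p" using False assms(1) by (auto simp: q_def field_simps)
  have "x * m powr (p - 1) \<le> x powr p / p + (m powr (p - 1)) powr q / q"
    using q assms by (intro Youngs_inequality) auto
  also have "(m powr (p - 1)) powr q = m powr p"
    using q(3) by (simp add: powr_powr q_def)
  finally have "p * (x * m powr (p - 1)) \<le> p * (x powr p / p + m powr p / q)"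
    using q(3) by (intro mult_left_mono) auto
  also have "\<dots> = x powr p + (p - 1) * m powr p"
    using q(3) by (simp add: q_def distrib_left)
  finally show ?thesis by (simp add: mult_ac)
qed

text \<open>
  Jensen's inequality, where \<open>\<mu>\<close> need not have mass \<open>1\<close>: integrate the inequality of \<open>powr_tangent\<close> at the
  mean \<open>m\<close>.
\<close>

lemma jensen_powr_infsum:
  fixes \<mu> x :: "'a \<Rightarrow> real"
  assumes p: "1 \<le> p" and \<mu>: "\<And>t. t \<in> A \<Longrightarrow> 0 \<le> \<mu> t" "\<mu> summable_on A"
    and x: "\<And>t. t \<in> A \<Longrightarrow> 0 \<le> x t" and s: "(\<lambda>t. \<mu> t * x t powr p) summable_on A"
  shows "(\<Sum>\<^sub>\<infinity>t\<in>A. \<mu> t * x t) powr p \<le> (infsum \<mu> A) powr (p - 1) * (\<Sum>\<^sub>\<infinity>t\<in>A. \<mu> t * x t powr p)"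
    and "(\<lambda>t. \<mu> t * x t) summable_on A"
proof -
  have le: "\<mu> t * x t \<le> \<mu> t + \<mu> t * x t powr p" if "t \<in> A" for t
  proof -
    have "x t \<le> 1 + x t powr p"
    proof (cases "x t \<le> 1")
      case False
      then have "x t powr 1 \<le> x t powr p" using p by (intro powr_mono) auto
      then show ?thesis using False by simp
    qed (simp add: add_increasing2)
    then have "\<mu> t * x t \<le> \<mu> t * (1 + x t powr p)" using \<mu>(1)[OF that] by (rule mult_left_mono)
    then show ?thesis by (simp add: distrib_left)
  qed
  show sx: "(\<lambda>t. \<mu> t * x t) summable_on A"
    by (rule summable_on_comparison_test[OF summable_on_add[OF \<mu>(2) s]]) (use le \<mu> x in auto)
  let ?M = "infsum \<mu> A" and ?X = "\<Sum>\<^sub>\<infinity>t\<in>A. \<mu> t * x t" and ?P = "\<Sum>\<^sub>\<infinity>t\<in>A. \<mu> t * x t powr p"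
  have M0: "0 \<le> ?M" and X0: "0 \<le> ?X" and P0: "0 \<le> ?P"
    using \<mu> x by (auto intro!: infsum_nonneg)
  show "?X powr p \<le> ?M powr (p - 1) * ?P"
  proof (cases "?X = 0")
    case False
    then have X: "0 < ?X" using X0 by simp
    have "?M \<noteq> 0"
    proof
      assume "?M = 0"
      then have "\<mu> t = 0" if "t \<in> A" for t
        using nonneg_infsum_le_0D[of \<mu> A t] \<mu> that by auto
      then have "?X = 0" by (intro infsum_0) simp
      then show False using False by simp
    qed
    then have M: "0 < ?M" using M0 by simp
    define m where "m = ?X / ?M"
    have m: "0 < m" using X M by (simp add: m_def)
    have "p * m powr (p - 1) * ?X = (\<Sum>\<^sub>\<infinity>t\<in>A. p * m powr (p - 1) * (\<mu> t * x t))"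
      by (simp add: infsum_cmult_right')
    also have "\<dots> \<le> (\<Sum>\<^sub>\<infinity>t\<in>A. \<mu> t * x t powr p + (p - 1) * m powr p * \<mu> t)"
    proof (rule infsum_mono)
      fix t assume t: "t \<in> A"
      show "p * m powr (p - 1) * (\<mu> t * x t) \<le> \<mu> t * x t powr p + (p - 1) * m powr p * \<mu> t"
        using mult_left_mono[OF powr_tangent[OF p x[OF t] m] \<mu>(1)[OF t]]
        by (simp add: algebra_simps)
    qed (intro summable_on_add summable_on_cmult_right sx s \<mu>(2))+
    also have "\<dots> = ?P + (p - 1) * m powr p * ?M"
      by (simp add: infsum_add s summable_on_cmult_right \<mu>(2) infsum_cmult_right')
    also have "p * m powr (p - 1) * ?X = p * (m powr p * ?M)"
      using M m by (simp add: m_def powr_diff field_simps)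
    finally have "m powr p * ?M \<le> ?P" by (simp add: algebra_simps)
    then have "?M powr (p - 1) * (m powr p * ?M) \<le> ?M powr (p - 1) * ?P"
      by (intro mult_left_mono) auto
    also have "?M powr (p - 1) * (m powr p * ?M) = ?X powr p"
      using M X by (simp add: m_def powr_diff powr_divide)
    finally show ?thesis .
  qed (simp add: P0)
qed

definition conv :: "('a, 'b) monoid_scheme \<Rightarrow> ('a \<Rightarrow> complex) \<Rightarrow> ('a \<Rightarrow> complex) \<Rightarrow> 'a \<Rightarrow> complex" where
  "conv G f h = (\<lambda>s. if s \<in> carrier G
     then \<Sum>\<^sub>\<infinity>t\<in>carrier G. f t * h (inv\<^bsub>G\<^esub> t \<otimes>\<^bsub>G\<^esub> s) else 0)"

definition conv_op ::
  "real \<Rightarrow> ('a, 'b) monoid_scheme \<Rightarrow> ('a \<Rightarrow> complex) \<Rightarrow> ('a \<Rightarrow> complex) \<Rightarrow> 'a \<Rightarrow> complex" where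
  "conv_op p G f = (\<lambda>\<xi>. if \<xi> \<in> lp_space p (carrier G) then conv G f \<xi> else (\<lambda>s. 0))"

context group
begin

lemma inv_mult_cancel [simp]:
  "t \<in> carrier G \<Longrightarrow> s \<in> carrier G \<Longrightarrow> inv t \<otimes> (t \<otimes> s) = s"
  "t \<in> carrier G \<Longrightarrow> s \<in> carrier G \<Longrightarrow> t \<otimes> (inv t \<otimes> s) = s"
  by (simp_all add: m_assoc[symmetric])

lemma mult_inv_cancel [simp]:
  "t \<in> carrier G \<Longrightarrow> s \<in> carrier G \<Longrightarrow> s \<otimes> t \<otimes> inv t = s"
  "t \<in> carrier G \<Longrightarrow> s \<in> carrier G \<Longrightarrow> s \<otimes> inv t \<otimes> t = s"
  by (simp_all add: m_assoc)

lemma infsum_left_translate: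
  assumes "t \<in> carrier G"
  shows "(\<Sum>\<^sub>\<infinity>s\<in>carrier G. g (inv t \<otimes> s)) = infsum g (carrier G)"
  by (rule infsum_reindex_bij_witness[of _ "\<lambda>s. t \<otimes> s" "\<lambda>s. inv t \<otimes> s"]) (use assms in auto)

lemma has_sum_left_translate:
  assumes "t \<in> carrier G"
  shows "((\<lambda>s. g (inv t \<otimes> s)) has_sum c) (carrier G) \<longleftrightarrow> (g has_sum c) (carrier G)"
  by (rule has_sum_reindex_bij_witness[of _ "\<lambda>s. t \<otimes> s" "\<lambda>s. inv t \<otimes> s"]) (use assms in auto)

lemma has_sum_right_translate:
  assumes "t \<in> carrier G"
  shows "((\<lambda>s. g (s \<otimes> t)) has_sum c) (carrier G) \<longleftrightarrow> (g has_sum c) (carrier G)"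
  by (rule has_sum_reindex_bij_witness[of _ "\<lambda>s. s \<otimes> inv t" "\<lambda>s. s \<otimes> t"]) (use assms in auto)

lemma has_sum_div_translate:
  assumes "s \<in> carrier G"
  shows "((\<lambda>t. g (s \<otimes> inv t)) has_sum c) (carrier G) \<longleftrightarrow> (g has_sum c) (carrier G)"
  by (rule has_sum_reindex_bij_witness[of _ "\<lambda>t. inv t \<otimes> s" "\<lambda>t. s \<otimes> inv t"])
    (use assms in \<open>auto simp: inv_mult_group m_assoc\<close>)

lemma conv_altdef:
  assumes "s \<in> carrier G"
  shows "conv G f h s = (\<Sum>\<^sub>\<infinity>r\<in>carrier G. f (s \<otimes> inv r) * h r)"
proof -
  have "conv G f h s = (\<Sum>\<^sub>\<infinity>t\<in>carrier G. f t * h (inv t \<otimes> s))"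
    using assms by (simp add: conv_def)
  also have "\<dots> = (\<Sum>\<^sub>\<infinity>r\<in>carrier G. f (s \<otimes> inv r) * h r)"
    by (rule infsum_reindex_bij_witness[of _ "\<lambda>r. s \<otimes> inv r" "\<lambda>t. inv t \<otimes> s"])
      (use assms in \<open>auto simp: inv_mult_group m_assoc\<close>)
  finally show ?thesis .
qed

lemma conv_off: "s \<notin> carrier G \<Longrightarrow> conv G f h s = 0"
  by (simp add: conv_def)

text \<open>
  Tonelli's theorem for the substitution \<open>(t, s) \<mapsto> (t, t\<^sup>-\<^sup>1 s)\<close>; it carries all estimates of convolutions.
\<close>

lemma double_sum_translate:
  fixes u v :: "'a \<Rightarrow> real"
  assumes "u summable_on carrier G" "v summable_on carrier G"
    and "\<And>t. 0 \<le> u t" "\<And>t. 0 \<le> v t"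
  shows "(\<lambda>(t, s). u t * v (inv t \<otimes> s)) summable_on carrier G \<times> carrier G"
    and "(\<Sum>\<^sub>\<infinity>s\<in>carrier G. \<Sum>\<^sub>\<infinity>t\<in>carrier G. u t * v (inv t \<otimes> s))
         = infsum u (carrier G) * infsum v (carrier G)"
    and "s \<in> carrier G \<Longrightarrow> (\<lambda>t. u t * v (inv t \<otimes> s)) summable_on carrier G"
    and "(\<lambda>s. \<Sum>\<^sub>\<infinity>t\<in>carrier G. u t * v (inv t \<otimes> s)) summable_on carrier G"
proof -
  have inner: "((\<lambda>s. u t * v (inv t \<otimes> s)) has_sum u t * infsum v (carrier G)) (carrier G)"
    if "t \<in> carrier G" for t
    by (intro has_sum_cmult_right) (simp add: has_sum_left_translate that assms)
  show sm: "(\<lambda>(t, s). u t * v (inv t \<otimes> s)) summable_on carrier G \<times> carrier G"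
    by (rule summable_on_SigmaI[where g = "\<lambda>t. u t * infsum v (carrier G)"])
      (use inner assms in \<open>auto intro: summable_on_cmult_left\<close>)
  have "(\<Sum>\<^sub>\<infinity>s\<in>carrier G. \<Sum>\<^sub>\<infinity>t\<in>carrier G. u t * v (inv t \<otimes> s))
      = (\<Sum>\<^sub>\<infinity>t\<in>carrier G. \<Sum>\<^sub>\<infinity>s\<in>carrier G. u t * v (inv t \<otimes> s))"
    by (rule infsum_swap_banach[symmetric, OF sm])
  also have "\<dots> = (\<Sum>\<^sub>\<infinity>t\<in>carrier G. u t * infsum v (carrier G))"
    by (intro infsum_cong infsumI inner)
  finally show "(\<Sum>\<^sub>\<infinity>s\<in>carrier G. \<Sum>\<^sub>\<infinity>t\<in>carrier G. u t * v (inv t \<otimes> s))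
         = infsum u (carrier G) * infsum v (carrier G)"
    by (simp add: infsum_cmult_left')
  have sm': "(\<lambda>(s, t). u t * v (inv t \<otimes> s)) summable_on carrier G \<times> carrier G"
    using sm by (subst summable_on_swap) (simp add: case_prod_unfold)
  show s: "(\<lambda>t. u t * v (inv t \<otimes> s)) summable_on carrier G" if "s \<in> carrier G" for s
    by (rule summable_on_SigmaD1[OF sm' that])
  show "(\<lambda>s. \<Sum>\<^sub>\<infinity>t\<in>carrier G. u t * v (inv t \<otimes> s)) summable_on carrier G"
    using summable_on_SigmaD[OF sm'] s by simp
qed

text \<open>
  Young's inequality.  Jensen's inequality bounds \<open>|f * h|\<^sup>p\<close> pointwise by
  \<open>\<parallel>f\<parallel>\<^sub>1\<^sup>p\<^sup>-\<^sup>1 (|f| * |h|\<^sup>p)\<close>, and the sum of the last convolution is a product.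
\<close>

lemma conv_young:
  assumes f: "f \<in> lp_space 1 (carrier G)" and h: "h \<in> lp_space p (carrier G)" and p: "1 \<le> p"
  shows "conv G f h \<in> lp_space p (carrier G)"
    and "lp_norm p (carrier G) (conv G f h) \<le> lp_norm 1 (carrier G) f * lp_norm p (carrier G) h"
proof -
  let ?A = "carrier G" and ?M = "lp_norm 1 (carrier G) f" and ?N = "lp_norm p (carrier G) h"
  let ?\<Phi> = "\<lambda>s. \<Sum>\<^sub>\<infinity>t\<in>?A. cmod (f t) * cmod (h (inv t \<otimes> s)) powr p"
  note d = double_sum_translate[OF l1_summable[OF f] lp_space_summable[OF h] norm_ge_zero powr_ge_zero]
  have le: "cmod (conv G f h s) powr p \<le> ?M powr (p - 1) * ?\<Phi> s" if s: "s \<in> ?A" for s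
  proof -
    note j = jensen_powr_infsum[OF p norm_ge_zero l1_summable[OF f] norm_ge_zero d(3)[OF s]]
    have "cmod (conv G f h s) \<le> (\<Sum>\<^sub>\<infinity>t\<in>?A. cmod (f t) * cmod (h (inv t \<otimes> s)))"
      using norm_infsum_bound[of "\<lambda>t. f t * h (inv t \<otimes> s)" ?A] j(2) s by (simp add: conv_def norm_mult)
    then have "cmod (conv G f h s) powr p \<le> (\<Sum>\<^sub>\<infinity>t\<in>?A. cmod (f t) * cmod (h (inv t \<otimes> s))) powr p"
      using p by (intro powr_mono2) auto
    also have "\<dots> \<le> ?M powr (p - 1) * ?\<Phi> s"
      using j(1) by (simp add: l1_norm)
    finally show ?thesis .
  qed
  have sb: "(\<lambda>s. ?M powr (p - 1) * ?\<Phi> s) summable_on ?A"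
    by (intro summable_on_cmult_right d(4))
  have sm: "(\<lambda>s. cmod (conv G f h s) powr p) summable_on ?A"
    by (rule summable_on_comparison_test[OF sb]) (use le in auto)
  show "conv G f h \<in> lp_space p ?A"
    using sm by (simp add: lp_space_def conv_off)
  have "(\<Sum>\<^sub>\<infinity>s\<in>?A. cmod (conv G f h s) powr p) \<le> (\<Sum>\<^sub>\<infinity>s\<in>?A. ?M powr (p - 1) * ?\<Phi> s)"
    by (intro infsum_mono sm sb le)
  also have "\<dots> = ?M powr (p - 1) * (?M * ?N powr p)"
    using p by (simp add: infsum_cmult_right' d(2) lp_norm_powr l1_norm)
  also have "\<dots> = (?M * ?N) powr p"
  proof (cases "?M = 0")
    case False
    then show ?thesis using lp_norm_nonneg[of 1 ?A f] by (simp add: powr_mult powr_diff)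
  qed simp
  finally show "lp_norm p ?A (conv G f h) \<le> ?M * ?N"
    by (intro lp_norm_leI p) (simp_all add: lp_norm_nonneg)
qed

lemma conv_summable:
  assumes f: "f \<in> lp_space 1 (carrier G)" and h: "\<And>s. cmod (h s) \<le> M"
  shows "(\<lambda>t. f t * h (inv t \<otimes> s)) summable_on carrier G"
proof -
  have "(\<lambda>t. h (inv t \<otimes> s) * f t) summable_on carrier G"
    by (rule abs_summable_summable[OF l1_bounded_product(1)[OF f h]])
  then show ?thesis by (rule summable_on_cong[THEN iffD1, rotated]) (rule mult.commute)
qed

lemma conv_lin_left:
  assumes "f \<in> lp_space 1 (carrier G)" "g \<in> lp_space 1 (carrier G)" "\<And>s. cmod (h s) \<le> M"
  shows "conv G (\<lambda>s. f s + c * g s) h = (\<lambda>s. conv G f h s + c * conv G g h s)"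
proof
  fix s
  have "(\<Sum>\<^sub>\<infinity>t\<in>carrier G. (f t + c * g t) * h (inv t \<otimes> s))
      = (\<Sum>\<^sub>\<infinity>t\<in>carrier G. f t * h (inv t \<otimes> s) + c * (g t * h (inv t \<otimes> s)))"
    by (simp add: algebra_simps)
  also have "\<dots> = (\<Sum>\<^sub>\<infinity>t\<in>carrier G. f t * h (inv t \<otimes> s)) + c * (\<Sum>\<^sub>\<infinity>t\<in>carrier G. g t * h (inv t \<otimes> s))"
    using conv_summable assms
    by (subst infsum_add) (auto simp: infsum_cmult_right' intro!: summable_on_cmult_right)
  finally show "conv G (\<lambda>s. f s + c * g s) h s = conv G f h s + c * conv G g h s"
    by (simp add: conv_def)
qed

lemma conv_lin_right:
  assumes "f \<in> lp_space 1 (carrier G)" "\<And>s. cmod (g s) \<le> M" "\<And>s. cmod (h s) \<le> N"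
  shows "conv G f (\<lambda>s. g s + c * h s) = (\<lambda>s. conv G f g s + c * conv G f h s)"
proof
  fix s
  have "(\<Sum>\<^sub>\<infinity>t\<in>carrier G. f t * (g (inv t \<otimes> s) + c * h (inv t \<otimes> s)))
      = (\<Sum>\<^sub>\<infinity>t\<in>carrier G. f t * g (inv t \<otimes> s) + c * (f t * h (inv t \<otimes> s)))"
    by (simp add: algebra_simps)
  also have "\<dots> = (\<Sum>\<^sub>\<infinity>t\<in>carrier G. f t * g (inv t \<otimes> s)) + c * (\<Sum>\<^sub>\<infinity>t\<in>carrier G. f t * h (inv t \<otimes> s))"
    using conv_summable[OF assms(1,2)] conv_summable[OF assms(1,3)]
    by (subst infsum_add) (auto simp: infsum_cmult_right' intro!: summable_on_cmult_right)
  finally show "conv G f (\<lambda>s. g s + c * h s) s = conv G f g s + c * conv G f h s"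
    by (simp add: conv_def)
qed

text \<open>
  The last factor is only assumed to be bounded: besides vectors in \<open>\<ell>\<^sup>p\<close> it will be the constant \<open>1\<close>, which
  shows that the augmentation is multiplicative.
\<close>

lemma conv_assoc:
  assumes f: "f \<in> lp_space 1 (carrier G)" and g: "g \<in> lp_space 1 (carrier G)"
    and h: "\<And>s. cmod (h s) \<le> M"
  shows "conv G (conv G f g) h = conv G f (conv G g h)"
proof
  fix s
  let ?A = "carrier G"
  show "conv G (conv G f g) h s = conv G f (conv G g h) s"
  proof (cases "s \<in> ?A")
    case s: True
    let ?k = "\<lambda>t r. f t * g (inv t \<otimes> r) * h (inv r \<otimes> s)"
    have "(\<lambda>(t, r). cmod (f t) * cmod (g (inv t \<otimes> r))) summable_on ?A \<times> ?A"
      by (rule double_sum_translate(1)) (auto intro: l1_summable f g)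
    then have "(\<lambda>x. M * (case x of (t, r) \<Rightarrow> cmod (f t) * cmod (g (inv t \<otimes> r)))) summable_on ?A \<times> ?A"
      by (rule summable_on_cmult_right)
    then have "(\<lambda>x. cmod (case x of (t, r) \<Rightarrow> ?k t r)) summable_on ?A \<times> ?A"
    proof (rule summable_on_comparison_test)
      fix x assume "x \<in> ?A \<times> ?A"
      obtain t r where x: "x = (t, r)" by (cases x)
      show "cmod (case x of (t, r) \<Rightarrow> ?k t r) \<le> M * (case x of (t, r) \<Rightarrow> cmod (f t) * cmod (g (inv t \<otimes> r)))"
        using mult_left_mono[OF h[of "inv r \<otimes> s"], of "cmod (f t) * cmod (g (inv t \<otimes> r))"]
        by (simp add: x norm_mult mult_ac)
    qed simp
    then have sm: "(\<lambda>(t, r). ?k t r) summable_on ?A \<times> ?A"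
      by (rule abs_summable_summable)
    have "conv G (conv G f g) h s = (\<Sum>\<^sub>\<infinity>r\<in>?A. (\<Sum>\<^sub>\<infinity>t\<in>?A. ?k t r))"
      using s by (simp add: conv_def infsum_cmult_left' cong: infsum_cong)
    also have "\<dots> = (\<Sum>\<^sub>\<infinity>t\<in>?A. (\<Sum>\<^sub>\<infinity>r\<in>?A. ?k t r))"
      by (rule infsum_swap_banach[symmetric, OF sm])
    also have "\<dots> = (\<Sum>\<^sub>\<infinity>t\<in>?A. f t * conv G g h (inv t \<otimes> s))"
    proof (rule infsum_cong)
      fix t assume t: "t \<in> ?A"
      have "(\<Sum>\<^sub>\<infinity>r\<in>?A. ?k t r) = f t * (\<Sum>\<^sub>\<infinity>r\<in>?A. g (inv t \<otimes> r) * h (inv r \<otimes> s))"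
        by (simp add: mult.assoc infsum_cmult_right')
      also have "(\<Sum>\<^sub>\<infinity>r\<in>?A. g (inv t \<otimes> r) * h (inv r \<otimes> s))
          = (\<Sum>\<^sub>\<infinity>r\<in>?A. g (inv t \<otimes> r) * h (inv (inv t \<otimes> r) \<otimes> (inv t \<otimes> s)))"
        using s t by (intro infsum_cong) (simp add: inv_mult_group m_assoc)
      also have "\<dots> = (\<Sum>\<^sub>\<infinity>k\<in>?A. g k * h (inv k \<otimes> (inv t \<otimes> s)))"
        by (rule infsum_left_translate[OF t])
      finally show "(\<Sum>\<^sub>\<infinity>r\<in>?A. ?k t r) = f t * conv G g h (inv t \<otimes> s)"
        using s t by (simp add: conv_def)
    qed
    finally show ?thesis using s by (simp add: conv_def)
  qed (simp add: conv_off)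
qed

lemma conv_finite_left:
  assumes "finite B" "B \<subseteq> carrier G" "\<And>t. t \<notin> B \<Longrightarrow> f t = 0" "s \<in> carrier G"
  shows "conv G f h s = (\<Sum>t\<in>B. f t * h (inv t \<otimes> s))"
proof -
  have "((\<lambda>t. f t * h (inv t \<otimes> s)) has_sum (\<Sum>t\<in>B. f t * h (inv t \<otimes> s))) (carrier G)"
    using assms by (intro has_sum_finite_neutralI[of B]) auto
  then show ?thesis using assms(4) by (simp add: conv_def infsumI)
qed

lemma conv_delta_left:
  assumes "t \<in> carrier G" "s \<in> carrier G"
  shows "conv G (delta t) h s = h (inv t \<otimes> s)"
  using conv_finite_left[of "{t}" "delta t" s h] assms by (simp add: delta_def)

lemma conv_delta_right:
  assumes "t \<in> carrier G" "s \<in> carrier G"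
  shows "conv G f (delta t) s = f (s \<otimes> inv t)"
proof -
  have "((\<lambda>r. f (s \<otimes> inv r) * delta t r) has_sum f (s \<otimes> inv t)) (carrier G)"
    by (rule has_sum_finite_neutralI[of "{t}"]) (use assms in \<open>auto simp: delta_def\<close>)
  then show ?thesis using assms by (simp add: conv_altdef infsumI)
qed

lemma conv_unit_right:
  assumes "\<And>s. s \<notin> carrier G \<Longrightarrow> f s = 0"
  shows "conv G f (delta \<one>) = f"
proof
  show "conv G f (delta \<one>) s = f s" for s
    by (cases "s \<in> carrier G") (simp_all add: conv_delta_right conv_off assms)
qed

lemma conv_unit_left:
  assumes "\<And>s. s \<notin> carrier G \<Longrightarrow> f s = 0"
  shows "conv G (delta \<one>) f = f"
proof
  show "conv G (delta \<one>) f s = f s" for s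
    by (cases "s \<in> carrier G") (simp_all add: conv_delta_left conv_off assms)
qed

text \<open>
  This is Young's inequality for \<open>f * \<delta>\<^sub>e = f\<close>.
\<close>

lemma l1_subset_lp:
  assumes "f \<in> lp_space 1 (carrier G)" "1 \<le> p"
  shows "f \<in> lp_space p (carrier G)"
  using conv_young(1)[OF assms(1) delta_in_lp_space[OF one_closed] assms(2)]
    conv_unit_right[of f] lp_space_off[OF assms(1)] by simp

section \<open>The algebra of convolution operators\<close>

lemma right_reg_delta:
  assumes "t \<in> carrier G"
  shows "right_reg p G (inv t) (delta \<one>) = delta t"
proof
  fix s
  have "s \<otimes> inv t = \<one> \<longleftrightarrow> s = t" if "s \<in> carrier G"
    using that assms inv_solve_right'[of \<one> s t] by auto
  then show "right_reg p G (inv t) (delta \<one>) s = delta t s"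
    using assms by (auto simp: right_reg_def delta_in_lp_space) (auto simp: delta_def)
qed

lemma right_reg_in_lp_space:
  assumes "t \<in> carrier G"
  shows "right_reg p G t \<xi> \<in> lp_space p (carrier G)"
proof (cases "\<xi> \<in> lp_space p (carrier G)")
  case True
  have "((\<lambda>s. cmod (\<xi> (s \<otimes> t)) powr p) has_sum (\<Sum>\<^sub>\<infinity>s\<in>carrier G. cmod (\<xi> s) powr p)) (carrier G)"
    using has_sum_infsum[OF lp_space_summable[OF True]]
      has_sum_right_translate[OF assms, of "\<lambda>s. cmod (\<xi> s) powr p"] by simp
  then have "(\<lambda>s. cmod (\<xi> (s \<otimes> t)) powr p) summable_on carrier G" by (rule has_sum_imp_summable)
  then have "(\<lambda>s. cmod (right_reg p G t \<xi> s) powr p) summable_on carrier G"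
    by (rule summable_on_cong[THEN iffD1, rotated]) (simp add: right_reg_def True)
  then show ?thesis by (auto simp: lp_space_def right_reg_def)
qed (simp add: right_reg_def lp_space_zero)

text \<open>
  Commuting with right translations makes the matrix of \<open>T\<close> depend on \<open>s t\<^sup>-\<^sup>1\<close> only.
\<close>

lemma CV_delta_shift:
  assumes "T \<in> carrier (CV p G)" "t \<in> carrier G" "s \<in> carrier G"
  shows "T (delta t) s = T (delta \<one>) (s \<otimes> inv t)"
proof -
  have "T (right_reg p G (inv t) (delta \<one>)) = right_reg p G (inv t) (T (delta \<one>))"
    using assms(1,2) by (auto simp: CV_carrier fun_eq_iff)
  moreover have "T (delta \<one>) \<in> lp_space p (carrier G)"
    by (rule CV_delta_in_lp_space[OF assms(1) one_closed])
  ultimately show ?thesis using assms by (simp add: right_reg_delta) (simp add: right_reg_def)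
qed

lemma CV_eqI:
  assumes "T \<in> carrier (CV p G)" "U \<in> carrier (CV p G)" "T (delta \<one>) = U (delta \<one>)" "1 \<le> p"
  shows "T = U"
proof (rule bounded_ops_eqI[of T p "carrier G" U])
  show "T (delta t) = U (delta t)" if t: "t \<in> carrier G" for t
  proof
    fix s
    show "T (delta t) s = U (delta t) s"
    proof (cases "s \<in> carrier G")
      case True
      then show ?thesis
        by (simp only: CV_delta_shift[OF assms(1) t] CV_delta_shift[OF assms(2) t] assms(3))
    next
      case False
      then show ?thesis
        using lp_space_off[OF CV_delta_in_lp_space[OF assms(1) t]]
          lp_space_off[OF CV_delta_in_lp_space[OF assms(2) t]] by simp
    qed
  qed
qed (use assms in \<open>auto simp: CV_carrier\<close>)

lemma CV_eq_conv:
  assumes T: "T \<in> carrier (CV p G)" and \<xi>: "\<xi> \<in> lp_space p (carrier G)" and p: "1 \<le> p"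
  shows "T \<xi> = conv G (T (delta \<one>)) \<xi>"
proof
  fix s
  have Tb: "T \<in> bounded_ops p (carrier G)" using T by (simp add: CV_carrier)
  show "T \<xi> s = conv G (T (delta \<one>)) \<xi> s"
  proof (cases "s \<in> carrier G")
    case s: True
    have "((\<lambda>t. \<xi> t * T (delta t) s) has_sum T \<xi> s) (carrier G)"
      by (rule bounded_ops_has_sum[OF Tb p \<xi>])
    then have "((\<lambda>t. T (delta \<one>) (s \<otimes> inv t) * \<xi> t) has_sum T \<xi> s) (carrier G)"
      by (rule has_sum_cong[THEN iffD1, rotated]) (simp only: CV_delta_shift[OF T _ s] mult.commute)
    then show ?thesis using s by (simp add: conv_altdef infsumI)
  next
    case False
    then show ?thesis using lp_space_off[OF bounded_opsD(1)[OF Tb \<xi>]] by (simp add: conv_off)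
  qed
qed

lemma conv_op_in_CV:
  assumes f: "f \<in> lp_space 1 (carrier G)" and p: "1 \<le> p"
  shows "conv_op p G f \<in> carrier (CV p G)"
  unfolding CV_carrier
proof (intro conjI ballI)
  show "conv_op p G f \<in> bounded_ops p (carrier G)"
  proof (rule bounded_opsI[where C = "lp_norm 1 (carrier G) f"])
    fix \<xi> \<zeta> s assume \<xi>: "\<xi> \<in> lp_space p (carrier G)" and \<zeta>: "\<zeta> \<in> lp_space p (carrier G)"
    show "conv_op p G f (\<lambda>s. \<xi> s + \<zeta> s) s = conv_op p G f \<xi> s + conv_op p G f \<zeta> s"
      using conv_lin_right[OF f norm_le_lp_norm[OF \<xi> p] norm_le_lp_norm[OF \<zeta> p], where c = 1]
      by (simp add: conv_op_def \<xi> \<zeta> lp_space_add p)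
  next
    fix \<xi> c s assume \<xi>: "\<xi> \<in> lp_space p (carrier G)"
    show "conv_op p G f (\<lambda>s. c * \<xi> s) s = c * conv_op p G f \<xi> s"
      by (simp add: conv_op_def \<xi> lp_space_scale conv_def infsum_cmult_right'[symmetric] mult_ac)
  qed (simp_all add: conv_op_def conv_young[OF f _ p])
  fix t assume t: "t \<in> carrier G"
  show "conv_op p G f \<circ> right_reg p G t = right_reg p G t \<circ> conv_op p G f"
  proof
    fix \<xi>
    show "(conv_op p G f \<circ> right_reg p G t) \<xi> = (right_reg p G t \<circ> conv_op p G f) \<xi>"
    proof (cases "\<xi> \<in> lp_space p (carrier G)")
      case True
      have "conv G f (right_reg p G t \<xi>) = right_reg p G t (conv G f \<xi>)"
      proof
        fix s
        have eq: "right_reg p G t (conv G f \<xi>) s = (if s \<in> carrier G then conv G f \<xi> (s \<otimes> t) else 0)"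
          by (simp add: right_reg_def conv_young(1)[OF f True p])
        show "conv G f (right_reg p G t \<xi>) s = right_reg p G t (conv G f \<xi>) s"
          unfolding eq using t by (auto simp: right_reg_def True conv_def m_assoc intro!: infsum_cong)
      qed
      then show ?thesis by (simp add: conv_op_def True right_reg_in_lp_space t)
    next
      case False
      then show ?thesis by (auto simp: conv_op_def right_reg_def lp_space_zero conv_def)
    qed
  qed
qed

lemma conv_op_delta_one:
  assumes "f \<in> lp_space 1 (carrier G)"
  shows "conv_op p G f (delta \<one>) = f"
  by (simp add: conv_op_def delta_in_lp_space conv_unit_right lp_space_off[OF assms])

lemma CV_add:
  assumes "T \<in> carrier (CV p G)" "U \<in> carrier (CV p G)" "1 \<le> p"
  shows "(\<lambda>\<xi> s. T \<xi> s + U \<xi> s) \<in> carrier (CV p G)"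
  unfolding CV_carrier
proof (intro conjI ballI)
  have T: "T \<in> bounded_ops p (carrier G)" and U: "U \<in> bounded_ops p (carrier G)"
    using assms by (auto simp: CV_carrier)
  show "(\<lambda>\<xi> s. T \<xi> s + U \<xi> s) \<in> bounded_ops p (carrier G)"
    by (rule bounded_ops_add[OF T U assms(3)])
  fix t assume t: "t \<in> carrier G"
  have c: "T (right_reg p G t \<xi>) = right_reg p G t (T \<xi>)" "U (right_reg p G t \<xi>) = right_reg p G t (U \<xi>)" for \<xi>
    using assms(1,2) t by (auto simp: CV_carrier fun_eq_iff)
  have lp: "T \<xi> \<in> lp_space p (carrier G)" "U \<xi> \<in> lp_space p (carrier G)" for \<xi>
    using bounded_opsD(1,2)[OF T] bounded_opsD(1,2)[OF U] lp_space_zero by metis+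
  show "(\<lambda>\<xi> s. T \<xi> s + U \<xi> s) \<circ> right_reg p G t = right_reg p G t \<circ> (\<lambda>\<xi> s. T \<xi> s + U \<xi> s)"
    by (simp add: fun_eq_iff c) (simp add: right_reg_def lp lp_space_add assms(3))
qed

lemma CV_scale:
  assumes "T \<in> carrier (CV p G)" "1 \<le> p"
  shows "(\<lambda>\<xi> s. c * T \<xi> s) \<in> carrier (CV p G)"
  unfolding CV_carrier
proof (intro conjI ballI)
  have T: "T \<in> bounded_ops p (carrier G)" using assms by (auto simp: CV_carrier)
  show "(\<lambda>\<xi> s. c * T \<xi> s) \<in> bounded_ops p (carrier G)"
    by (rule bounded_ops_scale[OF T assms(2)])
  fix t assume t: "t \<in> carrier G"
  have c: "T (right_reg p G t \<xi>) = right_reg p G t (T \<xi>)" for \<xi>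
    using assms(1) t by (auto simp: CV_carrier fun_eq_iff)
  have lp: "T \<xi> \<in> lp_space p (carrier G)" for \<xi>
    using bounded_opsD(1,2)[OF T] lp_space_zero by metis
  show "(\<lambda>\<xi> s. c * T \<xi> s) \<circ> right_reg p G t = right_reg p G t \<circ> (\<lambda>\<xi> s. c * T \<xi> s)"
    by (simp add: fun_eq_iff c) (simp add: right_reg_def lp lp_space_scale)
qed

lemma CV_compose:
  assumes "T \<in> carrier (CV p G)" "U \<in> carrier (CV p G)"
  shows "T \<circ> U \<in> carrier (CV p G)"
  unfolding CV_carrier
proof (intro conjI ballI)
  show "T \<circ> U \<in> bounded_ops p (carrier G)"
    using assms by (intro bounded_ops_compose) (auto simp: CV_carrier)
  fix t assume "t \<in> carrier G"
  then have "T \<circ> right_reg p G t = right_reg p G t \<circ> T" "U \<circ> right_reg p G t = right_reg p G t \<circ> U"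
    using assms by (auto simp: CV_carrier)
  then show "T \<circ> U \<circ> right_reg p G t = right_reg p G t \<circ> (T \<circ> U)"
    by (metis comp_assoc)
qed

lemma CV_one: "\<one>\<^bsub>CV p G\<^esub> = conv_op p G (delta \<one>)"
proof
  show "\<one>\<^bsub>CV p G\<^esub> \<xi> = conv_op p G (delta \<one>) \<xi>" for \<xi>
    using conv_unit_left[of \<xi>] lp_space_off[of \<xi> p "carrier G"] by (auto simp: CV_def conv_op_def)
qed

lemma CV_one_closed: "1 \<le> p \<Longrightarrow> \<one>\<^bsub>CV p G\<^esub> \<in> carrier (CV p G)"
  unfolding CV_one by (intro conv_op_in_CV delta_in_lp_space one_closed)

lemma CV_zero_closed: "1 \<le> p \<Longrightarrow> \<zero>\<^bsub>CV p G\<^esub> \<in> carrier (CV p G)"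
proof -
  assume p: "1 \<le> p"
  have "(\<lambda>\<xi> s. 0 * \<one>\<^bsub>CV p G\<^esub> \<xi> s) \<in> carrier (CV p G)" by (rule CV_scale[OF CV_one_closed[OF p] p])
  moreover have "\<zero>\<^bsub>CV p G\<^esub> = (\<lambda>\<xi> s. 0)" by (simp add: CV_def)
  ultimately show ?thesis by simp
qed

lemma CV_range_in_lp_space:
  assumes "T \<in> carrier (CV p G)"
  shows "T \<xi> \<in> lp_space p (carrier G)"
  using assms bounded_opsD(1,2)[of T p "carrier G"] lp_space_zero unfolding CV_carrier by metis

lemma CV_linear:
  assumes "T \<in> carrier (CV p G)" "U \<in> carrier (CV p G)" "V \<in> carrier (CV p G)"
  shows "T (\<lambda>s. U \<xi> s + V \<xi> s) = (\<lambda>s. T (U \<xi>) s + T (V \<xi>) s)"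
  by (rule bounded_opsD(3)[OF _ CV_range_in_lp_space[OF assms(2)] CV_range_in_lp_space[OF assms(3)]])
    (use assms(1) in \<open>simp add: CV_carrier\<close>)

lemma ring_CV:
  assumes p: "1 \<le> p"
  shows "ring (CV p G)"
proof (rule ringI)
  show "abelian_group (CV p G)"
  proof (rule abelian_groupI)
    show "\<exists>U\<in>carrier (CV p G). U \<oplus>\<^bsub>CV p G\<^esub> T = \<zero>\<^bsub>CV p G\<^esub>" if "T \<in> carrier (CV p G)" for T
      using CV_scale[OF that p, of "-1"] by (intro bexI[of _ "\<lambda>\<xi> s. (-1) * T \<xi> s"]) (auto simp: CV_def)
    show "T \<oplus>\<^bsub>CV p G\<^esub> U \<in> carrier (CV p G)" if "T \<in> carrier (CV p G)" "U \<in> carrier (CV p G)" for T U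
      using CV_add[OF that p] by (simp add: CV_def)
  qed (simp_all add: CV_zero_closed p, simp_all add: CV_def algebra_simps)
  show "monoid (CV p G)"
  proof (rule monoidI)
    show "T \<otimes>\<^bsub>CV p G\<^esub> U \<in> carrier (CV p G)" if "T \<in> carrier (CV p G)" "U \<in> carrier (CV p G)" for T U
      using CV_compose[OF that] by (simp add: CV_def)
    show "\<one>\<^bsub>CV p G\<^esub> \<otimes>\<^bsub>CV p G\<^esub> T = T" if "T \<in> carrier (CV p G)" for T
      using CV_range_in_lp_space[OF that] by (auto simp: CV_def)
    show "T \<otimes>\<^bsub>CV p G\<^esub> \<one>\<^bsub>CV p G\<^esub> = T" if "T \<in> carrier (CV p G)" for T
    proof
      have T: "T \<in> bounded_ops p (carrier G)" using that by (simp add: CV_carrier)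
      show "(T \<otimes>\<^bsub>CV p G\<^esub> \<one>\<^bsub>CV p G\<^esub>) \<xi> = T \<xi>" for \<xi>
        using bounded_opsD(2)[OF T, of \<xi>] bounded_ops_zero[OF T] by (auto simp: CV_def)
    qed
  qed (simp_all add: CV_one_closed p, simp_all add: CV_def comp_assoc)
  show "V \<otimes>\<^bsub>CV p G\<^esub> (T \<oplus>\<^bsub>CV p G\<^esub> U) = V \<otimes>\<^bsub>CV p G\<^esub> T \<oplus>\<^bsub>CV p G\<^esub> V \<otimes>\<^bsub>CV p G\<^esub> U"
    if "T \<in> carrier (CV p G)" "U \<in> carrier (CV p G)" "V \<in> carrier (CV p G)" for T U V
    using CV_linear[OF that(3,1,2)] by (simp add: CV_def fun_eq_iff)
qed (simp add: CV_def fun_eq_iff)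

end


section \<open>Conjugation\<close>

definition conjugate :: "('a, 'b) monoid_scheme \<Rightarrow> 'a \<Rightarrow> 'a \<Rightarrow> 'a" where
  "conjugate G x g = x \<otimes>\<^bsub>G\<^esub> g \<otimes>\<^bsub>G\<^esub> inv\<^bsub>G\<^esub> x"

context group
begin

lemma conjugate_closed [simp]:
  "x \<in> carrier G \<Longrightarrow> g \<in> carrier G \<Longrightarrow> conjugate G x g \<in> carrier G"
  by (simp add: conjugate_def)

lemma conjugate_mult:
  "x \<in> carrier G \<Longrightarrow> y \<in> carrier G \<Longrightarrow> g \<in> carrier G \<Longrightarrow>
     conjugate G (x \<otimes> y) g = conjugate G x (conjugate G y g)"
  by (simp add: conjugate_def inv_mult_group m_assoc)

lemma conjugate_one [simp]: "g \<in> carrier G \<Longrightarrow> conjugate G \<one> g = g"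
  by (simp add: conjugate_def)

lemma conjugate_unit [simp]: "x \<in> carrier G \<Longrightarrow> conjugate G x \<one> = \<one>"
  by (simp add: conjugate_def)

lemma conjugate_inv [simp]:
  "x \<in> carrier G \<Longrightarrow> g \<in> carrier G \<Longrightarrow> conjugate G (inv x) (conjugate G x g) = g"
  "x \<in> carrier G \<Longrightarrow> g \<in> carrier G \<Longrightarrow> conjugate G x (conjugate G (inv x) g) = g"
  by (simp_all add: conjugate_mult[symmetric])

lemma conjugate_prod:
  "x \<in> carrier G \<Longrightarrow> g \<in> carrier G \<Longrightarrow> h \<in> carrier G \<Longrightarrow>
     conjugate G x (g \<otimes> h) = conjugate G x g \<otimes> conjugate G x h"
  by (simp add: conjugate_def m_assoc)

lemma ICC_group_iff:
  "ICC_group G \<longleftrightarrow>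
     (\<forall>x\<in>carrier G. x \<noteq> \<one> \<longrightarrow> infinite {conjugate G g x | g. g \<in> carrier G})"
proof -
  have cls: "conjugacy_classes G = (\<lambda>x. {conjugate G g x | g. g \<in> carrier G}) ` carrier G"
    unfolding conjugacy_classes_def orbits_def orbit_def conjugate_def by (rule Setcompr_eq_image)
  have triv: "{conjugate G g x | g. g \<in> carrier G} = {\<one>} \<longleftrightarrow> x = \<one>" if "x \<in> carrier G" for x
  proof
    assume "{conjugate G g x | g. g \<in> carrier G} = {\<one>}"
    moreover have "conjugate G \<one> x \<in> {conjugate G g x | g. g \<in> carrier G}" by blast
    ultimately show "x = \<one>" using that by simp
  qed (auto intro!: exI[of _ \<one>])
  have "group G" ..
  then have "ICC_group G \<longleftrightarrow> (\<forall>x\<in>carrier G. {conjugate G g x | g. g \<in> carrier G} \<noteq> {\<one>} \<longrightarrow>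
      infinite {conjugate G g x | g. g \<in> carrier G})"
    unfolding ICC_group_def cls by (simp only: ball_simps simp_thms)
  also have "\<dots> \<longleftrightarrow> (\<forall>x\<in>carrier G. x \<noteq> \<one> \<longrightarrow> infinite {conjugate G g x | g. g \<in> carrier G})"
    by (rule ball_cong) (simp_all only: triv)
  finally show ?thesis .
qed

text \<open>
  This is the argument by which B. H. Neumann shows that a group is not a finite union of cosets of subgroups of
  infinite index.  The conjugators that move \<open>g\<close> into the finite set \<open>E\<close> form finitely many cosets of the
  centralizer of \<open>g\<close>.  If every conjugator were bad, then those in a coset that moves \<open>g\<close> off \<open>E\<close> would be bad
  because of the other elements \<open>F\<close>.  Translating this coset, the finitely many cosets that move \<open>g\<close> into \<open>E\<close>
  are bad because of \<open>F\<close> too, with the larger finite set \<open>E'\<close> in place of \<open>E\<close>.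
\<close>

lemma exists_conjugator_avoiding:
  assumes "finite F" "F \<subseteq> carrier G" "finite E"
    and "\<And>g. g \<in> F \<Longrightarrow> infinite {conjugate G x g | x. x \<in> carrier G}"
  shows "\<exists>x\<in>carrier G. \<forall>g\<in>F. conjugate G x g \<notin> E"
  using assms
proof (induction F arbitrary: E)
  case (insert g F)
  have g: "g \<in> carrier G" using insert.prems by simp
  show ?case
  proof (rule ccontr)
    assume "\<not> ?thesis"
    then have bad: "conjugate G x g \<in> E \<or> (\<exists>g'\<in>F. conjugate G x g' \<in> E)" if "x \<in> carrier G" for x
      using that by auto
    have "\<not> {conjugate G x g | x. x \<in> carrier G} \<subseteq> E"
      using insert.prems(2,3) finite_subset by blast
    then obtain t where t: "t \<in> carrier G" "conjugate G t g \<notin> E" by blast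
    define y where "y h = (SOME y. y \<in> carrier G \<and> conjugate G y g = h)" for h
    define E' where "E' = E \<union> (\<Union>h\<in>E. conjugate G (y h \<otimes> inv t) ` E)"
    have "\<exists>x\<in>carrier G. \<forall>g\<in>F. conjugate G x g \<notin> E'"
      using insert.prems by (intro insert.IH) (auto simp: E'_def)
    then obtain x where x: "x \<in> carrier G" "\<And>g'. g' \<in> F \<Longrightarrow> conjugate G x g' \<notin> E'" by blast
    then have h: "conjugate G x g \<in> E" using bad[OF x(1)] by (auto simp: E'_def)
    define z where "z = y (conjugate G x g)"
    have z: "z \<in> carrier G" "conjugate G z g = conjugate G x g"
      using someI[of "\<lambda>z. z \<in> carrier G \<and> conjugate G z g = conjugate G x g" x] x(1)
      unfolding z_def y_def by auto
    \<comment> \<open>\<open>x\<close> translated into the coset of \<open>t\<close>, so that \<open>r\<close> moves \<open>g\<close> off \<open>E\<close>\<close>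
    define r where "r = t \<otimes> (inv z \<otimes> x)"
    have r: "r \<in> carrier G" using t z x by (simp add: r_def)
    have "conjugate G r g = conjugate G t (conjugate G (inv z) (conjugate G x g))"
      using t z x g by (simp add: r_def conjugate_mult)
    also have "\<dots> = conjugate G t g"
      using z(1) g by (simp add: z(2)[symmetric])
    finally obtain g' where g': "g' \<in> F" "conjugate G r g' \<in> E"
      using bad[OF r] t(2) by auto
    have g'c: "g' \<in> carrier G" using g' insert.prems by auto
    have "(z \<otimes> inv t) \<otimes> r = x"
      using t z x by (simp add: r_def m_assoc)
    then have "conjugate G (z \<otimes> inv t) (conjugate G r g') = conjugate G x g'"
      using conjugate_mult[of "z \<otimes> inv t" r g'] z t r g'c by simp
    then have "conjugate G x g' \<in> E'"
      using h g'(2) unfolding E'_def z_def by (metis UN_I UnI2 imageI)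
    then show False using x(2) g'(1) by blast
  qed
qed auto

section \<open>Simplicity for ICC groups\<close>

lemma lp_norm_delta: "t \<in> carrier G \<Longrightarrow> lp_norm 1 (carrier G) (delta t) = 1"
proof -
  assume t: "t \<in> carrier G"
  have "((\<lambda>s. cmod (delta t s)) has_sum 1) (carrier G)"
    by (rule has_sum_finite_neutralI[of "{t}"]) (use t in \<open>auto simp: delta_def\<close>)
  then show ?thesis by (simp add: l1_norm infsumI)
qed

lemma translation_isometry:
  assumes "t \<in> carrier G" "\<xi> \<in> lp_space p (carrier G)" "1 \<le> p"
  shows "lp_norm p (carrier G) (conv_op p G (delta t) \<xi>) \<le> lp_norm p (carrier G) \<xi>"
  using conv_young(2)[OF delta_in_lp_space[OF assms(1)] assms(2,3)] assms
  by (simp add: conv_op_def lp_norm_delta)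

lemma CV_conjugate_entry:
  assumes T: "T \<in> carrier (CV p G)" and x: "x \<in> carrier G" and t: "t \<in> carrier G"
    and s: "s \<in> carrier G" and p: "1 \<le> p"
  shows "(conv_op p G (delta x) \<circ> T \<circ> conv_op p G (delta (inv x))) (delta t) s
         = T (delta \<one>) (conjugate G (inv x) (s \<otimes> inv t))"
proof -
  let ?V = "conv_op p G (delta x) \<circ> T \<circ> conv_op p G (delta (inv x))"
  have "?V \<in> carrier (CV p G)"
    using x p by (intro CV_compose conv_op_in_CV delta_in_lp_space T) auto
  then have "?V (delta t) s = ?V (delta \<one>) (s \<otimes> inv t)"
    by (rule CV_delta_shift[OF _ t s])
  also have "\<dots> = conv G (delta x) (T (delta (inv x))) (s \<otimes> inv t)"
    using x CV_range_in_lp_space[OF T] by (simp add: conv_op_delta_one delta_in_lp_space) (simp add: conv_op_def)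
  also have "\<dots> = T (delta (inv x)) (inv x \<otimes> (s \<otimes> inv t))"
    using x s t by (simp add: conv_delta_left)
  also have "\<dots> = T (delta \<one>) (inv x \<otimes> (s \<otimes> inv t) \<otimes> inv (inv x))"
    using x s t by (intro CV_delta_shift[OF T]) auto
  finally show ?thesis by (simp add: conjugate_def)
qed

text \<open>
  Conjugating by \<open>x\<close> permutes the coefficients of an operator.  In an ICC group \<open>x\<close> can be chosen so that
  this moves all coefficients away from any given finite set, except the one at the identity.
\<close>

lemma weak_star_limit_of_conjugates:
  assumes ICC: "ICC_group G" and p: "1 \<le> p"
    and I: "closedin (CV_weak_star p G) I" and T: "T \<in> carrier (CV p G)"
    and conj: "\<And>x. x \<in> carrier G \<Longrightarrow> conv_op p G (delta x) \<circ> T \<circ> conv_op p G (delta (inv x)) \<in> I"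
  shows "(\<lambda>\<xi> s. T (delta \<one>) \<one> * \<one>\<^bsub>CV p G\<^esub> \<xi> s) \<in> I"
proof -
  let ?A = "carrier G" and ?f = "T (delta \<one>)"
  define c where "c = ?f \<one>"
  define V where "V x = conv_op p G (delta x) \<circ> T \<circ> conv_op p G (delta (inv x))" for x
  define S where "S = (\<lambda>\<xi> s. c * \<one>\<^bsub>CV p G\<^esub> \<xi> s)"
  have S: "S \<in> carrier (CV p G)" unfolding S_def by (intro CV_scale CV_one_closed p)
  have VC: "V x \<in> carrier (CV p G)" if "x \<in> ?A" for x
    unfolding V_def using that p by (intro CV_compose conv_op_in_CV delta_in_lp_space T) auto
  \<comment> \<open>the net is indexed by the finite sets \<open>K\<close> that its members conjugate off themselves\<close>
  define x where "x K = (SOME x. x \<in> ?A \<and> (\<forall>g\<in>K. conjugate G x g \<notin> K))" for K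
  have x: "x K \<in> ?A \<and> (\<forall>g\<in>K. conjugate G (x K) g \<notin> K)" if "finite K" "K \<subseteq> ?A - {\<one>}" for K
  proof -
    have "\<exists>x\<in>?A. \<forall>g\<in>K. conjugate G x g \<notin> K"
      using that ICC by (intro exists_conjugator_avoiding) (auto simp: ICC_group_iff)
    then have "\<exists>x. x \<in> ?A \<and> (\<forall>g\<in>K. conjugate G x g \<notin> K)" by blast
    then show ?thesis unfolding x_def by (rule someI_ex)
  qed
  let ?F = "finite_subsets_at_top (?A - {\<one>})"
  have ev_x: "eventually (\<lambda>K. x K \<in> ?A) ?F"
    by (rule eventually_finite_subsets_at_top_weakI) (use x in blast)
  have "T \<in> bounded_ops p ?A" using T by (simp add: CV_carrier)
  then obtain C where C: "0 < C" "\<And>\<xi>. \<xi> \<in> lp_space p ?A \<Longrightarrow> lp_norm p ?A (T \<xi>) \<le> C * lp_norm p ?A \<xi>"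
    using bounded_ops_bound[of T p ?A] by blast
  have V_le: "lp_norm p ?A (V y \<xi>) \<le> (C + cmod c) * lp_norm p ?A \<xi>"
    if y: "y \<in> ?A" and \<xi>: "\<xi> \<in> lp_space p ?A" for y \<xi>
  proof -
    have in_lp: "conv_op p G (delta (inv y)) \<xi> \<in> lp_space p ?A"
      using y by (intro CV_range_in_lp_space conv_op_in_CV delta_in_lp_space p) auto
    have "lp_norm p ?A (V y \<xi>) \<le> lp_norm p ?A (T (conv_op p G (delta (inv y)) \<xi>))"
      unfolding V_def comp_def by (intro translation_isometry y CV_range_in_lp_space[OF T] p)
    also have "\<dots> \<le> C * lp_norm p ?A (conv_op p G (delta (inv y)) \<xi>)"
      by (rule C(2)[OF in_lp])
    also have "\<dots> \<le> C * lp_norm p ?A \<xi>"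
      using C(1) translation_isometry[OF inv_closed[OF y] \<xi> p] by (intro mult_left_mono) auto
    also have "\<dots> \<le> (C + cmod c) * lp_norm p ?A \<xi>"
      by (intro mult_right_mono lp_norm_nonneg) auto
    finally show ?thesis .
  qed
  have entry: "((\<lambda>K. V (x K) (delta t) h) \<longlongrightarrow> S (delta t) h) ?F" if t: "t \<in> ?A" for t h
  proof (cases "h \<in> ?A")
    case False
    have "eventually (\<lambda>K. V (x K) (delta t) h = 0) ?F"
      using ev_x by eventually_elim (rule lp_space_off[OF CV_delta_in_lp_space[OF VC t] False])
    then show ?thesis
      using lp_space_off[OF CV_delta_in_lp_space[OF S t] False] by (simp add: tendsto_eventually)
  next
    case h: True
    define r where "r = h \<otimes> inv t"
    have r: "r \<in> ?A" using h t by (simp add: r_def)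
    have S_entry: "S (delta t) h = (if r = \<one> then c else 0)"
    proof -
      have "r = \<one> \<longleftrightarrow> h = t" using h t inv_solve_right'[of \<one> h t] by (auto simp: r_def)
      then show ?thesis using t by (simp add: S_def CV_def delta_in_lp_space) (simp add: delta_def)
    qed
    have V_entry: "eventually (\<lambda>K. V (x K) (delta t) h = ?f (conjugate G (inv (x K)) r)) ?F"
      using ev_x by eventually_elim (simp only: V_def CV_conjugate_entry[OF T _ t h p] r_def)
    have "((\<lambda>K. ?f (conjugate G (inv (x K)) r)) \<longlongrightarrow> (if r = \<one> then c else 0)) ?F"
    proof (cases "r = \<one>")
      case True
      have "eventually (\<lambda>K. ?f (conjugate G (inv (x K)) r) = c) ?F"
        using ev_x by eventually_elim (simp add: True c_def)
      then show ?thesis using True by (simp add: tendsto_eventually)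
    next
      case False
      have "((\<lambda>K. ?f (conjugate G (inv (x K)) r)) \<longlongrightarrow> 0) ?F"
      proof (rule tendstoI)
        fix e :: real assume "0 < e"
        \<comment> \<open>the places of the large coefficients; if \<open>K\<close> contains \<open>L\<close> and \<open>r\<close>, then \<open>x K\<close> conjugates none of them to \<open>r\<close>\<close>
        define L where "L = {s. e \<le> cmod (?f s)} - {\<one>}"
        have "finite L"
          unfolding L_def using lp_level_finite[OF CV_delta_in_lp_space[OF T one_closed] p \<open>0 < e\<close>] by simp
        moreover have "L \<subseteq> ?A"
          using lp_space_off[OF CV_delta_in_lp_space[OF T one_closed]] \<open>0 < e\<close> unfolding L_def by force
        moreover have "\<one> \<notin> L" by (simp add: L_def)
        ultimately have "eventually (\<lambda>K. finite K \<and> insert r L \<subseteq> K \<and> K \<subseteq> ?A - {\<one>}) ?F"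
          unfolding eventually_finite_subsets_at_top
          using r False by (intro exI[of _ "insert r L"]) auto
        then show "eventually (\<lambda>K. dist (?f (conjugate G (inv (x K)) r)) 0 < e) ?F"
        proof eventually_elim
          case (elim K)
          then have xK: "x K \<in> ?A" "\<And>g. g \<in> K \<Longrightarrow> conjugate G (x K) g \<notin> K" using x by auto
          let ?g = "conjugate G (inv (x K)) r"
          have "conjugate G (x K) ?g = r" using xK r by simp
          then have "?g \<notin> K" using xK(2)[of ?g] elim by auto
          then have "?g \<notin> L" using elim by blast
          moreover have "?g \<noteq> \<one>"
            using \<open>conjugate G (x K) ?g = r\<close> False xK(1) by auto
          ultimately show ?case by (simp add: L_def)
        qed
      qed
      then show ?thesis using False by simp
    qed
    then show ?thesis
      unfolding S_entry by (rule tendsto_cong[THEN iffD2, OF V_entry])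
  qed
  interpret net: bounded_op_net p ?A "\<lambda>K. V (x K)" S ?F "C + cmod c"
  proof
    show "eventually (\<lambda>K. V (x K) \<in> bounded_ops p ?A) ?F"
      using ev_x by eventually_elim (use VC in \<open>simp add: CV_carrier\<close>)
    show "eventually (\<lambda>K. \<forall>\<xi>\<in>lp_space p ?A. lp_norm p ?A (V (x K) \<xi>) \<le> (C + cmod c) * lp_norm p ?A \<xi>) ?F"
      using ev_x by eventually_elim (use V_le in blast)
    show "S \<in> bounded_ops p ?A" using S by (simp add: CV_carrier)
    show "lp_norm p ?A (S \<xi>) \<le> (C + cmod c) * lp_norm p ?A \<xi>" if "\<xi> \<in> lp_space p ?A" for \<xi>
    proof -
      have "lp_norm p ?A (S \<xi>) = cmod c * lp_norm p ?A \<xi>"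
        using that by (simp add: S_def CV_def lp_norm_scale p)
      then show ?thesis using C(1) lp_norm_nonneg[of p ?A \<xi>] by (simp add: distrib_right)
    qed
    show "0 < C + cmod c" using C(1) by (simp add: add_pos_nonneg)
  qed (use entry p in auto)
  have "S \<in> I"
  proof (rule closedin_CV_weak_star_limit[OF I])
    show "?F \<noteq> bot" by simp
    show "eventually (\<lambda>K. V (x K) \<in> I) ?F"
      using ev_x by eventually_elim (use conj V_def in simp)
    show "((\<lambda>K. \<phi> (V (x K))) \<longlongrightarrow> \<phi> S) ?F" if "\<phi> \<in> CV_functionals p G" for \<phi>
    proof (cases "p = 1")
      case True
      then have "\<phi> \<in> (\<lambda>\<eta> T. dual_pair ?A \<eta> (T (delta \<one>))) ` c0_space ?A"
        using that by (simp add: CV_functionals_def)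
      then obtain \<eta> where "\<phi> = (\<lambda>T. dual_pair ?A \<eta> (T (delta \<one>)))" "\<eta> \<in> c0_space ?A"
        by (rule imageE)
      then show ?thesis
        using net.dual_pair_tendsto[OF delta_in_lp_space[OF one_closed]] tight_c0 True by blast
    next
      case False
      then have "\<phi> \<in> tensor_pair ?A ` proj_tensor_series (p / (p - 1)) p ?A"
        using that by (simp add: CV_functionals_def)
      then obtain w where "\<phi> = tensor_pair ?A w" "w \<in> proj_tensor_series (p / (p - 1)) p ?A"
        by (rule imageE)
      then show ?thesis using net.tensor_pair_tendsto[of w] False p by simp
    qed
  qed (fact S)
  then show ?thesis by (simp add: S_def c_def)
qed

lemma weak_star_simple_if_ICC:
  assumes ICC: "ICC_group G" and p: "1 \<le> p"
  shows "weak_star_simple p G"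
  unfolding weak_star_simple_def
proof (intro allI impI)
  fix I assume "CV_ideal I p G \<and> closedin (CV_weak_star p G) I"
  then have ideal: "ideal I (CV p G)" and scale: "\<And>c T. T \<in> I \<Longrightarrow> (\<lambda>\<xi> s. c * T \<xi> s) \<in> I"
    and closed: "closedin (CV_weak_star p G) I"
    by (auto simp: CV_ideal_def)
  interpret I: ideal I "CV p G" by (rule ideal)
  have mult: "x \<otimes>\<^bsub>CV p G\<^esub> y = x \<circ> y" for x y by (simp add: CV_def)
  have zero: "\<zero>\<^bsub>CV p G\<^esub> = (\<lambda>\<xi> s. 0)" by (simp add: CV_def)
  have "I = carrier (CV p G)" if "I \<noteq> {\<zero>\<^bsub>CV p G\<^esub>}"
  proof -
    have "\<zero>\<^bsub>CV p G\<^esub> \<in> I" by (rule additive_subgroup.zero_closed[OF ideal.axioms(1)[OF ideal]])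
    then have "\<not> I \<subseteq> {\<zero>\<^bsub>CV p G\<^esub>}" using that by (metis empty_iff subset_singletonD)
    then obtain T where T: "T \<in> I" "T \<noteq> \<zero>\<^bsub>CV p G\<^esub>" by (auto simp only: subset_iff singleton_iff)
    have TC: "T \<in> carrier (CV p G)" using T(1) by (rule I.a_Hcarr)
    have "T (delta \<one>) \<noteq> (\<lambda>s. 0)"
      using CV_eqI[OF TC CV_zero_closed[OF p] _ p] T(2) zero by auto
    then obtain g where g: "T (delta \<one>) g \<noteq> 0" by auto
    then have gG: "g \<in> carrier G" using lp_space_off[OF CV_delta_in_lp_space[OF TC one_closed]] by blast
    define U where "U = conv_op p G (delta (inv g)) \<circ> T"
    have L: "conv_op p G (delta y) \<in> carrier (CV p G)" if "y \<in> carrier G" for y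
      using that by (intro conv_op_in_CV delta_in_lp_space p)
    have U: "U \<in> I"
      using I.I_l_closed[OF T(1) L[OF inv_closed[OF gG]]] by (simp add: U_def mult)
    have "U (delta \<one>) \<one> = T (delta \<one>) g"
      using gG CV_delta_in_lp_space[OF TC one_closed]
      by (simp add: U_def conv_op_def conv_delta_left)
    then have U1: "U (delta \<one>) \<one> \<noteq> 0" using g by simp
    have "conv_op p G (delta x) \<circ> U \<circ> conv_op p G (delta (inv x)) \<in> I" if x: "x \<in> carrier G" for x
      using I.I_r_closed[OF I.I_l_closed[OF U L[OF x]] L[OF inv_closed[OF x]]] by (simp add: mult)
    then have "(\<lambda>\<xi> s. U (delta \<one>) \<one> * \<one>\<^bsub>CV p G\<^esub> \<xi> s) \<in> I"
      by (intro weak_star_limit_of_conjugates[OF ICC p closed I.a_Hcarr[OF U]])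
    from scale[OF this, of "1 / U (delta \<one>) \<one>"] have "\<one>\<^bsub>CV p G\<^esub> \<in> I"
      using U1 by (simp add: mult.assoc[symmetric])
    then show ?thesis by (rule I.one_imp_carrier)
  qed
  then show "I = {\<zero>\<^bsub>CV p G\<^esub>} \<or> I = carrier (CV p G)" by blast
qed

section \<open>Ideals from zero divisors\<close>

definition class_function :: "('a \<Rightarrow> complex) \<Rightarrow> bool" where
  "class_function b \<longleftrightarrow> (\<forall>x\<in>carrier G. \<forall>s\<in>carrier G. b (conjugate G x s) = b s)"

lemma conv_class_function:
  assumes "class_function b"
  shows "conv G b f = conv G f b"
proof
  fix s
  show "conv G b f s = conv G f b s"
  proof (cases "s \<in> carrier G")
    case s: True
    have "conv G b f s = (\<Sum>\<^sub>\<infinity>r\<in>carrier G. b (s \<otimes> inv r) * f r)"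
      by (rule conv_altdef[OF s])
    also have "\<dots> = (\<Sum>\<^sub>\<infinity>r\<in>carrier G. f r * b (inv r \<otimes> s))"
    proof (rule infsum_cong)
      fix r assume r: "r \<in> carrier G"
      have "b (s \<otimes> inv r) = b (conjugate G (inv r) (s \<otimes> inv r))"
        using assms r s by (simp add: class_function_def)
      also have "conjugate G (inv r) (s \<otimes> inv r) = inv r \<otimes> s"
        using r s by (simp add: conjugate_def m_assoc)
      finally show "b (s \<otimes> inv r) * f r = f r * b (inv r \<otimes> s)" by simp
    qed
    finally show ?thesis using s by (simp add: conv_def)
  qed (simp add: conv_off)
qed

text \<open>
  The operators in \<open>CV\<^sub>p(G)\<close> are left convolutions, and convolution by a class function from the left is
  convolution from the right.  Both composites commute with right translations, so it suffices to compare
  their symbols, where no convergence problem arises.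
\<close>

lemma conv_op_class_function_commute:
  assumes b: "b \<in> lp_space 1 (carrier G)" "class_function b"
    and T: "T \<in> carrier (CV p G)" and p: "1 \<le> p"
  shows "conv_op p G b \<circ> T = T \<circ> conv_op p G b"
proof (rule CV_eqI)
  have B: "conv_op p G b \<in> carrier (CV p G)" by (rule conv_op_in_CV[OF b(1) p])
  show "conv_op p G b \<circ> T \<in> carrier (CV p G)" "T \<circ> conv_op p G b \<in> carrier (CV p G)"
    by (intro CV_compose B T)+
  have "(conv_op p G b \<circ> T) (delta \<one>) = conv G b (T (delta \<one>))"
    by (simp add: conv_op_def CV_range_in_lp_space[OF T])
  also have "\<dots> = conv G (T (delta \<one>)) b" by (rule conv_class_function[OF b(2)])
  also have "\<dots> = T b" by (rule CV_eq_conv[OF T l1_subset_lp[OF b(1) p] p, symmetric])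
  finally show "(conv_op p G b \<circ> T) (delta \<one>) = (T \<circ> conv_op p G b) (delta \<one>)"
    by (simp add: conv_op_delta_one b(1))
qed (fact p)

text \<open>
  An \<open>\<ell>\<^sup>1\<close>-function lies in \<open>c\<^sub>0\<close> and in every \<open>\<ell>\<^sup>q\<close>, so pairing it with the symbol is
  weak*-continuous for every \<open>p\<close>.
\<close>

lemma l1_functional:
  assumes \<eta>: "\<eta> \<in> lp_space 1 (carrier G)" and p: "1 \<le> p"
  shows "(\<lambda>T. dual_pair (carrier G) \<eta> (T (delta \<one>))) \<in> CV_functionals p G"
proof (cases "p = 1")
  case True
  have "\<eta> \<in> c0_space (carrier G)"
    using lp_space_off[OF \<eta>] lp_level_finite[OF \<eta>] by (auto simp: c0_space_def intro: finite_subset[rotated])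
  then show ?thesis using True by (auto simp: CV_functionals_def)
next
  case False
  \<comment> \<open>the elementary tensor \<open>\<eta> \<otimes> \<delta>\<^sub>e\<close> as a series\<close>
  define x :: "(nat \<Rightarrow> 'a \<Rightarrow> complex) \<times> (nat \<Rightarrow> 'a \<Rightarrow> complex)"
    where "x = (\<lambda>j. if j = 0 then \<eta> else (\<lambda>s. 0), \<lambda>j. delta \<one>)"
  have "summable (\<lambda>j. lp_norm (p / (p - 1)) (carrier G) (if j = (0::nat) then \<eta> else (\<lambda>s. 0)) *
      lp_norm p (carrier G) (delta \<one>))"
    by (rule summable_finite[of "{0}"]) (auto simp: lp_norm_zero)
  moreover have "\<eta> \<in> lp_space (p / (p - 1)) (carrier G)"
    using False p by (intro l1_subset_lp[OF \<eta>]) auto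
  ultimately have "x \<in> proj_tensor_series (p / (p - 1)) p (carrier G)"
    by (auto simp: x_def proj_tensor_series_def lp_space_zero delta_in_lp_space)
  moreover have "tensor_pair (carrier G) x = (\<lambda>T. dual_pair (carrier G) \<eta> (T (delta \<one>)))"
  proof
    fix T
    have "tensor_pair (carrier G) x T
        = (\<Sum>j\<in>{0}. dual_pair (carrier G) (if j = (0::nat) then \<eta> else (\<lambda>s. 0)) (T (delta \<one>)))"
      unfolding x_def tensor_pair_def prod.case by (rule suminf_finite) (auto simp: dual_pair_def)
    then show "tensor_pair (carrier G) x T = dual_pair (carrier G) \<eta> (T (delta \<one>))" by simp
  qed
  ultimately have "(\<lambda>T. dual_pair (carrier G) \<eta> (T (delta \<one>)))
      \<in> tensor_pair (carrier G) ` proj_tensor_series (p / (p - 1)) p (carrier G)"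
    by (intro image_eqI[of _ _ x]) auto
  then show ?thesis using False by (simp add: CV_functionals_def)
qed

lemma l1_reflect_translate:
  assumes b: "b \<in> lp_space 1 (carrier G)" and s: "s \<in> carrier G"
  shows "(\<lambda>r. if r \<in> carrier G then b (s \<otimes> inv r) else 0) \<in> lp_space 1 (carrier G)"
proof -
  have "((\<lambda>r. cmod (b (s \<otimes> inv r))) has_sum (\<Sum>\<^sub>\<infinity>t\<in>carrier G. cmod (b t))) (carrier G)"
    using has_sum_infsum[OF l1_summable[OF b]] has_sum_div_translate[OF s, of "\<lambda>t. cmod (b t)"] by simp
  then have "(\<lambda>r. cmod (b (s \<otimes> inv r))) summable_on carrier G" by (rule has_sum_imp_summable)
  then have "(\<lambda>r. cmod (if r \<in> carrier G then b (s \<otimes> inv r) else 0)) summable_on carrier G"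
    by (rule summable_on_cong[THEN iffD1, rotated]) simp
  then show ?thesis by (simp add: lp_space_def)
qed

text \<open>
  The annihilator \<open>I\<close> of \<open>b\<close> is an ideal because convolution by \<open>b\<close> is central, and it is weak*-closed because
  each coefficient of \<open>b * f\<close> is a pairing of \<open>f\<close> with an \<open>\<ell>\<^sup>1\<close>-function.  It contains convolution
  by \<open>a\<close>, but not the identity.
\<close>

lemma not_weak_star_simple_if_zero_divisors:
  assumes a: "a \<in> lp_space 1 (carrier G)" "a \<noteq> (\<lambda>s. 0)"
    and b: "b \<in> lp_space 1 (carrier G)" "b \<noteq> (\<lambda>s. 0)" "class_function b"
    and ab: "conv G b a = (\<lambda>s. 0)" and p: "1 \<le> p"
  shows "\<not> weak_star_simple p G"
proof
  assume simple: "weak_star_simple p G"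
  define B where "B = conv_op p G b"
  have B: "B \<in> carrier (CV p G)" unfolding B_def by (rule conv_op_in_CV[OF b(1) p])
  have Bb: "B \<in> bounded_ops p (carrier G)" using B by (simp add: CV_carrier)
  define I where "I = {T \<in> carrier (CV p G). B \<circ> T = (\<lambda>\<xi> s. 0)}"
  have ops: "x \<otimes>\<^bsub>CV p G\<^esub> y = x \<circ> y" "x \<oplus>\<^bsub>CV p G\<^esub> y = (\<lambda>\<xi> s. x \<xi> s + y \<xi> s)"
    "\<zero>\<^bsub>CV p G\<^esub> = (\<lambda>\<xi> s. 0)" for x y by (simp_all add: CV_def)
  interpret R: ring "CV p G" by (rule ring_CV[OF p])
  have I_add: "(\<lambda>\<xi> s. T \<xi> s + U \<xi> s) \<in> I" if T: "T \<in> I" and U: "U \<in> I" for T U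
  proof -
    have C: "T \<in> carrier (CV p G)" "U \<in> carrier (CV p G)" using that by (auto simp: I_def)
    have "B (\<lambda>s. T \<xi> s + U \<xi> s) = (\<lambda>s. 0)" for \<xi>
      using CV_linear[OF B C, of \<xi>] T U by (auto simp: I_def fun_eq_iff)
    then show ?thesis using CV_add[OF C p] by (auto simp: I_def fun_eq_iff)
  qed
  have I_scale: "(\<lambda>\<xi> s. c * T \<xi> s) \<in> I" if T: "T \<in> I" for c T
  proof -
    have C: "T \<in> carrier (CV p G)" using that by (auto simp: I_def)
    have "B (\<lambda>s. c * T \<xi> s) = (\<lambda>s. 0)" for \<xi>
      using bounded_opsD(4)[OF Bb CV_range_in_lp_space[OF C], of c \<xi>] T by (auto simp: I_def fun_eq_iff)
    then show ?thesis using CV_scale[OF C p] by (auto simp: I_def fun_eq_iff)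
  qed
  have ideal: "ideal I (CV p G)"
  proof (rule idealI[OF ring_CV[OF p]])
    show "subgroup I (add_monoid (CV p G))"
    proof (rule R.add.subgroupI)
      show "I \<subseteq> carrier (CV p G)" by (auto simp: I_def)
      show "I \<noteq> {}"
        using CV_zero_closed[OF p] bounded_ops_zero[OF Bb] by (auto simp: I_def ops fun_eq_iff)
      show "\<ominus>\<^bsub>CV p G\<^esub> T \<in> I" if "T \<in> I" for T
      proof -
        have "\<ominus>\<^bsub>CV p G\<^esub> T = (\<lambda>\<xi> s. (-1) * T \<xi> s)"
          using that I_scale[OF that, of "-1"] by (intro R.minus_equality) (auto simp: I_def ops)
        then show ?thesis using I_scale[OF that, of "-1"] by simp
      qed
      show "T \<oplus>\<^bsub>CV p G\<^esub> U \<in> I" if "T \<in> I" "U \<in> I" for T U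
        using I_add[OF that] by (simp add: ops)
    qed
    fix T U assume T: "T \<in> I" and U: "U \<in> carrier (CV p G)"
    have TC: "T \<in> carrier (CV p G)" and BT: "\<And>\<xi>. B (T \<xi>) = (\<lambda>s. 0)"
      using T by (auto simp: I_def fun_eq_iff)
    have Ub: "U \<in> bounded_ops p (carrier G)" using U by (simp add: CV_carrier)
    have comm: "B (U \<xi>) = U (B \<xi>)" for \<xi>
      using conv_op_class_function_commute[OF b(1,3) U p] by (simp add: B_def fun_eq_iff)
    show "U \<otimes>\<^bsub>CV p G\<^esub> T \<in> I"
    proof -
      have "B \<circ> (U \<circ> T) = (\<lambda>\<xi> s. 0)"
        by (rule ext) (simp add: comm BT bounded_ops_zero[OF Ub])
      then show ?thesis using CV_compose[OF U TC] by (simp add: I_def ops)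
    qed
    show "T \<otimes>\<^bsub>CV p G\<^esub> U \<in> I"
      using CV_compose[OF TC U] BT by (auto simp: I_def ops fun_eq_iff)
  qed
  have mem_iff: "T \<in> I \<longleftrightarrow> (\<forall>s\<in>carrier G. conv G b (T (delta \<one>)) s = 0)" if T: "T \<in> carrier (CV p G)" for T
  proof -
    have "B \<circ> T = (\<lambda>\<xi> s. 0) \<longleftrightarrow> (B \<circ> T) (delta \<one>) = (\<lambda>s. 0)"
    proof
      show "B \<circ> T = (\<lambda>\<xi> s. 0) \<Longrightarrow> (B \<circ> T) (delta \<one>) = (\<lambda>s. 0)" by (simp only:)
      show "(B \<circ> T) (delta \<one>) = (\<lambda>s. 0) \<Longrightarrow> B \<circ> T = (\<lambda>\<xi> s. 0)"
        using CV_eqI[OF CV_compose[OF B T] CV_zero_closed[OF p] _ p] by (simp only: ops)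
    qed
    also have "(B \<circ> T) (delta \<one>) = conv G b (T (delta \<one>))"
      by (simp add: B_def conv_op_def CV_range_in_lp_space[OF T])
    finally show ?thesis using T conv_off by (auto simp: I_def fun_eq_iff)
  qed
  define \<eta> where "\<eta> s = (\<lambda>r. if r \<in> carrier G then b (s \<otimes> inv r) else 0)" for s
  define \<Psi> where "\<Psi> = (\<lambda>s T. dual_pair (carrier G) (\<eta> s) (T (delta \<one>))) ` carrier G"
  have coeff: "dual_pair (carrier G) (\<eta> s) f = conv G b f s" if "s \<in> carrier G" for s f
    unfolding conv_altdef[OF that] dual_pair_def by (rule infsum_cong) (simp add: \<eta>_def)
  have "\<Psi> \<subseteq> CV_functionals p G"
    unfolding \<Psi>_def using l1_functional[OF l1_reflect_translate[OF b(1)] p] by (auto simp: \<eta>_def)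
  then have "closedin (CV_weak_star p G) {T \<in> carrier (CV p G). \<forall>\<phi>\<in>\<Psi>. \<phi> T = 0}"
    by (rule closedin_CV_weak_star_kernel)
  also have "{T \<in> carrier (CV p G). \<forall>\<phi>\<in>\<Psi>. \<phi> T = 0} = I"
    using mem_iff by (auto simp: \<Psi>_def coeff I_def)
  finally have closed: "closedin (CV_weak_star p G) I" .
  have "conv_op p G a \<in> I"
    using mem_iff[OF conv_op_in_CV[OF a(1) p]] ab by (simp add: conv_op_delta_one a(1))
  moreover have "conv_op p G a \<noteq> \<zero>\<^bsub>CV p G\<^esub>"
    using conv_op_delta_one[OF a(1), of p] a(2) by (auto simp: ops)
  moreover have "\<one>\<^bsub>CV p G\<^esub> \<notin> I"
  proof
    assume "\<one>\<^bsub>CV p G\<^esub> \<in> I"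
    then have "conv G b (delta \<one>) s = 0" if "s \<in> carrier G" for s
      using mem_iff[OF CV_one_closed[OF p]] that
      by (simp add: CV_one conv_op_delta_one delta_in_lp_space)
    then have "b s = 0" for s
      using conv_unit_right[of b] lp_space_off[OF b(1)] by metis
    then show False using b(2) by blast
  qed
  ultimately show False
    using simple ideal closed I_scale CV_one_closed[OF p]
    unfolding weak_star_simple_def CV_ideal_def by blast
qed

end


section \<open>Finite conjugacy classes\<close>

lemma (in group) conjugate_pow:
  "x \<in> carrier G \<Longrightarrow> g \<in> carrier G \<Longrightarrow> conjugate G x (g [^] n) = conjugate G x g [^] (n::nat)"
  by (induction n) (simp_all add: conjugate_prod)

lemma (in group) commute_if_conjugate_fixed:
  assumes "x \<in> carrier G" "g \<in> carrier G" "conjugate G x g = g"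
  shows "x \<otimes> g = g \<otimes> x"
proof -
  have "x \<otimes> g = conjugate G x g \<otimes> x" using assms(1,2) by (simp add: conjugate_def)
  then show ?thesis by (simp add: assms(3))
qed

locale finite_invariant_subset = group G for G (structure) +
  fixes C :: "'a set"
  assumes finite_C: "finite C" and C_carrier: "C \<subseteq> carrier G"
    and C_invariant: "\<And>x c. x \<in> carrier G \<Longrightarrow> c \<in> C \<Longrightarrow> conjugate G x c \<in> C"
begin

lemma C_in_carrier [simp]: "c \<in> C \<Longrightarrow> c \<in> carrier G"
  using C_carrier by blast

definition word :: "'a list \<Rightarrow> 'a" where
  "word ws = foldr (\<otimes>) ws \<one>"

lemma word_simps [simp]: "word [] = \<one>" "word (w # ws) = w \<otimes> word ws"
  by (simp_all add: word_def)

lemma word_closed [simp]: "set ws \<subseteq> C \<Longrightarrow> word ws \<in> carrier G"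
  by (induction ws) auto

lemma word_append: "set us \<subseteq> C \<Longrightarrow> set vs \<subseteq> C \<Longrightarrow> word (us @ vs) = word us \<otimes> word vs"
  by (induction us) (auto simp: m_assoc)

lemma word_conjugate:
  "x \<in> carrier G \<Longrightarrow> set ws \<subseteq> C \<Longrightarrow> word (map (conjugate G x) ws) = conjugate G x (word ws)"
  by (induction ws) (auto simp: conjugate_prod)

text \<open>
  Occurrences of a letter \<open>c\<close> can be moved to the front, at the price of conjugating the letters that
  they pass, which stay in \<open>C\<close>.
\<close>

lemma word_extract:
  assumes "c \<in> C" "set ws \<subseteq> C" "k \<le> count_list ws c"
  shows "\<exists>vs. set vs \<subseteq> C \<and> length vs + k = length ws \<and> word ws = c [^] k \<otimes> word vs"
  using assms(2,3)
proof (induction ws arbitrary: k)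
  case Nil
  then show ?case by (intro exI[of _ "[]"]) auto
next
  case (Cons w ws)
  have c: "c \<in> carrier G" and w: "w \<in> carrier G" "w \<in> C" using assms(1) Cons.prems by auto
  show ?case
  proof (cases "k = 0")
    case True
    then show ?thesis using Cons.prems w by (intro exI[of _ "w # ws"]) auto
  next
    case False
    show ?thesis
    proof (cases "w = c")
      case True
      have "k - 1 \<le> count_list ws c" using Cons.prems(2) True by (simp add: le_diff_conv)
      then obtain vs where vs: "set vs \<subseteq> C" "length vs + (k - 1) = length ws"
          "word ws = c [^] (k - 1) \<otimes> word vs"
        using Cons.IH[of "k - 1"] Cons.prems by auto
      have "c \<otimes> c [^] (k - 1) = c [^] k"
        using nat_pow_Suc2[OF c, of "k - 1"] False by simp
      then have "word (w # ws) = c [^] k \<otimes> word vs"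
        using vs True c by (simp add: m_assoc[symmetric])
      then show ?thesis using vs False by (intro exI[of _ vs]) auto
    next
      case neq: False
      then obtain vs where vs: "set vs \<subseteq> C" "length vs + k = length ws"
          "word ws = c [^] k \<otimes> word vs"
        using Cons.IH[of k] Cons.prems by auto
      let ?w = "conjugate G (inv (c [^] k)) w"
      have "c [^] k \<otimes> ?w = w \<otimes> c [^] k"
        using c w by (simp add: conjugate_def m_assoc)
      moreover have "?w \<in> C" using c w by (intro C_invariant) auto
      moreover have "word (?w # vs) = ?w \<otimes> word vs" by simp
      ultimately have "word (w # ws) = c [^] k \<otimes> word (?w # vs)"
        using vs c w by (simp add: m_assoc[symmetric])
      then show ?thesis using vs \<open>?w \<in> C\<close> by (intro exI[of _ "?w # vs"]) auto
    qed
  qed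
qed

text \<open>Dietzmann's lemma: long words contain some letter \<open>n\<close> times, hence can be shortened.\<close>

lemma finite_words:
  assumes n: "0 < n" and tors: "\<And>c. c \<in> C \<Longrightarrow> c [^] (n::nat) = \<one>"
  shows "finite (word ` {ws. set ws \<subseteq> C})"
proof -
  let ?L = "card C * n"
  have short: "\<exists>vs. set vs \<subseteq> C \<and> length vs \<le> ?L \<and> word vs = word ws" if "set ws \<subseteq> C" for ws
    using that
  proof (induction "length ws" arbitrary: ws rule: less_induct)
    case less
    show ?case
    proof (cases "length ws \<le> ?L")
      case True
      then show ?thesis using less.prems by blast
    next
      case False
      have "\<exists>c\<in>C. n \<le> count_list ws c"
      proof (rule ccontr)
        assume "\<not> ?thesis"
        then have "sum (count_list ws) C \<le> (\<Sum>c\<in>C. n)" by (intro sum_mono) force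
        then show False using False sum_count_set[OF less.prems finite_C] by simp
      qed
      then obtain c where c: "c \<in> C" "n \<le> count_list ws c" by blast
      obtain vs where vs: "set vs \<subseteq> C" "length vs + n = length ws" "word ws = c [^] n \<otimes> word vs"
        using word_extract[OF c(1) less.prems c(2)] by blast
      have "word ws = word vs" using vs tors[OF c(1)] by simp
      then show ?thesis using less.hyps[of vs] vs n by auto
    qed
  qed
  have "word ` {ws. set ws \<subseteq> C} \<subseteq> word ` {ws. set ws \<subseteq> C \<and> length ws \<le> ?L}"
  proof
    fix g assume "g \<in> word ` {ws. set ws \<subseteq> C}"
    then obtain ws where "set ws \<subseteq> C" "g = word ws" by blast
    then obtain vs where "set vs \<subseteq> C" "length vs \<le> ?L" "g = word vs"
      using short[of ws] by metis
    then show "g \<in> word ` {ws. set ws \<subseteq> C \<and> length ws \<le> ?L}" by blast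
  qed
  then show ?thesis
    using finite_lists_length_le[OF finite_C, of ?L] finite_subset by blast
qed

text \<open>
  Two of the conjugates of \<open>d\<close> by the powers \<open>c\<^sup>i\<close> with \<open>i \<le> |C|\<close> coincide, so some positive power of \<open>c\<close>
  with exponent at most \<open>|C|\<close> commutes with \<open>d\<close>.  The factorial is a common multiple of these exponents.
\<close>

lemma power_commute:
  assumes "c \<in> C" "d \<in> C"
  shows "conjugate G (c [^] (fact (card C) :: nat)) d = d"
proof -
  have c: "c \<in> carrier G" and d: "d \<in> carrier G" using assms by auto
  have "\<not> inj_on (\<lambda>i. conjugate G (c [^] i) d) {..card C}"
  proof
    assume "inj_on (\<lambda>i. conjugate G (c [^] i) d) {..card C}"
    moreover have "(\<lambda>i. conjugate G (c [^] i) d) ` {..card C} \<subseteq> C"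
      using assms c by (auto intro: C_invariant)
    ultimately have "card {..card C} \<le> card C" by (rule card_inj_on_le) (rule finite_C)
    then show False by simp
  qed
  then obtain i j where ij: "i < j" "j \<le> card C" "conjugate G (c [^] i) d = conjugate G (c [^] j) d"
    unfolding inj_on_def by (metis atMost_iff nat_neq_iff)
  define k where "k = j - i"
  have "c [^] j = c [^] i \<otimes> c [^] k"
    using ij(1) c by (simp add: k_def nat_pow_mult)
  then have "conjugate G (c [^] i) d = conjugate G (c [^] i) (conjugate G (c [^] k) d)"
    using ij(3) c d by (simp add: conjugate_mult)
  then have "conjugate G (inv (c [^] i)) (conjugate G (c [^] i) d)
      = conjugate G (inv (c [^] i)) (conjugate G (c [^] i) (conjugate G (c [^] k) d))"
    by simp
  then have fixk: "conjugate G (c [^] k) d = d"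
    using c d by simp
  have "k dvd (fact (card C) :: nat)"
    using ij by (intro dvd_fact) (auto simp: k_def)
  then obtain q where q: "(fact (card C) :: nat) = k * q" by (rule dvdE)
  have "conjugate G ((c [^] k) [^] q) d = d"
    by (induction q) (use c d fixk in \<open>simp_all add: conjugate_mult\<close>)
  then show ?thesis using c by (simp add: q nat_pow_pow)
qed

end

section \<open>A finite normal subgroup gives zero divisors\<close>

text \<open>
  The uniform distribution \<open>a\<close> on \<open>N\<close> is a central idempotent, and it is annihilated by the complementary
  idempotent \<open>\<delta>\<^sub>e - a\<close>.
\<close>

lemma (in group) not_weak_star_simple_if_finite_normal:
  assumes N: "finite N" "N \<subseteq> carrier G" "\<one> \<in> N" "x \<in> N" "x \<noteq> \<one>"
    and mult: "\<And>g h. g \<in> N \<Longrightarrow> h \<in> N \<Longrightarrow> g \<otimes> h \<in> N"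
    and inv: "\<And>y g. y \<in> carrier G \<Longrightarrow> g \<in> N \<Longrightarrow> conjugate G y g \<in> N"
    and p: "1 \<le> p"
  shows "\<not> weak_star_simple p G"
proof -
  define a :: "'a \<Rightarrow> complex" where "a = (\<lambda>s. if s \<in> N then 1 / of_nat (card N) else 0)"
  define b where "b = (\<lambda>s. delta \<one> s + (-1) * a s)"
  have card: "2 \<le> card N"
  proof -
    have "card {\<one>, x} \<le> card N" using N by (intro card_mono) auto
    then show ?thesis using N(5) by simp
  qed
  have a: "a \<in> lp_space 1 (carrier G)"
    by (rule lp_space_finite_support[of N]) (use N in \<open>auto simp: a_def\<close>)
  have b: "b \<in> lp_space 1 (carrier G)"
    by (rule lp_space_finite_support[of N]) (use N in \<open>auto simp: a_def b_def delta_def\<close>)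
  have shift: "inv t \<otimes> s \<in> N \<longleftrightarrow> s \<in> N" if t: "t \<in> N" and s: "s \<in> carrier G" for t s
  proof
    have tG: "t \<in> carrier G" using t N by auto
    show "s \<in> N" if "inv t \<otimes> s \<in> N" using mult[OF t that] tG s by simp
    have "(\<lambda>n. t \<otimes> n) ` N = N"
    proof (rule endo_inj_surj[OF N(1)])
      show "inj_on (\<lambda>n. t \<otimes> n) N" using tG N(2) by (auto simp: inj_on_def subset_iff)
    qed (use mult t in auto)
    moreover assume "s \<in> N"
    ultimately obtain n where "n \<in> N" "s = t \<otimes> n" by blast
    then show "inv t \<otimes> s \<in> N" using tG N(2) by auto
  qed
  have aa: "conv G a a = a"
  proof
    fix s
    show "conv G a a s = a s"
    proof (cases "s \<in> carrier G")
      case True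
      have "conv G a a s = (\<Sum>t\<in>N. a t * a (inv t \<otimes> s))"
        using N True by (intro conv_finite_left) (auto simp: a_def)
      also have "\<dots> = (\<Sum>t\<in>N. 1 / of_nat (card N) * a s)"
        by (rule sum.cong) (use shift True in \<open>auto simp: a_def\<close>)
      also have "\<dots> = a s" using card by simp
      finally show ?thesis .
    next
      case False
      then show ?thesis using lp_space_off[OF a] by (simp add: conv_off)
    qed
  qed
  show ?thesis
  proof (rule not_weak_star_simple_if_zero_divisors[OF a _ b _ _ _ p])
    have "a \<one> \<noteq> 0" using N card by (auto simp: a_def)
    then show "a \<noteq> (\<lambda>s. 0)" by metis
    have "b x \<noteq> 0" using N card by (auto simp: a_def b_def delta_def)
    then show "b \<noteq> (\<lambda>s. 0)" by metis
    have "conjugate G y s \<in> N \<longleftrightarrow> s \<in> N" if "y \<in> carrier G" "s \<in> carrier G" for y s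
      using inv[of y s] inv[of "inv y" "conjugate G y s"] that by auto
    moreover have "conjugate G y s = \<one> \<longleftrightarrow> s = \<one>" if "y \<in> carrier G" "s \<in> carrier G" for y s
      using conjugate_inv(1)[OF that] that by (metis conjugate_unit inv_closed)
    ultimately show "class_function b"
      by (simp add: class_function_def b_def a_def delta_def)
    show "conv G b a = (\<lambda>s. 0)"
      unfolding b_def
      using conv_lin_left[OF delta_in_lp_space[OF one_closed] a norm_le_lp_norm[OF a order_refl], of "-1"]
        conv_unit_left[of a] lp_space_off[OF a] aa by simp
  qed
qed

section \<open>The binomial series of the square root\<close>

text \<open>
  The coefficients of the power series of \<open>(1 - z)\<^sup>1\<^sup>/\<^sup>2\<close>.
\<close>

definition sqrt_coeff :: "nat \<Rightarrow> real" where
  "sqrt_coeff n = (-1) ^ n * ((1/2) gchoose n)"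

lemma sqrt_coeff_0: "sqrt_coeff 0 = 1"
  by (simp add: sqrt_coeff_def)

lemma sqrt_coeff_Suc: "sqrt_coeff (Suc n) * (2 * real n + 2) = sqrt_coeff n * (2 * real n - 1)"
proof -
  have "(1/2 gchoose Suc n) * (real n + 1) = ((1/2::real) gchoose n) * (1/2 - real n)"
    using gbinomial_absorption'[of "Suc n" "1/2::real"] gbinomial_mult_1[of "1/2::real" n]
    by (simp add: algebra_simps)
  note rec = this
  have "sqrt_coeff (Suc n) * (2 * real n + 2) = - 2 * (-1) ^ n * ((1/2 gchoose Suc n) * (real n + 1))"
    by (simp add: sqrt_coeff_def algebra_simps)
  also have "\<dots> = sqrt_coeff n * (2 * real n - 1)"
    unfolding rec by (simp add: sqrt_coeff_def algebra_simps)
  finally show ?thesis .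
qed

lemma sqrt_coeff_1: "sqrt_coeff 1 = -1/2"
  using sqrt_coeff_Suc[of 0] by (simp add: sqrt_coeff_0)

lemma sqrt_coeff_nonpos: "sqrt_coeff (Suc n) \<le> 0"
proof (induction n)
  case 0
  then show ?case using sqrt_coeff_1 by simp
next
  case (Suc n)
  have "sqrt_coeff (Suc (Suc n)) = sqrt_coeff (Suc n) * ((2 * real (Suc n) - 1) / (2 * real (Suc n) + 2))"
    using sqrt_coeff_Suc[of "Suc n"] by (simp add: field_simps)
  also have "\<dots> \<le> 0" using Suc by (intro mult_nonpos_nonneg) auto
  finally show ?case .
qed

text \<open>
  All coefficients but the first are non-positive, so this formula shows that the partial sums of the series at
  \<open>z = 1\<close> stay non-negative.  Hence the coefficients are absolutely summable.
\<close>

lemma sqrt_coeff_partial_sum: "(\<Sum>i\<le>n. sqrt_coeff i) = - sqrt_coeff (Suc n) * (2 * real n + 2)"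
proof (induction n)
  case 0
  then show ?case using sqrt_coeff_1 by (simp add: sqrt_coeff_0)
next
  case (Suc n)
  then show ?case using sqrt_coeff_Suc[of "Suc n"] by (simp add: algebra_simps)
qed

lemma sqrt_coeff_finite_sum_le:
  assumes "finite F" "F \<subseteq> - {0, 1}"
  shows "(\<Sum>i\<in>F. \<bar>sqrt_coeff i\<bar>) \<le> 1/2"
proof -
  obtain n where n: "F \<subseteq> {..n}" using assms(1) finite_nat_iff_bounded_le by blast
  define m where "m = Suc n"
  have "0 \<le> (\<Sum>i\<le>m. sqrt_coeff i)"
    unfolding sqrt_coeff_partial_sum using sqrt_coeff_nonpos[of m] by (simp add: mult_nonpos_nonneg)
  also have "{..m} = insert 0 (insert 1 ({..m} - {0, 1}))" by (auto simp: m_def)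
  also have "(\<Sum>i\<in>\<dots>. sqrt_coeff i) = 1/2 + (\<Sum>i\<in>{..m} - {0, 1}. sqrt_coeff i)"
    by (subst sum.insert; simp?)+ (simp add: sqrt_coeff_0 sqrt_coeff_1[unfolded One_nat_def])
  also have "(\<Sum>i\<in>{..m} - {0, 1}. sqrt_coeff i) = - (\<Sum>i\<in>{..m} - {0, 1}. \<bar>sqrt_coeff i\<bar>)"
  proof -
    have "sqrt_coeff i = - \<bar>sqrt_coeff i\<bar>" if "i \<in> {..m} - {0, 1}" for i
      using sqrt_coeff_nonpos[of "i - 1"] that by simp
    then show ?thesis by (simp add: sum_negf[symmetric])
  qed
  finally have "(\<Sum>i\<in>{..m} - {0, 1}. \<bar>sqrt_coeff i\<bar>) \<le> 1/2" by simp
  moreover have "(\<Sum>i\<in>F. \<bar>sqrt_coeff i\<bar>) \<le> (\<Sum>i\<in>{..m} - {0, 1}. \<bar>sqrt_coeff i\<bar>)"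
    using n assms by (intro sum_mono2) (auto simp: m_def)
  ultimately show ?thesis by simp
qed

lemma sqrt_coeff_summable: "(\<lambda>n. \<bar>sqrt_coeff n\<bar>) summable_on UNIV"
  and sqrt_coeff_tail: "(\<lambda>n. \<bar>sqrt_coeff n\<bar>) summable_on - {0, 1}" "(\<Sum>\<^sub>\<infinity>n\<in>- {0, 1}. \<bar>sqrt_coeff n\<bar>) \<le> 1/2"
proof -
  show tail: "(\<lambda>n. \<bar>sqrt_coeff n\<bar>) summable_on - {0, 1}"
    by (rule nonneg_bdd_above_summable_on) (auto intro!: bdd_aboveI2[of _ _ "1/2"] sqrt_coeff_finite_sum_le)
  show "(\<Sum>\<^sub>\<infinity>n\<in>- {0, 1}. \<bar>sqrt_coeff n\<bar>) \<le> 1/2"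
    by (rule infsum_le_finite_sums[OF tail]) (rule sqrt_coeff_finite_sum_le)
  have "(\<lambda>n. \<bar>sqrt_coeff n\<bar>) summable_on {0, 1} \<union> - {0, 1}"
    by (rule summable_on_Un_disjoint) (use tail in auto)
  then show "(\<lambda>n. \<bar>sqrt_coeff n\<bar>) summable_on UNIV" by simp
qed

text \<open>The Cauchy product of the series with itself is \<open>1 - z\<close>, by Vandermonde's identity.\<close>

lemma sqrt_coeff_cauchy:
  "(\<Sum>i\<le>k. sqrt_coeff i * sqrt_coeff (k - i)) = (if k = 0 then 1 else if k = 1 then -1 else 0)"
proof -
  have "(\<Sum>i\<le>k. sqrt_coeff i * sqrt_coeff (k - i))
      = (\<Sum>i\<le>k. (-1) ^ k * (((1/2) gchoose i) * ((1/2) gchoose (k - i))))"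
  proof (rule sum.cong)
    fix i assume "i \<in> {..k}"
    then have "(-1::real) ^ i * (-1) ^ (k - i) = (-1) ^ k" by (simp flip: power_add)
    then show "sqrt_coeff i * sqrt_coeff (k - i) = (-1) ^ k * (((1/2) gchoose i) * ((1/2) gchoose (k - i)))"
      unfolding sqrt_coeff_def by (simp add: mult_ac)
  qed simp
  also have "\<dots> = (-1) ^ k * ((1/2 + 1/2) gchoose k)"
    using gbinomial_Vandermonde[of "1/2::real" "1/2" k] by (simp add: sum_distrib_left[symmetric] atMost_atLeast0)
  also have "((1/2 + 1/2 :: real) gchoose k) = of_nat (1 choose k)"
    using binomial_gbinomial[of 1 k, where ?'a = real] by simp
  also have "(-1) ^ k * real (1 choose k) = (if k = 0 then 1 else if k = 1 then -1 else 0)"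
    by (cases "k \<le> 1") (auto simp: le_Suc_eq binomial_eq_0)
  finally show ?thesis .
qed


section \<open>Square roots in the group algebra\<close>

context group
begin

abbreviation l1 :: "('a \<Rightarrow> complex) set" where
  "l1 \<equiv> lp_space 1 (carrier G)"

lemma l1_le_norm: "f \<in> l1 \<Longrightarrow> cmod (f s) \<le> lp_norm 1 (carrier G) f"
  by (rule norm_le_lp_norm) auto

lemma l1_conv: "f \<in> l1 \<Longrightarrow> g \<in> l1 \<Longrightarrow> conv G f g \<in> l1"
  by (rule conv_young(1)) auto

lemma l1_lin: "f \<in> l1 \<Longrightarrow> g \<in> l1 \<Longrightarrow> (\<lambda>s. f s + c * g s) \<in> l1"
  by (intro lp_space_add lp_space_scale) auto

lemma l1_delta: "x \<in> carrier G \<Longrightarrow> delta x \<in> l1"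
  by (rule delta_in_lp_space)

lemma l1_assoc: "f \<in> l1 \<Longrightarrow> g \<in> l1 \<Longrightarrow> h \<in> l1 \<Longrightarrow> conv G (conv G f g) h = conv G f (conv G g h)"
  by (rule conv_assoc) (auto intro: l1_le_norm)

lemma l1_conv_lin_left:
  "f \<in> l1 \<Longrightarrow> g \<in> l1 \<Longrightarrow> h \<in> l1 \<Longrightarrow>
     conv G (\<lambda>s. f s + c * g s) h = (\<lambda>s. conv G f h s + c * conv G g h s)"
  by (rule conv_lin_left) (auto intro: l1_le_norm)

lemma l1_conv_lin_right:
  "f \<in> l1 \<Longrightarrow> g \<in> l1 \<Longrightarrow> h \<in> l1 \<Longrightarrow>
     conv G f (\<lambda>s. g s + c * h s) = (\<lambda>s. conv G f g s + c * conv G f h s)"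
  by (rule conv_lin_right) (auto intro: l1_le_norm)

lemma l1_unit: "f \<in> l1 \<Longrightarrow> conv G (delta \<one>) f = f" "f \<in> l1 \<Longrightarrow> conv G f (delta \<one>) = f"
  by (simp_all add: conv_unit_left conv_unit_right lp_space_off[where S = "carrier G"])

lemma conv_scale_left: "conv G (\<lambda>s. c * f s) h = (\<lambda>s. c * conv G f h s)"
  by (simp add: conv_def fun_eq_iff mult.assoc infsum_cmult_right')

lemma conv_scale_right: "conv G f (\<lambda>s. c * h s) = (\<lambda>s. c * conv G f h s)"
  by (simp add: conv_def fun_eq_iff mult.left_commute infsum_cmult_right')

lemma conv_zero_left: "conv G (\<lambda>s. 0) h = (\<lambda>s. 0)"
  by (simp add: conv_def fun_eq_iff)

lemma conv_zero_right: "conv G h (\<lambda>s. 0) = (\<lambda>s. 0)"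
  by (simp add: conv_def fun_eq_iff)

lemma conv_delta_delta:
  assumes "x \<in> carrier G" "y \<in> carrier G"
  shows "conv G (delta x) (delta y) = delta (x \<otimes> y)"
proof
  fix s
  show "conv G (delta x) (delta y) s = delta (x \<otimes> y) s"
  proof (cases "s \<in> carrier G")
    case True
    then have "inv x \<otimes> s = y \<longleftrightarrow> s = x \<otimes> y" using assms by auto
    then show ?thesis using True assms by (simp add: conv_delta_left) (simp add: delta_def)
  next
    case False
    then show ?thesis using assms by (auto simp: conv_off delta_def)
  qed
qed

section \<open>Commuting elements\<close>

definition commutes :: "('a \<Rightarrow> complex) \<Rightarrow> ('a \<Rightarrow> complex) \<Rightarrow> bool" where
  "commutes f g \<longleftrightarrow> f \<in> l1 \<and> g \<in> l1 \<and> conv G f g = conv G g f"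

lemma commutes_sym: "commutes f g \<Longrightarrow> commutes g f"
  by (simp add: commutes_def)

lemma commutes_lin: "commutes f h \<Longrightarrow> commutes g h \<Longrightarrow> commutes (\<lambda>s. f s + c * g s) h"
  by (simp add: commutes_def l1_lin l1_conv_lin_left l1_conv_lin_right)

lemma commutes_scale: "commutes f h \<Longrightarrow> commutes (\<lambda>s. c * f s) h"
  by (simp add: commutes_def lp_space_scale conv_scale_left conv_scale_right)

lemma commutes_conv:
  assumes "commutes f h" "commutes g h"
  shows "commutes (conv G f g) h"
proof -
  have m: "f \<in> l1" "g \<in> l1" "h \<in> l1" and e: "conv G f h = conv G h f" "conv G g h = conv G h g"
    using assms by (auto simp: commutes_def)
  have "conv G (conv G f g) h = conv G f (conv G g h)" by (rule l1_assoc) fact+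
  also have "\<dots> = conv G (conv G f h) g" by (simp only: e(2) l1_assoc m)
  also have "\<dots> = conv G h (conv G f g)" by (simp only: e(1) l1_assoc m)
  finally show ?thesis using m by (simp add: commutes_def l1_conv)
qed

lemma commutes_unit: "h \<in> l1 \<Longrightarrow> commutes (delta \<one>) h"
  by (simp add: commutes_def l1_delta l1_unit)

lemma commutes_delta:
  "x \<in> carrier G \<Longrightarrow> y \<in> carrier G \<Longrightarrow> x \<otimes> y = y \<otimes> x \<Longrightarrow> commutes (delta x) (delta y)"
  by (simp add: commutes_def l1_delta conv_delta_delta)

section \<open>The augmentation\<close>

text \<open>
  The trivial character of the group algebra.  It detects that a product is non-zero.
\<close>

definition aug :: "('a \<Rightarrow> complex) \<Rightarrow> complex" where
  "aug f = infsum f (carrier G)"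

lemma l1_summable_on: "f \<in> l1 \<Longrightarrow> f summable_on carrier G"
  by (rule abs_summable_summable) (rule l1_summable)

lemma aug_lin: "f \<in> l1 \<Longrightarrow> g \<in> l1 \<Longrightarrow> aug (\<lambda>s. f s + c * g s) = aug f + c * aug g"
  unfolding aug_def
  by (subst infsum_add) (auto intro: l1_summable_on summable_on_cmult_right simp: infsum_cmult_right')

lemma aug_scale: "aug (\<lambda>s. c * f s) = c * aug f"
  by (simp add: aug_def infsum_cmult_right')

lemma aug_delta: "x \<in> carrier G \<Longrightarrow> aug (delta x) = 1"
proof -
  assume x: "x \<in> carrier G"
  have "(delta x has_sum 1) (carrier G)"
    by (rule has_sum_finite_neutralI[of "{x}"]) (use x in \<open>auto simp: delta_def\<close>)
  then show ?thesis by (simp add: aug_def infsumI)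
qed

lemma aug_eq_conv: "s \<in> carrier G \<Longrightarrow> aug f = conv G f (\<lambda>r. if r \<in> carrier G then 1 else 0) s"
  unfolding aug_def conv_def by (simp cong: infsum_cong)

lemma aug_conv:
  assumes "f \<in> l1" "g \<in> l1"
  shows "aug (conv G f g) = aug f * aug g"
proof -
  let ?e = "\<lambda>r. if r \<in> carrier G then 1 else 0 :: complex"
  have "conv G g ?e = (\<lambda>s. aug g * ?e s)"
    using aug_eq_conv[of _ g] by (auto simp: conv_off)
  moreover have "conv G (conv G f g) ?e = conv G f (conv G g ?e)"
    by (rule conv_assoc[where M = 1]) (use assms in auto)
  ultimately have "conv G (conv G f g) ?e \<one> = aug g * conv G f ?e \<one>"
    by (simp only: conv_scale_right)
  then show ?thesis using aug_eq_conv[OF one_closed] by simp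
qed

section \<open>The binomial series\<close>

definition conv_power :: "('a \<Rightarrow> complex) \<Rightarrow> nat \<Rightarrow> 'a \<Rightarrow> complex" where
  "conv_power w n = (conv G w ^^ n) (delta \<one>)"

lemma conv_power_0: "conv_power w 0 = delta \<one>"
  and conv_power_Suc: "conv_power w (Suc n) = conv G w (conv_power w n)"
  by (simp_all add: conv_power_def)

text \<open>
  The binomial series for a square root of \<open>\<delta>\<^sub>e - w\<close>.
\<close>

definition conv_sqrt :: "('a \<Rightarrow> complex) \<Rightarrow> 'a \<Rightarrow> complex" where
  "conv_sqrt w = (\<lambda>s. \<Sum>\<^sub>\<infinity>n. of_real (sqrt_coeff n) * conv_power w n s)"

lemma commutes_conv_power: "commutes w h \<Longrightarrow> commutes (conv_power w n) h"
  by (induction n) (auto simp: conv_power_0 conv_power_Suc commutes_def[of w] intro: commutes_unit commutes_conv)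

end

text \<open>
  Powers of \<open>w\<close> have norm at most \<open>1\<close>, so absolute summability of the coefficients makes all sums over powers
  absolutely convergent and interchangeable with convolution.
\<close>

locale l1_contraction = group G for G (structure) +
  fixes w :: "'a \<Rightarrow> complex"
  assumes w: "w \<in> lp_space 1 (carrier G)" and w_norm: "lp_norm 1 (carrier G) w \<le> 1"
begin

lemma conv_power_l1: "conv_power w n \<in> l1"
  by (induction n) (simp_all add: conv_power_0 conv_power_Suc l1_delta l1_conv w)

lemma conv_power_norm: "lp_norm 1 (carrier G) (conv_power w n) \<le> 1"
proof (induction n)
  case 0
  then show ?case by (simp add: conv_power_0 lp_norm_delta)
next
  case (Suc n)
  have "lp_norm 1 (carrier G) (conv_power w (Suc n))
      \<le> lp_norm 1 (carrier G) w * lp_norm 1 (carrier G) (conv_power w n)"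
    unfolding conv_power_Suc by (rule conv_young(2)[OF w conv_power_l1]) simp
  also have "\<dots> \<le> 1 * 1" using w_norm Suc by (intro mult_mono) (auto simp: lp_norm_nonneg)
  finally show ?case by simp
qed

lemma conv_power_le_1: "cmod (conv_power w n s) \<le> 1"
  using l1_le_norm[OF conv_power_l1] conv_power_norm by (rule order_trans)

lemma conv_power_add: "conv G (conv_power w m) (conv_power w n) = conv_power w (m + n)"
  by (induction m) (simp_all add: conv_power_0 conv_power_Suc l1_unit conv_power_l1 l1_assoc w)

lemma series_summable:
  "(\<lambda>(n, t). cmod (of_real (sqrt_coeff n) * conv_power w n t)) summable_on UNIV \<times> carrier G"
proof (rule summable_on_SigmaI)
  fix n
  have "((\<lambda>t. cmod (conv_power w n t)) has_sum lp_norm 1 (carrier G) (conv_power w n)) (carrier G)"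
    unfolding l1_norm by (rule has_sum_infsum[OF l1_summable[OF conv_power_l1]])
  then have "((\<lambda>t. \<bar>sqrt_coeff n\<bar> * cmod (conv_power w n t)) has_sum
      \<bar>sqrt_coeff n\<bar> * lp_norm 1 (carrier G) (conv_power w n)) (carrier G)"
    by (rule has_sum_cmult_right)
  then show "((\<lambda>t. case (n, t) of (n, t) \<Rightarrow> cmod (of_real (sqrt_coeff n) * conv_power w n t)) has_sum
      \<bar>sqrt_coeff n\<bar> * lp_norm 1 (carrier G) (conv_power w n)) (carrier G)"
    by (simp add: norm_mult)
next
  show "(\<lambda>n. \<bar>sqrt_coeff n\<bar> * lp_norm 1 (carrier G) (conv_power w n)) summable_on UNIV"
    by (rule summable_on_comparison_test[OF sqrt_coeff_summable])
      (auto intro: mult_left_le conv_power_norm simp: lp_norm_nonneg)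
qed auto

lemma conv_sqrt_l1: "conv_sqrt w \<in> l1"
proof -
  have sw: "(\<lambda>(t, n). cmod (of_real (sqrt_coeff n) * conv_power w n t)) summable_on carrier G \<times> UNIV"
    using series_summable by (subst summable_on_swap) (simp add: case_prod_unfold)
  have abs: "(\<lambda>n. cmod (of_real (sqrt_coeff n) * conv_power w n t)) summable_on UNIV" if "t \<in> carrier G" for t
    by (rule summable_on_SigmaD1[OF sw that])
  have "(\<lambda>t. \<Sum>\<^sub>\<infinity>n. cmod (of_real (sqrt_coeff n) * conv_power w n t)) summable_on carrier G"
    using summable_on_SigmaD[OF sw] abs by simp
  then have "(\<lambda>t. cmod (conv_sqrt w t)) summable_on carrier G"
    by (rule summable_on_comparison_test) (auto simp: conv_sqrt_def intro!: norm_infsum_bound abs)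
  moreover have "conv_sqrt w s = 0" if "s \<notin> carrier G" for s
    using lp_space_off[OF conv_power_l1 that] by (simp add: conv_sqrt_def)
  ultimately show ?thesis by (simp add: lp_space_def)
qed

lemma conv_sqrt_left:
  assumes h: "\<And>s. cmod (h s) \<le> M" and s: "s \<in> carrier G"
  shows "conv G (conv_sqrt w) h s = (\<Sum>\<^sub>\<infinity>n. of_real (sqrt_coeff n) * conv G (conv_power w n) h s)"
proof -
  let ?k = "\<lambda>n t. of_real (sqrt_coeff n) * conv_power w n t * h (inv t \<otimes> s)"
  have "(\<lambda>x. M * (case x of (n, t) \<Rightarrow> cmod (of_real (sqrt_coeff n) * conv_power w n t)))
      summable_on UNIV \<times> carrier G"
    by (rule summable_on_cmult_right[OF series_summable])
  then have "(\<lambda>x. cmod (case x of (n, t) \<Rightarrow> ?k n t)) summable_on UNIV \<times> carrier G"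
  proof (rule summable_on_comparison_test)
    fix x :: "nat \<times> 'a"
    obtain n t where x: "x = (n, t)" by (cases x)
    show "cmod (case x of (n, t) \<Rightarrow> ?k n t)
        \<le> M * (case x of (n, t) \<Rightarrow> cmod (of_real (sqrt_coeff n) * conv_power w n t))"
      using mult_left_mono[OF h[of "inv t \<otimes> s"], of "cmod (of_real (sqrt_coeff n) * conv_power w n t)"]
      unfolding x prod.case norm_mult by (simp only: mult_ac norm_ge_zero mult_nonneg_nonneg)
  qed simp
  then have sm: "(\<lambda>(n, t). ?k n t) summable_on UNIV \<times> carrier G"
    by (rule abs_summable_summable)
  have "conv G (conv_sqrt w) h s = (\<Sum>\<^sub>\<infinity>t\<in>carrier G. \<Sum>\<^sub>\<infinity>n. ?k n t)"
    using s by (simp add: conv_def conv_sqrt_def infsum_cmult_left')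
  also have "\<dots> = (\<Sum>\<^sub>\<infinity>n. \<Sum>\<^sub>\<infinity>t\<in>carrier G. ?k n t)"
    by (rule infsum_swap_banach[symmetric, OF sm])
  also have "\<dots> = (\<Sum>\<^sub>\<infinity>n. of_real (sqrt_coeff n) * conv G (conv_power w n) h s)"
    using s by (simp add: conv_def mult.assoc infsum_cmult_right')
  finally show ?thesis .
qed

lemma conv_sqrt_right:
  assumes f: "f \<in> l1" and s: "s \<in> carrier G"
  shows "conv G f (conv_sqrt w) s = (\<Sum>\<^sub>\<infinity>n. of_real (sqrt_coeff n) * conv G f (conv_power w n) s)"
proof -
  let ?k = "\<lambda>t n. f t * (of_real (sqrt_coeff n) * conv_power w n (inv t \<otimes> s))"
  have "(\<lambda>(t, n). cmod (f t) * \<bar>sqrt_coeff n\<bar>) summable_on carrier G \<times> UNIV"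
  proof (rule summable_on_SigmaI)
    show "((\<lambda>n. case (t, n) of (t, n) \<Rightarrow> cmod (f t) * \<bar>sqrt_coeff n\<bar>) has_sum
        cmod (f t) * (\<Sum>\<^sub>\<infinity>n. \<bar>sqrt_coeff n\<bar>)) UNIV" for t
      unfolding prod.case by (intro has_sum_cmult_right has_sum_infsum sqrt_coeff_summable)
    show "(\<lambda>t. cmod (f t) * (\<Sum>\<^sub>\<infinity>n. \<bar>sqrt_coeff n\<bar>)) summable_on carrier G"
      by (intro summable_on_cmult_left l1_summable f)
  qed auto
  then have "(\<lambda>x. cmod (case x of (t, n) \<Rightarrow> ?k t n)) summable_on carrier G \<times> UNIV"
  proof (rule summable_on_comparison_test)
    fix x :: "'a \<times> nat"
    obtain t n where x: "x = (t, n)" by (cases x)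
    show "cmod (case x of (t, n) \<Rightarrow> ?k t n) \<le> (case x of (t, n) \<Rightarrow> cmod (f t) * \<bar>sqrt_coeff n\<bar>)"
      using mult_left_mono[OF mult_left_le[OF conv_power_le_1[of n "inv t \<otimes> s"], of "\<bar>sqrt_coeff n\<bar>"], of "cmod (f t)"]
      by (simp add: x norm_mult)
  qed simp
  then have sm: "(\<lambda>(t, n). ?k t n) summable_on carrier G \<times> UNIV"
    by (rule abs_summable_summable)
  have "conv G f (conv_sqrt w) s = (\<Sum>\<^sub>\<infinity>t\<in>carrier G. \<Sum>\<^sub>\<infinity>n. ?k t n)"
    using s by (simp add: conv_def conv_sqrt_def infsum_cmult_right')
  also have "\<dots> = (\<Sum>\<^sub>\<infinity>n. \<Sum>\<^sub>\<infinity>t\<in>carrier G. ?k t n)"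
    by (rule infsum_swap_banach[OF sm])
  also have "\<dots> = (\<Sum>\<^sub>\<infinity>n. of_real (sqrt_coeff n) * conv G f (conv_power w n) s)"
    using s by (simp add: conv_def mult.left_commute[of "f _"] infsum_cmult_right')
  finally show ?thesis .
qed

lemma commutes_conv_sqrt:
  assumes "commutes w h"
  shows "commutes (conv_sqrt w) h"
proof -
  have h: "h \<in> l1" using assms by (simp add: commutes_def)
  have "conv G (conv_power w n) h = conv G h (conv_power w n)" for n
    using commutes_conv_power[OF assms] by (simp add: commutes_def)
  then have "conv G (conv_sqrt w) h s = conv G h (conv_sqrt w) s" for s
    by (cases "s \<in> carrier G")
      (simp_all add: conv_off conv_sqrt_left[OF l1_le_norm[OF h]] conv_sqrt_right[OF h])
  then show ?thesis using h conv_sqrt_l1 by (auto simp: commutes_def)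
qed

text \<open>
  Collect the terms of equal degree in the double series and use \<open>sqrt_coeff_cauchy\<close>.
\<close>

lemma conv_sqrt_square: "conv G (conv_sqrt w) (conv_sqrt w) = (\<lambda>s. delta \<one> s + (-1) * w s)"
proof
  fix s
  show "conv G (conv_sqrt w) (conv_sqrt w) s = delta \<one> s + (-1) * w s"
  proof (cases "s \<in> carrier G")
    case s: True
    let ?a = "\<lambda>n. complex_of_real (sqrt_coeff n)" and ?p = "\<lambda>n. conv_power w n s"
    let ?t = "\<lambda>(m, n). ?a m * (?a n * ?p (m + n))"
    have "(\<lambda>(m, n). \<bar>sqrt_coeff m\<bar> * \<bar>sqrt_coeff n\<bar>) summable_on UNIV \<times> UNIV"
    proof (rule summable_on_SigmaI)
      show "((\<lambda>n. case (m, n) of (m, n) \<Rightarrow> \<bar>sqrt_coeff m\<bar> * \<bar>sqrt_coeff n\<bar>) has_sum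
          \<bar>sqrt_coeff m\<bar> * (\<Sum>\<^sub>\<infinity>n. \<bar>sqrt_coeff n\<bar>)) UNIV" for m
        unfolding prod.case by (intro has_sum_cmult_right has_sum_infsum sqrt_coeff_summable)
    qed (auto intro: summable_on_cmult_left sqrt_coeff_summable)
    then have "(\<lambda>x. cmod (?t x)) summable_on UNIV \<times> UNIV"
    proof (rule summable_on_comparison_test)
      fix x :: "nat \<times> nat"
      obtain m n where x: "x = (m, n)" by (cases x)
      show "cmod (?t x) \<le> (case x of (m, n) \<Rightarrow> \<bar>sqrt_coeff m\<bar> * \<bar>sqrt_coeff n\<bar>)"
        using mult_left_mono[OF mult_left_le[OF conv_power_le_1[of "m + n" s], of "\<bar>sqrt_coeff n\<bar>"], of "\<bar>sqrt_coeff m\<bar>"]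
        by (simp add: x norm_mult)
    qed simp
    then have sm: "?t summable_on UNIV \<times> UNIV" by (rule abs_summable_summable)
    have "conv G (conv_sqrt w) (conv_sqrt w) s = (\<Sum>\<^sub>\<infinity>m. ?a m * conv G (conv_power w m) (conv_sqrt w) s)"
      by (rule conv_sqrt_left[OF l1_le_norm[OF conv_sqrt_l1] s])
    also have "\<dots> = (\<Sum>\<^sub>\<infinity>m. \<Sum>\<^sub>\<infinity>n. ?t (m, n))"
      using s by (simp add: conv_sqrt_right[OF conv_power_l1] conv_power_add infsum_cmult_right')
    also have "\<dots> = infsum ?t (UNIV \<times> UNIV)"
      by (rule infsum_Sigma_banach[OF sm])
    also have "\<dots> = (\<Sum>\<^sub>\<infinity>(k, m)\<in>Sigma UNIV (\<lambda>k. {..k}). ?a m * (?a (k - m) * ?p k))"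
      by (rule infsum_reindex_bij_witness[of _ "\<lambda>(k, m). (m, k - m)" "\<lambda>(m, n). (m + n, m)"]) auto
    also have "\<dots> = (\<Sum>\<^sub>\<infinity>k. \<Sum>\<^sub>\<infinity>m\<in>{..k}. ?a m * (?a (k - m) * ?p k))"
    proof -
      have "(\<lambda>(k, m). ?a m * (?a (k - m) * ?p k)) summable_on Sigma UNIV (\<lambda>k. {..k})
          \<longleftrightarrow> ?t summable_on UNIV \<times> UNIV"
        by (rule summable_on_reindex_bij_witness[of _ "\<lambda>(m, n). (m + n, m)" "\<lambda>(k, m). (m, k - m)"]) auto
      then show ?thesis using sm infsum_Sigma_banach[of "\<lambda>(k, m). ?a m * (?a (k - m) * ?p k)" UNIV "\<lambda>k. {..k}"]
        by simp
    qed
    also have "\<dots> = (\<Sum>\<^sub>\<infinity>k. of_real (\<Sum>m\<le>k. sqrt_coeff m * sqrt_coeff (k - m)) * ?p k)"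
      by (simp add: sum_distrib_right mult.assoc)
    also have "\<dots> = (\<Sum>\<^sub>\<infinity>k\<in>{0, 1}. of_real (\<Sum>m\<le>k. sqrt_coeff m * sqrt_coeff (k - m)) * ?p k)"
      by (rule infsum_cong_neutral) (auto simp: sqrt_coeff_cauchy)
    also have "\<dots> = ?p 0 - ?p 1"
      by (simp add: sqrt_coeff_cauchy)
    finally show ?thesis
      using w by (simp add: conv_power_0 conv_power_Suc l1_unit)
  next
    case False
    then show ?thesis using lp_space_off[OF w] by (auto simp: conv_off delta_def)
  qed
qed

text \<open>
  The augmentation can be applied term by term, because it is a value of a convolution with a bounded function.
\<close>

lemma aug_conv_sqrt:
  assumes "aug w = 0"
  shows "aug (conv_sqrt w) = 1"
proof -
  let ?e = "\<lambda>r. if r \<in> carrier G then 1 else 0 :: complex"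
  have power: "aug (conv_power w n) = (if n = 0 then 1 else 0)" for n
    by (cases n) (simp_all add: conv_power_0 conv_power_Suc aug_delta aug_conv w conv_power_l1 assms)
  have "aug (conv_sqrt w) = conv G (conv_sqrt w) ?e \<one>"
    by (rule aug_eq_conv) simp
  also have "\<dots> = (\<Sum>\<^sub>\<infinity>n. of_real (sqrt_coeff n) * conv G (conv_power w n) ?e \<one>)"
    by (rule conv_sqrt_left[where M = 1]) auto
  also have "\<dots> = (\<Sum>\<^sub>\<infinity>n. of_real (sqrt_coeff n) * (if n = 0 then 1 else 0))"
    using aug_eq_conv[OF one_closed] power by simp
  also have "\<dots> = (\<Sum>\<^sub>\<infinity>n\<in>{0}. of_real (sqrt_coeff n) * (if n = 0 then 1 else 0))"
    by (rule infsum_cong_neutral) auto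
  finally show ?thesis by (simp add: sqrt_coeff_0)
qed

text \<open>
  The first two terms are \<open>1\<close> and \<open>-1/2 \<sqdot> 1/2\<close>, and the remaining coefficients have absolute sum at most \<open>1/2\<close>.
\<close>

lemma Re_conv_sqrt_pos:
  assumes "w \<one> = 1/2"
  shows "0 < Re (conv_sqrt w \<one>)"
proof -
  let ?t = "\<lambda>n. of_real (sqrt_coeff n) * conv_power w n \<one>"
  have le: "cmod (?t n) \<le> \<bar>sqrt_coeff n\<bar>" for n
    using mult_left_le[OF conv_power_le_1[of n \<one>], of "\<bar>sqrt_coeff n\<bar>"] by (simp add: norm_mult)
  have abs: "(\<lambda>n. cmod (?t n)) summable_on - {0, 1}"
    by (rule summable_on_comparison_test[OF sqrt_coeff_tail(1)]) (use le in auto)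
  have "conv_sqrt w \<one> = infsum ?t ({0, 1} \<union> - {0, 1})"
    by (simp add: conv_sqrt_def)
  also have "\<dots> = infsum ?t {0, 1} + infsum ?t (- {0, 1})"
    by (rule infsum_Un_disjoint) (use abs in \<open>auto intro: abs_summable_summable\<close>)
  also have "infsum ?t {0, 1} = 3/4"
  proof -
    have p0: "conv_power w 0 \<one> = 1" by (simp add: conv_power_0 delta_def)
    have p1: "conv_power w (Suc 0) \<one> = 1/2"
      using w assms by (simp add: conv_power_0 conv_power_Suc l1_unit)
    show ?thesis by (simp add: sqrt_coeff_0 sqrt_coeff_1[unfolded One_nat_def] p0 p1)
  qed
  finally have "conv_sqrt w \<one> = 3/4 + infsum ?t (- {0, 1})" .
  moreover have "cmod (infsum ?t (- {0, 1})) \<le> 1/2"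
  proof -
    have "cmod (infsum ?t (- {0, 1})) \<le> (\<Sum>\<^sub>\<infinity>n\<in>- {0, 1}. cmod (?t n))"
      by (rule norm_infsum_bound[OF abs])
    also have "\<dots> \<le> (\<Sum>\<^sub>\<infinity>n\<in>- {0, 1}. \<bar>sqrt_coeff n\<bar>)"
      by (intro infsum_mono abs sqrt_coeff_tail(1) le)
    also have "\<dots> \<le> 1/2" by (rule sqrt_coeff_tail(2))
    finally show ?thesis .
  qed
  then have "- 1/2 \<le> Re (infsum ?t (- {0, 1}))"
    using abs_Re_le_cmod[of "infsum ?t (- {0, 1})"] by linarith
  ultimately show ?thesis by simp
qed

end


section \<open>Zero divisors from commuting conjugates\<close>

context group
begin

text \<open>
  A character \<open>\<chi>\<close> of the subgroup generated by \<open>d\<close> with \<open>\<chi>(d) = e\<^sup>i\<^sup>\<theta>\<close> maps these elements of the group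
  algebra to \<open>cos \<theta>\<close>, \<open>sin\<^sup>2 \<theta>\<close>, \<open>|cos \<theta>|\<close>, and to twice the positive and negative part of
  \<open>cos \<theta>\<close>.
\<close>

definition cosine :: "'a \<Rightarrow> 'a \<Rightarrow> complex" where
  "cosine d = (\<lambda>s. (1/2) * (delta d s + 1 * delta (inv d) s))"

definition sine_squared :: "'a \<Rightarrow> 'a \<Rightarrow> complex" where
  "sine_squared d = (\<lambda>s. delta \<one> s + (-1) * conv G (cosine d) (cosine d) s)"

definition abs_cosine :: "'a \<Rightarrow> 'a \<Rightarrow> complex" where
  "abs_cosine d = conv_sqrt (sine_squared d)"

definition pos_cosine :: "'a \<Rightarrow> 'a \<Rightarrow> complex" where
  "pos_cosine d = (\<lambda>s. abs_cosine d s + 1 * cosine d s)"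

definition neg_cosine :: "'a \<Rightarrow> 'a \<Rightarrow> complex" where
  "neg_cosine d = (\<lambda>s. abs_cosine d s + (-1) * cosine d s)"

lemma cosine_l1: "d \<in> carrier G \<Longrightarrow> cosine d \<in> l1"
  unfolding cosine_def by (intro lp_space_scale l1_lin l1_delta) auto

lemma sine_squared_l1: "d \<in> carrier G \<Longrightarrow> sine_squared d \<in> l1"
  unfolding sine_squared_def by (intro l1_lin l1_delta l1_conv cosine_l1) auto

lemma aug_cosine: "d \<in> carrier G \<Longrightarrow> aug (cosine d) = 1"
  unfolding cosine_def aug_scale by (subst aug_lin) (simp_all add: l1_delta aug_delta)

lemma aug_sine_squared: "d \<in> carrier G \<Longrightarrow> aug (sine_squared d) = 0"
  unfolding sine_squared_def
  by (subst aug_lin) (simp_all add: l1_delta aug_delta aug_conv aug_cosine cosine_l1 l1_conv)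

text \<open>
  The explicit form shows that the \<open>\<ell>\<^sup>1\<close>-norm is at most \<open>1/2 + 1/4 + 1/4 = 1\<close>, and that the coefficient
  at \<open>e\<close> is \<open>1/2\<close> unless \<open>d\<^sup>2 = e\<close>.
\<close>

lemma sine_squared_eq:
  assumes "d \<in> carrier G"
  shows "sine_squared d s =
    (1/2) * delta \<one> s - (1/4) * delta (d \<otimes> d) s - (1/4) * delta (inv d \<otimes> inv d) s"
proof -
  have shift: "conv G (delta x) (cosine d) = (\<lambda>s. (1/2) * (delta (x \<otimes> d) s + 1 * delta (x \<otimes> inv d) s))"
    if "x \<in> carrier G" for x
    unfolding cosine_def conv_scale_right
    using that assms by (subst l1_conv_lin_right) (simp_all add: l1_delta conv_delta_delta)
  have "conv G (cosine d) (cosine d) = (\<lambda>s. (1/2) * (conv G (delta d) (cosine d) s + 1 * conv G (delta (inv d)) (cosine d) s))"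
    using l1_conv_lin_left[OF l1_delta[OF assms] l1_delta[OF inv_closed[OF assms]] cosine_l1[OF assms], of 1]
    by (simp only: cosine_def[of d] conv_scale_left)
  then show ?thesis
    using assms by (simp add: sine_squared_def shift algebra_simps)
qed

lemma l1_contraction_sine_squared:
  assumes d: "d \<in> carrier G"
  shows "l1_contraction G (sine_squared d)"
proof
  show "sine_squared d \<in> l1" by (rule sine_squared_l1[OF d])
  have delta_sum: "((\<lambda>s. cmod (delta x s)) has_sum 1) (carrier G)" if "x \<in> carrier G" for x
    by (rule has_sum_finite_neutralI[of "{x}"]) (use that in \<open>auto simp: delta_def\<close>)
  let ?g = "\<lambda>s. (1/2) * cmod (delta \<one> s) + (1/4) * cmod (delta (d \<otimes> d) s) + (1/4) * cmod (delta (inv d \<otimes> inv d) s)"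
  have g: "(?g has_sum (1/2) * 1 + (1/4) * 1 + (1/4) * 1) (carrier G)"
    using d by (intro has_sum_add has_sum_cmult_right delta_sum) auto
  have le: "cmod (sine_squared d s) \<le> ?g s" for s
    unfolding sine_squared_eq[OF d]
    by (rule order_trans[OF norm_triangle_ineq4] order_trans[OF add_right_mono[OF norm_triangle_ineq4]])+
      (simp add: norm_mult)
  have "lp_norm 1 (carrier G) (sine_squared d) \<le> infsum ?g (carrier G)"
    unfolding l1_norm
    by (intro infsum_mono le l1_summable sine_squared_l1 d has_sum_imp_summable[OF g])
  also have "\<dots> = 1" using infsumI[OF g] by simp
  finally show "lp_norm 1 (carrier G) (sine_squared d) \<le> 1" .
qed

lemma abs_cosine_l1: "d \<in> carrier G \<Longrightarrow> abs_cosine d \<in> l1"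
  unfolding abs_cosine_def by (rule l1_contraction.conv_sqrt_l1[OF l1_contraction_sine_squared])

lemma pos_cosine_l1: "d \<in> carrier G \<Longrightarrow> pos_cosine d \<in> l1"
  unfolding pos_cosine_def by (intro l1_lin abs_cosine_l1 cosine_l1)

lemma neg_cosine_l1: "d \<in> carrier G \<Longrightarrow> neg_cosine d \<in> l1"
  unfolding neg_cosine_def by (intro l1_lin abs_cosine_l1 cosine_l1)

lemma aug_pos_cosine: "d \<in> carrier G \<Longrightarrow> aug (pos_cosine d) = 2"
  unfolding pos_cosine_def
  by (subst aug_lin) (simp_all add: abs_cosine_l1 cosine_l1 aug_cosine abs_cosine_def
      l1_contraction.aug_conv_sqrt[OF l1_contraction_sine_squared] aug_sine_squared
      l1_contraction.conv_sqrt_l1[OF l1_contraction_sine_squared])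

lemma Re_neg_cosine_pos:
  assumes d: "d \<in> carrier G" "d \<noteq> \<one>" "d \<otimes> d \<noteq> \<one>"
  shows "0 < Re (neg_cosine d \<one>)"
proof -
  have ne: "inv d \<noteq> \<one>" "inv d \<otimes> inv d \<noteq> \<one>"
    using d by (simp_all flip: inv_mult_group add: inv_eq_1_iff)
  have "cosine d \<one> = 0" "sine_squared d \<one> = 1/2"
    by (simp_all only: cosine_def sine_squared_eq[OF d(1)])
      (simp_all add: delta_def d(2,3)[symmetric] ne[symmetric])
  then show ?thesis
    using l1_contraction.Re_conv_sqrt_pos[OF l1_contraction_sine_squared[OF d(1)]]
    by (simp add: neg_cosine_def abs_cosine_def)
qed

lemma commutes_sine_squared:
  assumes "commutes (cosine d) h"
  shows "commutes (sine_squared d) h"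
  using assms unfolding sine_squared_def
  by (intro commutes_lin commutes_conv commutes_unit) (auto simp: commutes_def)

lemma commutes_abs_cosine:
  assumes "d \<in> carrier G" "commutes (cosine d) h"
  shows "commutes (abs_cosine d) h"
  unfolding abs_cosine_def
  by (intro l1_contraction.commutes_conv_sqrt[OF l1_contraction_sine_squared] commutes_sine_squared assms)

lemma commutes_cosine:
  assumes d: "d \<in> carrier G" "e \<in> carrier G" and de: "d \<otimes> e = e \<otimes> d"
  shows "commutes (cosine d) (cosine e)"
proof -
  have inv_comm: "inv x \<otimes> y = y \<otimes> inv x"
    if "x \<in> carrier G" "y \<in> carrier G" "x \<otimes> y = y \<otimes> x" for x y
  proof -
    have "inv x \<otimes> y = inv x \<otimes> (y \<otimes> x) \<otimes> inv x" using that by (simp add: m_assoc)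
    also have "\<dots> = y \<otimes> inv x" using that by (simp flip: that(3))
    finally show ?thesis .
  qed
  have e: "commutes (delta x) (cosine e)"
    if "x \<in> carrier G" "x \<otimes> e = e \<otimes> x" for x
    unfolding cosine_def
    using that d inv_comm[of e x]
    by (intro commutes_sym[of _ "delta x"] commutes_scale commutes_lin commutes_delta) auto
  show ?thesis
    unfolding cosine_def[of d] using d de inv_comm[of d e]
    by (intro commutes_scale commutes_lin e) auto
qed

text \<open>
  With \<open>u\<close> and \<open>v\<close> for the absolute cosine and the cosine, \<open>(u - v) * (u + v) = u\<^sup>2 - v\<^sup>2 = 0\<close>.
\<close>

lemma neg_pos_cosine:
  assumes d: "d \<in> carrier G"
  shows "conv G (neg_cosine d) (pos_cosine d) = (\<lambda>s. 0)"
proof -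
  let ?U = "abs_cosine d" and ?V = "cosine d"
  note U = abs_cosine_l1[OF d] and V = cosine_l1[OF d]
  have "commutes ?U ?V"
    by (intro commutes_abs_cosine commutes_cosine d) simp
  then have UV: "conv G ?U ?V = conv G ?V ?U" by (simp add: commutes_def)
  have UU: "conv G ?U ?U = conv G ?V ?V"
    unfolding abs_cosine_def l1_contraction.conv_sqrt_square[OF l1_contraction_sine_squared[OF d]]
    by (simp add: sine_squared_def)
  have "conv G (neg_cosine d) (pos_cosine d)
      = (\<lambda>s. conv G ?U (pos_cosine d) s + (-1) * conv G ?V (pos_cosine d) s)"
    unfolding neg_cosine_def by (rule l1_conv_lin_left[OF U V pos_cosine_l1[OF d]])
  moreover have "conv G h (pos_cosine d) = (\<lambda>s. conv G h ?U s + 1 * conv G h ?V s)" if "h \<in> l1" for h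
    unfolding pos_cosine_def by (rule l1_conv_lin_right[OF that U V])
  ultimately show ?thesis using U V UU UV by simp
qed

lemma commutes_neg_pos_cosine:
  assumes "d \<in> carrier G" "e \<in> carrier G" "d \<otimes> e = e \<otimes> d"
  shows "commutes (neg_cosine d) (pos_cosine e)"
proof -
  have Ve: "commutes (cosine d) (cosine e)" by (rule commutes_cosine[OF assms])
  have U: "commutes (cosine d) (abs_cosine e)"
    by (rule commutes_sym, rule commutes_abs_cosine[OF assms(2)], rule commutes_sym, rule Ve)
  have "commutes h (pos_cosine e)" if "commutes h (cosine e)" "commutes h (abs_cosine e)" for h
    unfolding pos_cosine_def
    using that by (intro commutes_sym[of _ h] commutes_lin) (auto intro: commutes_sym)
  then show ?thesis
    unfolding neg_cosine_def using Ve U assms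
    by (intro commutes_lin) (auto intro: commutes_abs_cosine)
qed

text \<open>Conjugation acts on the group algebra by automorphisms.\<close>

lemma conv_conjugate:
  assumes x: "x \<in> carrier G"
    and f: "\<And>s. s \<in> carrier G \<Longrightarrow> f' (conjugate G x s) = f s"
    and h: "\<And>s. s \<in> carrier G \<Longrightarrow> h' (conjugate G x s) = h s"
    and s: "s \<in> carrier G"
  shows "conv G f' h' (conjugate G x s) = conv G f h s"
proof -
  have "(\<Sum>\<^sub>\<infinity>t\<in>carrier G. f t * h (inv t \<otimes> s))
      = (\<Sum>\<^sub>\<infinity>t\<in>carrier G. f' t * h' (inv t \<otimes> conjugate G x s))"
  proof (rule infsum_reindex_bij_witness[of _ "conjugate G (inv x)" "conjugate G x"])
    fix t assume t: "t \<in> carrier G"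
    have "inv (conjugate G x t) \<otimes> conjugate G x s = conjugate G x (inv t \<otimes> s)"
      using x s t by (simp add: conjugate_def inv_mult_group m_assoc)
    then show "f' (conjugate G x t) * h' (inv (conjugate G x t) \<otimes> conjugate G x s) = f t * h (inv t \<otimes> s)"
      using x s t f h by simp
  qed (use x in auto)
  then show ?thesis using x s by (simp add: conv_def)
qed

lemma delta_conjugate:
  assumes "x \<in> carrier G" "d \<in> carrier G" "s \<in> carrier G"
  shows "delta (conjugate G x d) (conjugate G x s) = delta d s"
  using assms conjugate_inv(1)[of x] unfolding delta_def by metis

lemma cosine_conjugate:
  assumes "x \<in> carrier G" "d \<in> carrier G" "s \<in> carrier G"
  shows "cosine (conjugate G x d) (conjugate G x s) = cosine d s"
proof -
  have "inv (conjugate G x d) = conjugate G x (inv d)"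
    using assms by (simp add: conjugate_def inv_mult_group m_assoc)
  then show ?thesis using assms by (simp add: cosine_def delta_conjugate)
qed

lemma delta_one_conjugate:
  assumes "x \<in> carrier G" "s \<in> carrier G"
  shows "delta \<one> (conjugate G x s) = delta \<one> s"
  using delta_conjugate[OF assms(1) one_closed assms(2)] assms(1) by simp

lemma sine_squared_conjugate:
  assumes x: "x \<in> carrier G" and d: "d \<in> carrier G" and s: "s \<in> carrier G"
  shows "sine_squared (conjugate G x d) (conjugate G x s) = sine_squared d s"
proof -
  have "conv G (cosine (conjugate G x d)) (cosine (conjugate G x d)) (conjugate G x s)
      = conv G (cosine d) (cosine d) s"
    by (rule conv_conjugate[OF x _ _ s]) (rule cosine_conjugate[OF x d], assumption)+
  then show ?thesis by (simp add: sine_squared_def delta_one_conjugate x s)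
qed

lemma neg_cosine_conjugate:
  assumes x: "x \<in> carrier G" and d: "d \<in> carrier G" and s: "s \<in> carrier G"
  shows "neg_cosine (conjugate G x d) (conjugate G x s) = neg_cosine d s"
proof -
  have "conv_power (sine_squared (conjugate G x d)) n (conjugate G x r) = conv_power (sine_squared d) n r"
    if "r \<in> carrier G" for n r
    using that
  proof (induction n arbitrary: r)
    case 0
    then show ?case by (simp add: conv_power_0 delta_one_conjugate x)
  next
    case (Suc n)
    show ?case
      unfolding conv_power_Suc
      by (rule conv_conjugate[OF x _ _ Suc.prems])
        (rule sine_squared_conjugate[OF x d], assumption, rule Suc.IH, assumption)
  qed
  then show ?thesis
    using s by (simp add: neg_cosine_def abs_cosine_def conv_sqrt_def cosine_conjugate[OF x d s])
qed

lemma conv_sum_left: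
  assumes "finite D" "\<And>d. d \<in> D \<Longrightarrow> f d \<in> l1" "h \<in> l1"
  shows "conv G (\<lambda>s. \<Sum>d\<in>D. f d s) h = (\<lambda>s. \<Sum>d\<in>D. conv G (f d) h s)"
  using assms(1,2)
proof (induction D)
  case empty
  then show ?case by (simp add: conv_zero_left)
next
  case (insert d D)
  have "(\<lambda>s. \<Sum>d\<in>D. f d s) \<in> l1" using insert by (intro lp_space_sum) auto
  then show ?case
    using insert l1_conv_lin_left[of "f d" "\<lambda>s. \<Sum>d\<in>D. f d s" h 1] assms(3) by simp
qed

text \<open>
  Summing \<open>neg_cosine\<close> over the invariant set \<open>D\<close> gives a class function \<open>b\<close>.  The product \<open>a\<close> of
  \<open>pos_cosine\<close> over \<open>D\<close> contains, for each summand of \<open>b\<close>, a factor that this summand annihilates; it can be moved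
  there because the elements of \<open>D\<close> commute.
\<close>

lemma not_weak_star_simple_if_commuting_conjugates:
  assumes D: "finite D" "D \<subseteq> carrier G" "D \<noteq> {}"
    and invariant: "\<And>x d. x \<in> carrier G \<Longrightarrow> d \<in> D \<Longrightarrow> conjugate G x d \<in> D"
    and commute: "\<And>d e. d \<in> D \<Longrightarrow> e \<in> D \<Longrightarrow> d \<otimes> e = e \<otimes> d"
    and order: "\<And>d. d \<in> D \<Longrightarrow> d \<noteq> \<one>" "\<And>d. d \<in> D \<Longrightarrow> d \<otimes> d \<noteq> \<one>"
    and p: "1 \<le> p"
  shows "\<not> weak_star_simple p G"
proof -
  have DG: "d \<in> carrier G" if "d \<in> D" for d using D that by auto
  define b where "b = (\<lambda>s. \<Sum>d\<in>D. neg_cosine d s)"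
  define a where "a ds = foldr (\<lambda>d r. conv G (pos_cosine d) r) ds (delta \<one>)" for ds
  have a_l1: "a ds \<in> l1" if "set ds \<subseteq> D" for ds
    using that by (induction ds) (auto simp: a_def l1_delta DG intro!: l1_conv pos_cosine_l1)
  have a_aug: "aug (a ds) = 2 ^ length ds" if "set ds \<subseteq> D" for ds
    using that
  proof (induction ds)
    case Nil
    then show ?case by (simp add: a_def aug_delta)
  next
    case (Cons d ds)
    have "aug (a (d # ds)) = aug (pos_cosine d) * aug (a ds)"
      using Cons.prems a_l1[of ds] by (simp add: a_def aug_conv pos_cosine_l1 DG)
    then show ?case using Cons by (simp add: aug_pos_cosine DG)
  qed
  have kill: "conv G (neg_cosine e) (a ds) = (\<lambda>s. 0)" if "set ds \<subseteq> D" "e \<in> set ds" for e ds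
    using that
  proof (induction ds)
    case (Cons d ds)
    have d: "d \<in> D" and e: "e \<in> D" and ds: "set ds \<subseteq> D" using Cons.prems by auto
    note l = neg_cosine_l1[OF DG[OF e]] pos_cosine_l1[OF DG[OF d]] a_l1[OF ds]
    have step: "conv G (neg_cosine e) (a (d # ds)) = conv G (conv G (neg_cosine e) (pos_cosine d)) (a ds)"
      using l1_assoc[OF l] by (simp add: a_def)
    show ?case
    proof (cases "e = d")
      case True
      then show ?thesis unfolding step by (simp add: neg_pos_cosine DG d conv_zero_left)
    next
      case False
      have "conv G (neg_cosine e) (pos_cosine d) = conv G (pos_cosine d) (neg_cosine e)"
        using commutes_neg_pos_cosine[OF DG[OF e] DG[OF d] commute[OF e d]] by (simp add: commutes_def)
      then have "conv G (neg_cosine e) (a (d # ds)) = conv G (pos_cosine d) (conv G (neg_cosine e) (a ds))"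
        using step l1_assoc[OF l(2,1,3)] by simp
      also have "conv G (neg_cosine e) (a ds) = (\<lambda>s. 0)"
        using Cons False by auto
      finally show ?thesis by (simp add: conv_zero_right)
    qed
  qed simp
  obtain ds where ds: "set ds = D" using finite_list[OF D(1)] by blast
  have a1: "a ds \<in> l1" using a_l1 ds by simp
  show ?thesis
  proof (rule not_weak_star_simple_if_zero_divisors[OF a1 _ _ _ _ _ p])
    show "a ds \<noteq> (\<lambda>s. 0)"
    proof
      assume "a ds = (\<lambda>s. 0)"
      then have "aug (a ds) = 0" by (simp add: aug_def)
      then show False using a_aug[of ds] ds by simp
    qed
    show "b \<in> l1"
      unfolding b_def using D(1) by (intro lp_space_sum neg_cosine_l1 DG) auto
    have "Re (b \<one>) = (\<Sum>d\<in>D. Re (neg_cosine d \<one>))" by (simp add: b_def)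
    also have "\<dots> > 0"
      using D by (intro sum_pos Re_neg_cosine_pos DG order) auto
    finally show "b \<noteq> (\<lambda>s. 0)" by auto
    show "class_function b"
      unfolding class_function_def
    proof (intro ballI)
      fix x s assume x: "x \<in> carrier G" and s: "s \<in> carrier G"
      have "b s = (\<Sum>d\<in>D. neg_cosine (conjugate G x d) (conjugate G x s))"
        unfolding b_def by (intro sum.cong) (simp_all add: neg_cosine_conjugate x s DG)
      also have "\<dots> = b (conjugate G x s)"
        unfolding b_def
        by (rule sum.reindex_bij_witness[of _ "conjugate G (inv x)" "conjugate G x"])
          (use x invariant DG in auto)
      finally show "b (conjugate G x s) = b s" by simp
    qed
    show "conv G b (a ds) = (\<lambda>s. 0)"
      unfolding b_def using D(1) a1 kill[of ds] ds
      by (subst conv_sum_left) (auto intro: neg_cosine_l1 DG)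
  qed
qed

end

section \<open>Simplicity and the ICC condition\<close>

lemma (in group) not_weak_star_simple_if_not_ICC:
  assumes "\<not> ICC_group G" and p: "1 \<le> p"
  shows "\<not> weak_star_simple p G"
proof -
  obtain x where x: "x \<in> carrier G" "x \<noteq> \<one>" "finite {conjugate G g x | g. g \<in> carrier G}"
    using assms(1) unfolding ICC_group_iff by blast
  define C where "C = {conjugate G g x | g. g \<in> carrier G}"
  have CI: "conjugate G g x \<in> C" if "g \<in> carrier G" for g using that by (auto simp: C_def)
  have xC: "x \<in> C" using CI[OF one_closed] x(1) by simp
  interpret C: finite_invariant_subset G C
  proof
    show "finite C" using x(3) by (simp add: C_def)
    show "C \<subseteq> carrier G" using x(1) by (auto simp: C_def)
    show "conjugate G y c \<in> C" if y: "y \<in> carrier G" and "c \<in> C" for y c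
    proof -
      obtain g where g: "g \<in> carrier G" "c = conjugate G g x" using \<open>c \<in> C\<close> unfolding C_def by blast
      then have "conjugate G y c = conjugate G (y \<otimes> g) x" using x(1) y by (simp add: conjugate_mult)
      then show ?thesis using g y CI by simp
    qed
  qed
  have pow_conj: "c [^] n = \<one> \<longleftrightarrow> x [^] n = \<one>" if c: "c \<in> C" for c and n :: nat
  proof -
    obtain g where g: "g \<in> carrier G" "c = conjugate G g x" using c unfolding C_def by blast
    have "c [^] n = conjugate G g (x [^] n)" using g x(1) by (simp add: conjugate_pow)
    moreover have "conjugate G (inv g) (conjugate G g (x [^] n)) = x [^] n" using g x(1) by simp
    ultimately show ?thesis using g(1) by auto
  qed
  show ?thesis
  proof (cases "\<exists>n>0. x [^] (n::nat) = \<one>")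
    case True
    then obtain n :: nat where n: "0 < n" "x [^] n = \<one>" by blast
    let ?N = "C.word ` {ws. set ws \<subseteq> C}"
    show ?thesis
    proof (rule not_weak_star_simple_if_finite_normal[of ?N x])
      show "finite ?N" using C.finite_words[OF n(1)] pow_conj n(2) by blast
      show "?N \<subseteq> carrier G" by auto
      show "\<one> \<in> ?N" by (intro image_eqI[of _ _ "[]"]) auto
      show "x \<in> ?N" using xC by (intro image_eqI[of _ _ "[x]"]) auto
      show "g \<otimes> h \<in> ?N" if gh: "g \<in> ?N" "h \<in> ?N" for g h
      proof -
        obtain us vs where "set us \<subseteq> C" "g = C.word us" "set vs \<subseteq> C" "h = C.word vs"
          using gh by blast
        then show ?thesis by (intro image_eqI[of _ _ "us @ vs"]) (auto simp: C.word_append)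
      qed
      show "conjugate G y g \<in> ?N" if y: "y \<in> carrier G" and g: "g \<in> ?N" for y g
      proof -
        obtain us where us: "set us \<subseteq> C" "g = C.word us" using g by blast
        then show ?thesis using y
          by (intro image_eqI[of _ _ "map (conjugate G y) us"]) (auto simp: C.word_conjugate intro: C.C_invariant)
      qed
    qed (use x p in auto)
  next
    case False
    define m :: nat where "m = fact (card C)"
    have m: "0 < m" by (simp add: m_def)
    let ?D = "(\<lambda>c. c [^] m) ` C"
    show ?thesis
    proof (rule not_weak_star_simple_if_commuting_conjugates[of ?D])
      show "finite ?D" "?D \<noteq> {}" using C.finite_C xC by auto
      show "?D \<subseteq> carrier G" by auto
      show "conjugate G y d \<in> ?D" if y: "y \<in> carrier G" and "d \<in> ?D" for y d
      proof -
        obtain c where "c \<in> C" "d = c [^] m" using \<open>d \<in> ?D\<close> by blast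
        then show ?thesis using y C.C_invariant by (auto simp: conjugate_pow)
      qed
      show "d \<otimes> e = e \<otimes> d" if de: "d \<in> ?D" "e \<in> ?D" for d e
      proof -
        obtain c c' where c: "c \<in> C" "c' \<in> C" "d = c [^] m" "e = c' [^] m" using de by blast
        have "conjugate G d e = conjugate G d c' [^] m" using c by (simp add: conjugate_pow)
        also have "\<dots> = e" using C.power_commute[OF c(1,2)] c by (simp add: m_def)
        finally show ?thesis using c by (intro commute_if_conjugate_fixed) auto
      qed
      show "d \<noteq> \<one>" if d: "d \<in> ?D" for d
      proof -
        obtain c where c: "c \<in> C" "d = c [^] m" using d by blast
        have "x [^] m \<noteq> \<one>" using False m by blast
        then show ?thesis using pow_conj[OF c(1), of m] c(2) by simp
      qed
      show "d \<otimes> d \<noteq> \<one>" if d: "d \<in> ?D" for d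
      proof -
        obtain c where c: "c \<in> C" "d = c [^] m" using d by blast
        then have dd: "d \<otimes> d = c [^] (m + m)" by (simp add: nat_pow_mult)
        have "x [^] (m + m) \<noteq> \<one>" using False m by (metis add_gr_0)
        then show ?thesis using pow_conj[OF c(1), of "m + m"] dd by simp
      qed
    qed (use p in auto)
  qed
qed

theorem theorem1p1:
  fixes G :: "('a, 'b) monoid_scheme" and p :: real
  assumes "group G" and "1 \<le> p"
  shows "weak_star_simple p G \<longleftrightarrow> ICC_group G"
proof -
  interpret group G by fact
  show ?thesis
    using weak_star_simple_if_ICC not_weak_star_simple_if_not_ICC assms(2) by blast
qed

end
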